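(* The normalized Haar system $(h_I/\|h_I\|_{L^1})_{I\in\mathcal D^+}$ of $L^1=L^1[0,1]$ is $1$-strategically reproducible.
   Context: All Banach spaces are real. $\mathcal D$ is the set of dyadic intervals $[\frac{i-1}{2^j},\frac{i}{2^j})$, $j\ge0$, $1\le i\le2^j$; for $I\in\mathcal D$ with left half $I^+$ and right half $I^-$, $h_I=\chi_{I^+}-\chi_{I^-}$. $\mathcal D^+=\mathcal D\cup\{\emptyset\}$, $h_\emptyset=\chi_{[0,1)}$. $\mathcal D^+$ is enumerated by letting $\emptyset$ be the first element, followed by the elements of $\mathcal D$ in the order given by $[\frac{i-1}{2^j},\frac i{2^j})\mapsto2^j+i-1$; with this order $(h_I)_{I\in\mathcal D^+}$ is a monotone Schauder basis of $L^1$. Impartial equivalence: sequences $(x_i)$, $(y_i)$ in Banach spaces are impartially $C$-equivalent if $\frac1{\sqrt C}\|\sum a_iy_i\|\le\|\sum a_ix_i\|\le\sqrt C\|\sum a_iy_i\|$ for all finitely supported real sequences $(a_i)$. Strategical reproducibility. Let $X$ be a Banach space with a normalized Schauder basis $(e_i)_{i\in\mathbb N}$ and biorthogonal functionals $(e_i^* )\subset X^*$. $\mathrm{cof}(X)$ is the set of closed finite-codimensional subspaces of $X$; $\mathrm{cof}_{w^*}(X^* )$ is the set of $w^*$-closed finite-codimensional subspaces of $X^*$. For $C\ge1$, $\eta>0$ the two-player game $\mathrm{Rep}_{(X,(e_i))}(C,\eta)$ is as follows. Before the first turn player (I) chooses a partition $\mathbb N=N_1\cup N_2$. For $k\in\mathbb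 N$, turn $k$ has three steps. Step 1: player (I) chooses $\eta_k>0$, $W_k\in\mathrm{cof}(X)$, $G_k\in\mathrm{cof}_{w^*}(X^* )$. Step 2: player (II) chooses $i_k\in\{1,2\}$, a finite set $E_k\subset N_{i_k}$ and non-negative reals $(\lambda_i^{(k)})_{i\in E_k}$, $(\mu_i^{(k)})_{i\in E_k}$ with $1-\eta<\sum_{i\in E_k}\lambda_i^{(k)}\mu_i^{(k)}<1+\eta$. Step 3: player (I) chooses signs $(\varepsilon_i^{(k)})_{i\in E_k}\in\{-1,1\}^{E_k}$. Put $x_k=\sum_{i\in E_k}\varepsilon_i^{(k)}\lambda_i^{(k)}e_i$ and $x_k^*=\sum_{i\in E_k}\varepsilon_i^{(k)}\mu_i^{(k)}e_i^*$. Player (II) wins if: (i) $(x_k)_k$ and $(e_k)_k$ are impartially $(C+\eta)$-equivalent; (ii) $(x_k^* )_k$ and $(e_k^* )_k$ are impartially $(C+\eta)$-equivalent; (iii) $\mathrm{dist}(x_k,W_k)<\eta_k$ for all $k$; (iv) $\mathrm{dist}(x_k^*,G_k)<\eta_k$ for all $k$. The basis $(e_i)_i$ is $C$-strategically reproducible in $X$ if for every $\eta>0$ player (II) has a winning strategy in $\mathrm{Rep}_{(X,(e_i))}(C,\eta)$. *)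

theory Defs
  imports "HOL-Analysis.Analysis" "HOL-Library.Discrete_Functions"
begin

section \<open>The Banach space $L^1[0,1]$\<close>

abbreviation unit_lebesgue :: "real measure"
  where "unit_lebesgue \<equiv> lebesgue_on {0..1}"

definition L1_rel :: "(real \<Rightarrow> real) \<Rightarrow> (real \<Rightarrow> real) \<Rightarrow> bool"
  where "L1_rel f g \<longleftrightarrow>
    integrable unit_lebesgue f \<and> integrable unit_lebesgue g \<and> (AE x in unit_lebesgue. f x = g x)"

lemma part_equivp_L1_rel: "part_equivp L1_rel"
proof (rule part_equivpI)
  show "\<exists>f. L1_rel f f"
    by (rule exI[of _ "\<lambda>_. 0"]) (simp add: L1_rel_def)
  show "symp L1_rel"
    by (rule sympI) (auto simp: L1_rel_def)
  show "transp L1_rel"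
  proof (rule transpI)
    fix f g h assume "L1_rel f g" "L1_rel g h"
    then have "AE x in unit_lebesgue. f x = g x" "AE x in unit_lebesgue. g x = h x"
      by (auto simp: L1_rel_def)
    then have "AE x in unit_lebesgue. f x = h x" by eventually_elim simp
    with \<open>L1_rel f g\<close> \<open>L1_rel g h\<close> show "L1_rel f h" by (auto simp: L1_rel_def)
  qed
qed

quotient_type L1 = "real \<Rightarrow> real" / partial: L1_rel
  morphisms rep_L1 abs_L1
  by (rule part_equivp_L1_rel)

instantiation L1 :: real_normed_vector
begin

lift_definition norm_L1 :: "L1 \<Rightarrow> real"
  is "\<lambda>f. LINT x|unit_lebesgue. \<bar>f x\<bar>"
  unfolding L1_rel_def by (intro integral_cong_AE) auto

lift_definition zero_L1 :: L1 is "\<lambda>_. 0"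
  by (simp add: L1_rel_def)

lift_definition plus_L1 :: "L1 \<Rightarrow> L1 \<Rightarrow> L1" is "\<lambda>f g x. f x + g x"
  unfolding L1_rel_def by auto

lift_definition minus_L1 :: "L1 \<Rightarrow> L1 \<Rightarrow> L1" is "\<lambda>f g x. f x - g x"
  unfolding L1_rel_def by auto

lift_definition uminus_L1 :: "L1 \<Rightarrow> L1" is "\<lambda>f x. - f x"
  unfolding L1_rel_def by auto

lift_definition scaleR_L1 :: "real \<Rightarrow> L1 \<Rightarrow> L1" is "\<lambda>c f x. c * f x"
  unfolding L1_rel_def by auto

definition dist_L1 :: "L1 \<Rightarrow> L1 \<Rightarrow> real"
  where "dist_L1 f g = norm (f - g)"

definition sgn_L1 :: "L1 \<Rightarrow> L1"
  where "sgn_L1 f = scaleR (inverse (norm f)) f"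

definition uniformity_L1 :: "(L1 \<times> L1) filter"
  where "uniformity_L1 = (INF e\<in>{0 <..}. principal {(x, y). dist x y < e})"

definition open_L1 :: "L1 set \<Rightarrow> bool"
  where "open_L1 S = (\<forall>x\<in>S. \<forall>\<^sub>F (x', y) in uniformity. x' = x \<longrightarrow> y \<in> S)"

instance
proof
  fix f g h :: L1 and a b :: real
  show "f + g + h = f + (g + h)"
    by transfer (auto simp: L1_rel_def add.assoc)
  show "f + g = g + f"
    by transfer (auto simp: L1_rel_def add.commute)
  show "0 + f = f"
    by transfer (auto simp: L1_rel_def)
  show "- f + f = 0"
    by transfer (auto simp: L1_rel_def)
  show "f - g = f + - g"
    by transfer (auto simp: L1_rel_def)
  show "a *\<^sub>R (f + g) = a *\<^sub>R f + a *\<^sub>R g"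
    by transfer (auto simp: L1_rel_def algebra_simps)
  show "(a + b) *\<^sub>R f = a *\<^sub>R f + b *\<^sub>R f"
    by transfer (auto simp: L1_rel_def algebra_simps)
  show "a *\<^sub>R b *\<^sub>R f = (a * b) *\<^sub>R f"
    by transfer (auto simp: L1_rel_def algebra_simps)
  show "1 *\<^sub>R f = f"
    by transfer (auto simp: L1_rel_def)
  show "norm f = 0 \<longleftrightarrow> f = 0"
  proof transfer
    fix f assume f: "L1_rel f f"
    then have "(LINT x|unit_lebesgue. \<bar>f x\<bar>) = 0 \<longleftrightarrow> (AE x in unit_lebesgue. \<bar>f x\<bar> = 0)"
      by (intro integral_nonneg_eq_0_iff_AE) (auto simp: L1_rel_def)
    with f show "(LINT x|unit_lebesgue. \<bar>f x\<bar>) = 0 \<longleftrightarrow> L1_rel f (\<lambda>_. 0)"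
      by (simp add: L1_rel_def)
  qed
  show "norm (f + g) \<le> norm f + norm g"
  proof transfer
    fix f g assume "L1_rel f f" "L1_rel g g"
    then have fg: "integrable unit_lebesgue f" "integrable unit_lebesgue g"
      by (auto simp: L1_rel_def)
    then have "(LINT x|unit_lebesgue. \<bar>f x + g x\<bar>) \<le> (LINT x|unit_lebesgue. \<bar>f x\<bar> + \<bar>g x\<bar>)"
      by (intro integral_mono) auto
    also have "\<dots> = (LINT x|unit_lebesgue. \<bar>f x\<bar>) + (LINT x|unit_lebesgue. \<bar>g x\<bar>)"
      using fg by (intro Bochner_Integration.integral_add) auto
    finally show "(LINT x|unit_lebesgue. \<bar>f x + g x\<bar>)
        \<le> (LINT x|unit_lebesgue. \<bar>f x\<bar>) + (LINT x|unit_lebesgue. \<bar>g x\<bar>)" .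
  qed
  show "norm (a *\<^sub>R f) = \<bar>a\<bar> * norm f"
    by transfer (simp add: abs_mult)
qed (rule dist_L1_def sgn_L1_def uniformity_L1_def open_L1_def)+

end

instance L1 :: banach
proof
  fix X :: "nat \<Rightarrow> L1" assume X: "Cauchy X"
  define s where "s n = rep_L1 (X n)" for n
  have s_rel: "L1_rel (s n) (s n)" and abs_s: "abs_L1 (s n) = X n" for n
    unfolding s_def
    by (rule Quotient_rep_reflp[OF Quotient_L1], rule Quotient_abs_rep[OF Quotient_L1])
  have int[measurable]: "integrable unit_lebesgue (s n)" for n
    using s_rel by (simp add: L1_rel_def)
  have dist_abs: "dist (abs_L1 f) (abs_L1 g) = (LINT x|unit_lebesgue. \<bar>f x - g x\<bar>)"
    if "integrable unit_lebesgue f" "integrable unit_lebesgue g" for f g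
    using that unfolding dist_norm
    by (simp add: minus_L1.abs_eq norm_L1.abs_eq L1_rel_def)
  have cau: "\<exists>N. \<forall>i\<ge>N. \<forall>j\<ge>N. (LINT x|unit_lebesgue. norm (s i x - s j x)) < e" if "e > 0" for e
    using X that unfolding Cauchy_def by (simp add: dist_abs[OF int int, unfolded abs_s])
  obtain r where r: "strict_mono r" "AE x in unit_lebesgue. Cauchy (\<lambda>i. s (r i) x)"
    using cauchy_L1_AE_cauchy_subseq[OF int cau] by blast
  define f where "f x = lim (\<lambda>i. s (r i) x)" for x
  have f_meas[measurable]: "f \<in> borel_measurable unit_lebesgue"
    unfolding f_def by measurable
  have lim: "AE x in unit_lebesgue. (\<lambda>i. s (r i) x) \<longlonglongrightarrow> f x"
    using r(2) by eventually_elim (simp add: f_def Cauchy_convergent_iff convergent_LIMSEQ_iff)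
  have fatou: "(\<integral>\<^sup>+x. norm (s n x - f x) \<partial>unit_lebesgue) \<le> ennreal e"
    if e: "e > 0" and N: "\<forall>i\<ge>N. \<forall>j\<ge>N. (LINT x|unit_lebesgue. norm (s i x - s j x)) < e"
      and n: "n \<ge> N" for n N e
  proof -
    have "(\<integral>\<^sup>+x. norm (s n x - f x) \<partial>unit_lebesgue)
        = (\<integral>\<^sup>+x. liminf (\<lambda>i. ennreal (norm (s n x - s (r i) x))) \<partial>unit_lebesgue)"
    proof (rule nn_integral_cong_AE)
      show "AE x in unit_lebesgue. ennreal (norm (s n x - f x))
          = liminf (\<lambda>i. ennreal (norm (s n x - s (r i) x)))"
        using lim
      proof eventually_elim
        fix x assume "(\<lambda>i. s (r i) x) \<longlonglongrightarrow> f x"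
        then have "(\<lambda>i. ennreal (norm (s n x - s (r i) x))) \<longlonglongrightarrow> ennreal (norm (s n x - f x))"
          by (intro tendsto_ennrealI tendsto_norm tendsto_diff tendsto_const)
        then show "ennreal (norm (s n x - f x)) = liminf (\<lambda>i. ennreal (norm (s n x - s (r i) x)))"
          by (rule lim_imp_Liminf[OF sequentially_bot, symmetric])
      qed
    qed
    also have "\<dots> \<le> liminf (\<lambda>i. \<integral>\<^sup>+x. ennreal (norm (s n x - s (r i) x)) \<partial>unit_lebesgue)"
      by (rule nn_integral_liminf) measurable
    also have "\<dots> \<le> limsup (\<lambda>i. \<integral>\<^sup>+x. ennreal (norm (s n x - s (r i) x)) \<partial>unit_lebesgue)"
      by (rule Liminf_le_Limsup) simp
    also have "\<dots> \<le> ennreal e"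
    proof (rule Limsup_bounded)
      show "\<forall>\<^sub>F i in sequentially.
          (\<integral>\<^sup>+x. ennreal (norm (s n x - s (r i) x)) \<partial>unit_lebesgue) \<le> ennreal e"
      proof (rule eventually_sequentiallyI[of N])
        fix i assume "i \<ge> N"
        then have "r i \<ge> N" using seq_suble[OF r(1), of i] by simp
        then have "(LINT x|unit_lebesgue. norm (s n x - s (r i) x)) < e" using N n by blast
        moreover have "(\<integral>\<^sup>+x. ennreal (norm (s n x - s (r i) x)) \<partial>unit_lebesgue)
            = ennreal (LINT x|unit_lebesgue. norm (s n x - s (r i) x))"
          using int by (intro nn_integral_eq_integral) auto
        ultimately show "(\<integral>\<^sup>+x. ennreal (norm (s n x - s (r i) x)) \<partial>unit_lebesgue) \<le> ennreal e"
          by (simp add: ennreal_leI)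
      qed
    qed
    finally show ?thesis .
  qed
  obtain N where N: "\<forall>i\<ge>N. \<forall>j\<ge>N. (LINT x|unit_lebesgue. norm (s i x - s j x)) < 1"
    using cau[of 1] by auto
  have "integrable unit_lebesgue (\<lambda>x. s N x - f x)"
    using fatou[OF _ N, of N]
    by (intro integrableI_bounded) (auto simp: le_less_trans[OF _ ennreal_one_less_top])
  then have "integrable unit_lebesgue (\<lambda>x. s N x - (s N x - f x))"
    by (rule Bochner_Integration.integrable_diff[OF int])
  then have f_int: "integrable unit_lebesgue f" by (simp only: diff_diff_eq2 add_diff_cancel_left')
  have "X \<longlonglongrightarrow> abs_L1 f"
  proof (rule metric_LIMSEQ_I)
    fix e :: real assume e: "e > 0"
    obtain N where N: "\<forall>i\<ge>N. \<forall>j\<ge>N. (LINT x|unit_lebesgue. norm (s i x - s j x)) < e / 2"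
      using cau[of "e / 2"] e by auto
    have "dist (X n) (abs_L1 f) < e" if "n \<ge> N" for n
    proof -
      have "ennreal (LINT x|unit_lebesgue. norm (s n x - f x))
          = (\<integral>\<^sup>+x. norm (s n x - f x) \<partial>unit_lebesgue)"
        using int f_int by (intro nn_integral_eq_integral[symmetric]) auto
      also have "\<dots> \<le> ennreal (e / 2)" using fatou[OF _ N that] e by simp
      finally have "(LINT x|unit_lebesgue. norm (s n x - f x)) \<le> e / 2" using e by simp
      then show ?thesis using e dist_abs[OF int f_int, of n] by (simp add: abs_s)
    qed
    then show "\<exists>N. \<forall>n\<ge>N. dist (X n) (abs_L1 f) < e" by blast
  qed
  then show "convergent X" by (auto simp: convergent_def)
qed

section \<open>The Haar system\<close>

definition dyadic :: "nat \<Rightarrow> nat \<Rightarrow> real set"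
  where "dyadic j i = {(real i - 1) / 2 ^ j ..< real i / 2 ^ j}"

definition dyadic_intervals :: "real set set"
  where "dyadic_intervals = {dyadic j i |j i. 1 \<le> i \<and> i \<le> 2 ^ j}"

definition dyadic_intervals_plus :: "real set set"
  where "dyadic_intervals_plus = insert {} dyadic_intervals"

text \<open>Every \<^term>\<open>n \<ge> 1\<close> is uniquely of the form \<^term>\<open>2 ^ j + i - 1\<close> with
  \<^term>\<open>1 \<le> i \<and> i \<le> 2 ^ j\<close>, namely for \<^term>\<open>j = floor_log n\<close>; the empty set is put at 0.\<close>

definition dyadic_enum :: "nat \<Rightarrow> real set"
  where "dyadic_enum n =
    (if n = 0 then {} else dyadic (floor_log n) (n + 1 - 2 ^ floor_log n))"

definition left_half :: "real set \<Rightarrow> real set"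
  where "left_half I = {x \<in> I. x < (Inf I + Sup I) / 2}"

definition right_half :: "real set \<Rightarrow> real set"
  where "right_half I = {x \<in> I. (Inf I + Sup I) / 2 \<le> x}"

definition haar_fun :: "real set \<Rightarrow> real \<Rightarrow> real"
  where "haar_fun I x =
    (if I = {} then indicator {0..<1} x
     else indicator (left_half I) x - indicator (right_half I) x)"

definition normalized_haar :: "nat \<Rightarrow> L1"
  where "normalized_haar n =
    (let h = abs_L1 (haar_fun (dyadic_enum n)) in h /\<^sub>R norm h)"

lemma dyadic_enum_eq:
  assumes "1 \<le> i" "i \<le> 2 ^ j"
  shows "dyadic_enum (2 ^ j + i - 1) = dyadic j i"
proof -
  have "floor_log (2 ^ j + i - 1) = j"
    using assms by (intro floor_log_eqI) auto
  then show ?thesis using assms by (auto simp: dyadic_enum_def)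
qed

lemma dyadic_nonempty: "dyadic j i \<noteq> {}"
  by (simp add: dyadic_def divide_strict_right_mono)

lemma dyadic_inject:
  assumes "dyadic j i = dyadic k l"
  shows "j = k \<and> i = l"
proof -
  have lt: "(real i - 1) / 2 ^ j < real i / 2 ^ j" for i j
    by (simp add: divide_strict_right_mono)
  have eq: "(real i - 1) / 2 ^ j = (real l - 1) / 2 ^ k" "real i / 2 ^ j = real l / 2 ^ k"
    using assms lt[of i j] lt[of l k] unfolding dyadic_def by (simp_all add: Ico_eq_Ico)
  then have "1 / 2 ^ j = (1 / 2 ^ k :: real)" by (simp add: diff_divide_distrib)
  then have "j = k" by simp
  with eq(2) show ?thesis by simp
qed

lemma bij_betw_dyadic_enum: "bij_betw dyadic_enum UNIV dyadic_intervals_plus"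
proof -
  have pos: "\<exists>j i. 1 \<le> i \<and> i \<le> 2 ^ j \<and> n = 2 ^ j + i - 1" if "n \<noteq> 0" for n :: nat
    using that floor_log_exp2_le[of n] floor_log_exp2_gt[of n]
    by (intro exI[of _ "floor_log n"] exI[of _ "n + 1 - 2 ^ floor_log n"]) auto
  have "inj dyadic_enum"
  proof (rule injI)
    fix m n assume eq: "dyadic_enum m = dyadic_enum n"
    have zero: "dyadic_enum k = {} \<longleftrightarrow> k = 0" for k
      by (simp add: dyadic_enum_def dyadic_nonempty)
    show "m = n"
    proof (cases "m = 0 \<or> n = 0")
      case True
      then show ?thesis using eq zero by metis
    next
      case False
      then obtain j i k l where
        m: "1 \<le> i" "i \<le> 2 ^ j" "m = 2 ^ j + i - 1" and
        n: "1 \<le> l" "l \<le> 2 ^ k" "n = 2 ^ k + l - 1"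
        using pos by meson
      then have "dyadic j i = dyadic k l"
        using eq dyadic_enum_eq by metis
      then show ?thesis using dyadic_inject m(3) n(3) by blast
    qed
  qed
  moreover have "range dyadic_enum = dyadic_intervals_plus"
  proof
    show "range dyadic_enum \<subseteq> dyadic_intervals_plus"
    proof
      fix I assume "I \<in> range dyadic_enum"
      then obtain n where n: "I = dyadic_enum n" by blast
      show "I \<in> dyadic_intervals_plus"
      proof (cases "n = 0")
        case True
        then show ?thesis by (simp add: n dyadic_enum_def dyadic_intervals_plus_def)
      next
        case False
        then obtain j i where "1 \<le> i" "i \<le> 2 ^ j" "n = 2 ^ j + i - 1" using pos by blast
        then have "I = dyadic j i" by (simp only: n dyadic_enum_eq)
        with \<open>1 \<le> i\<close> \<open>i \<le> 2 ^ j\<close> show ?thesis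
          by (auto simp: dyadic_intervals_plus_def dyadic_intervals_def)
      qed
    qed
    have "{} = dyadic_enum 0" by (simp add: dyadic_enum_def)
    then show "dyadic_intervals_plus \<subseteq> range dyadic_enum"
      by (auto simp: dyadic_intervals_plus_def dyadic_intervals_def dyadic_enum_eq[symmetric])
  qed
  ultimately show ?thesis by (simp add: bij_betw_def)
qed

lemma left_half_dyadic:
  assumes "1 \<le> i"
  shows "left_half (dyadic j i) = dyadic (Suc j) (2 * i - 1)"
    and "right_half (dyadic j i) = dyadic (Suc j) (2 * i)"
proof -
  have lt: "(real i - 1) / 2 ^ j < real i / 2 ^ j"
    by (simp add: divide_strict_right_mono)
  have "Inf (dyadic j i) = (real i - 1) / 2 ^ j" "Sup (dyadic j i) = real i / 2 ^ j"
    using lt by (simp_all add: dyadic_def)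
  then have mid: "(Inf (dyadic j i) + Sup (dyadic j i)) / 2 = (2 * real i - 1) / 2 ^ Suc j"
    by (simp add: field_simps)
  have ends: "(real i - 1) / 2 ^ j = (2 * real i - 2) / 2 ^ Suc j"
      "real i / 2 ^ j = 2 * real i / 2 ^ Suc j"
    by (simp_all add: field_simps)
  have "(2 * real i - 2) / 2 ^ Suc j \<le> (2 * real i - 1) / 2 ^ Suc j"
      "(2 * real i - 1) / 2 ^ Suc j \<le> 2 * real i / 2 ^ Suc j"
    by (intro divide_right_mono; simp)+
  moreover have "real (2 * i - 1) = 2 * real i - 1" using assms by simp
  ultimately show "left_half (dyadic j i) = dyadic (Suc j) (2 * i - 1)"
      "right_half (dyadic j i) = dyadic (Suc j) (2 * i)"
    unfolding left_half_def right_half_def mid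
    by (auto simp: dyadic_def ends simp del: power_Suc)
qed

lemma integrable_haar_fun:
  assumes "I \<in> dyadic_intervals_plus"
  shows "integrable unit_lebesgue (haar_fun I)"
proof -
  have *: "integrable unit_lebesgue (indicator {a..<b} :: real \<Rightarrow> real)" for a b :: real
  proof -
    have "{0..1} \<inter> {a..<b} \<in> lmeasurable"
      by (intro fmeasurable_Int_fmeasurable) auto
    then show ?thesis
      by (subst integrable_restrict_space)
        (auto simp: fmeasurable_def indicator_inter_arith[symmetric] mult.commute)
  qed
  have "haar_fun {} = indicator {0..<1}"
    by (simp add: haar_fun_def fun_eq_iff)
  moreover have "haar_fun (dyadic j i) =
      (\<lambda>x. indicator (dyadic (Suc j) (2 * i - 1)) x - indicator (dyadic (Suc j) (2 * i)) x)"
    if "1 \<le> i" for i j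
    using that by (simp add: haar_fun_def fun_eq_iff dyadic_nonempty left_half_dyadic)
  ultimately show ?thesis
    using assms * by (auto simp: dyadic_intervals_plus_def dyadic_intervals_def dyadic_def
        intro!: Bochner_Integration.integrable_diff)
qed

section \<open>Schauder bases and impartial equivalence\<close>

definition schauder_basis :: "(nat \<Rightarrow> 'a::banach) \<Rightarrow> bool"
  where "schauder_basis e \<longleftrightarrow> (\<forall>x. \<exists>!a::nat \<Rightarrow> real. (\<lambda>n. a n *\<^sub>R e n) sums x)"

definition normalized_schauder_basis :: "(nat \<Rightarrow> 'a::banach) \<Rightarrow> bool"
  where "normalized_schauder_basis e \<longleftrightarrow> schauder_basis e \<and> (\<forall>n. norm (e n) = 1)"

definition is_biorthogonal :: "(nat \<Rightarrow> 'a::banach) \<Rightarrow> nat \<Rightarrow> ('a \<Rightarrow>\<^sub>L real) \<Rightarrow> bool"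
  where "is_biorthogonal e n f \<longleftrightarrow> (\<forall>m. blinfun_apply f (e m) = (if m = n then 1 else 0))"

definition biorthogonal :: "(nat \<Rightarrow> 'a::banach) \<Rightarrow> nat \<Rightarrow> 'a \<Rightarrow>\<^sub>L real"
  where "biorthogonal e n = (THE f. is_biorthogonal e n f)"

lemma biorthogonal_eqI:
  assumes "schauder_basis e" and f: "is_biorthogonal e n f"
  shows "biorthogonal e n = f"
  unfolding biorthogonal_def
proof (rule the_equality[where P = "is_biorthogonal e n", OF f])
  fix g assume g: "is_biorthogonal e n g"
  show "g = f"
  proof (rule blinfun_eqI)
    fix x
    obtain a where a: "(\<lambda>n. a n *\<^sub>R e n) sums x"
      using assms(1) unfolding schauder_basis_def by blast
    have "(\<lambda>m. blinfun_apply h (a m *\<^sub>R e m)) sums blinfun_apply h x" for h :: "'a \<Rightarrow>\<^sub>L real"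
      using a by (rule bounded_linear.sums[OF blinfun.bounded_linear_right])
    from this[of f] this[of g] have
      "(\<lambda>m. blinfun_apply f (a m *\<^sub>R e m)) sums blinfun_apply f x"
      "(\<lambda>m. blinfun_apply g (a m *\<^sub>R e m)) sums blinfun_apply g x" .
    moreover have "blinfun_apply f (a m *\<^sub>R e m) = blinfun_apply g (a m *\<^sub>R e m)" for m
      using f g by (simp add: is_biorthogonal_def blinfun.scaleR_right)
    ultimately show "blinfun_apply g x = blinfun_apply f x"
      using sums_unique2 by simp
  qed
qed

definition impartially_equivalent ::
    "real \<Rightarrow> (nat \<Rightarrow> 'a::real_normed_vector) \<Rightarrow> (nat \<Rightarrow> 'b::real_normed_vector) \<Rightarrow> bool"
  where "impartially_equivalent C x y \<longleftrightarrow>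
    (\<forall>a::nat \<Rightarrow> real. finite {i. a i \<noteq> 0} \<longrightarrow>
      1 / sqrt C * norm (\<Sum>i | a i \<noteq> 0. a i *\<^sub>R y i) \<le> norm (\<Sum>i | a i \<noteq> 0. a i *\<^sub>R x i) \<and>
      norm (\<Sum>i | a i \<noteq> 0. a i *\<^sub>R x i) \<le> sqrt C * norm (\<Sum>i | a i \<noteq> 0. a i *\<^sub>R y i))"

section \<open>The game and strategic reproducibility\<close>

definition finite_codimensional :: "'a::real_vector set \<Rightarrow> bool"
  where "finite_codimensional W \<longleftrightarrow> subspace W \<and> (\<exists>B. finite B \<and> span (W \<union> B) = UNIV)"

definition cof :: "'a::banach set set"
  where "cof = {W. finite_codimensional W \<and> closed W}"

text \<open>For functionals, \<^const>\<open>strong_operator_topology\<close> is the topology of pointwise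
  convergence, that is, the weak-star topology of the dual.\<close>

definition cof_wstar :: "('a::banach \<Rightarrow>\<^sub>L real) set set"
  where "cof_wstar = {G. finite_codimensional G \<and> closedin strong_operator_topology G}"

record (overloaded) 'a step1 =
  tolerance :: real
  primal_space :: "'a set"
  dual_space :: "('a \<Rightarrow>\<^sub>L real) set"

record step2 =
  part :: nat
  supp :: "nat set"
  lam :: "nat \<Rightarrow> real"
  mu :: "nat \<Rightarrow> real"

type_synonym step3 = "nat \<Rightarrow> real"

definition legal_step1 :: "'a::banach step1 \<Rightarrow> bool"
  where "legal_step1 p \<longleftrightarrow>
    tolerance p > 0 \<and> primal_space p \<in> cof \<and> dual_space p \<in> cof_wstar"

text \<open>Families indexed by a finite set \<^term>\<open>E\<close> are functions that are \<^const>\<open>undefined\<close>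
  outside \<^term>\<open>E\<close>.\<close>

definition legal_step2 :: "real \<Rightarrow> nat set \<Rightarrow> nat set \<Rightarrow> step2 \<Rightarrow> bool"
  where "legal_step2 \<eta> N1 N2 q \<longleftrightarrow>
    (part q = 1 \<and> supp q \<subseteq> N1 \<or> part q = 2 \<and> supp q \<subseteq> N2) \<and> finite (supp q) \<and>
    lam q \<in> supp q \<rightarrow>\<^sub>E {0..} \<and> mu q \<in> supp q \<rightarrow>\<^sub>E {0..} \<and>
    1 - \<eta> < (\<Sum>i\<in>supp q. lam q i * mu q i) \<and> (\<Sum>i\<in>supp q. lam q i * mu q i) < 1 + \<eta>"

definition legal_step3 :: "step2 \<Rightarrow> step3 \<Rightarrow> bool"
  where "legal_step3 q \<epsilon> \<longleftrightarrow> \<epsilon> \<in> supp q \<rightarrow>\<^sub>E {-1, 1}"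

definition block :: "(nat \<Rightarrow> 'a::banach) \<Rightarrow> step2 \<Rightarrow> step3 \<Rightarrow> 'a"
  where "block e q \<epsilon> = (\<Sum>i\<in>supp q. (\<epsilon> i * lam q i) *\<^sub>R e i)"

definition dual_block :: "(nat \<Rightarrow> 'a::banach) \<Rightarrow> step2 \<Rightarrow> step3 \<Rightarrow> 'a \<Rightarrow>\<^sub>L real"
  where "dual_block e q \<epsilon> = (\<Sum>i\<in>supp q. (\<epsilon> i * mu q i) *\<^sub>R biorthogonal e i)"

definition wins_II ::
    "(nat \<Rightarrow> 'a::banach) \<Rightarrow> real \<Rightarrow> real \<Rightarrow>
      (nat \<Rightarrow> 'a step1) \<Rightarrow> (nat \<Rightarrow> step2) \<Rightarrow> (nat \<Rightarrow> step3) \<Rightarrow> bool"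
  where "wins_II e C \<eta> p q \<epsilon> \<longleftrightarrow>
    impartially_equivalent (C + \<eta>) (\<lambda>k. block e (q k) (\<epsilon> k)) e \<and>
    impartially_equivalent (C + \<eta>) (\<lambda>k. dual_block e (q k) (\<epsilon> k)) (biorthogonal e) \<and>
    (\<forall>k. infdist (block e (q k) (\<epsilon> k)) (primal_space (p k)) < tolerance (p k)) \<and>
    (\<forall>k. infdist (dual_block e (q k) (\<epsilon> k)) (dual_space (p k)) < tolerance (p k))"

text \<open>A strategy for player (II) computes the move in step 2 of turn \<^term>\<open>k\<close> from the
  partition, the list of the turns before \<^term>\<open>k\<close>, and the move of player (I) in step 1 of
  turn \<^term>\<open>k\<close>.\<close>

type_synonym 'a strategy =
  "nat set \<times> nat set \<Rightarrow> ('a step1 \<times> step2 \<times> step3) list \<Rightarrow> 'a step1 \<Rightarrow> step2"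

text \<open>Player (I) always has a legal move, so every finite play in which (I) moves legally extends
  to an infinite one; hence it suffices to consider infinite plays.\<close>

definition winning_strategy ::
    "(nat \<Rightarrow> 'a::banach) \<Rightarrow> real \<Rightarrow> real \<Rightarrow> 'a strategy \<Rightarrow> bool"
  where "winning_strategy e C \<eta> \<sigma> \<longleftrightarrow>
    (\<forall>N1 N2 p q \<epsilon>.
      N1 \<union> N2 = UNIV \<and> N1 \<inter> N2 = {} \<and>
      (\<forall>k. legal_step1 (p k)) \<and>
      (\<forall>k. q k = \<sigma> (N1, N2) (map (\<lambda>j. (p j, q j, \<epsilon> j)) [0..<k]) (p k)) \<and>
      (\<forall>k. legal_step3 (q k) (\<epsilon> k)) \<longrightarrow>
      (\<forall>k. legal_step2 \<eta> N1 N2 (q k)) \<and> wins_II e C \<eta> p q \<epsilon>)"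

definition strategically_reproducible :: "real \<Rightarrow> (nat \<Rightarrow> 'a::banach) \<Rightarrow> bool"
  where "strategically_reproducible C e \<longleftrightarrow>
    normalized_schauder_basis e \<and> (\<forall>\<eta>>0. \<exists>\<sigma>. winning_strategy e C \<eta> \<sigma>)"

end

theory Submission
  imports Defs
begin

text \<open>The Haar function with index \<open>k \<ge> 1\<close> lives on the interval \<open>I\<^sub>k\<close>, whose halves are \<open>I\<^bsub>2k\<^esub>\<close>
and \<open>I\<^bsub>2k+1\<^esub>\<close>; the basis vector is \<open>e\<^sub>k = h\<^sub>k / |I\<^sub>k|\<close> and its biorthogonal functional is
integration against \<open>h\<^sub>k\<close>.

Given the partition, every point of \<open>[0,1)\<close> lies in infinitely many intervals with index in
one of the two parts. So for one part \<open>M\<close> the set \<open>L\<close> of the points that lie in infinitely many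
intervals with index in \<open>M\<close> has measure at least \<open>1/2\<close>, and player (II) always plays in \<open>M\<close>.
In turn \<open>k\<close> she chooses a finite family \<open>E\<^sub>k\<close> of disjoint intervals and puts
\<open>\<mu>\<^sub>J = 1\<close>, \<open>\<lambda>\<^sub>J = |J| / w\<^sub>k\<close>, where \<open>w\<^sub>k\<close> is the measure of the union of the family. With
\<open>b\<^sub>k = (\<Sum>J\<in>E\<^sub>k. \<epsilon>\<^sub>J h\<^sub>J)\<close> this gives \<open>x\<^sub>k = b\<^sub>k / w\<^sub>k\<close> and \<open>x\<^sub>k\<^sup>* = b\<^sub>k\<close>. For \<open>k \<ge> 1\<close> the intervals of
\<open>E\<^sub>k\<close> fill, up to the fraction \<open>\<delta> / 2\<^sup>k\<close>, a target set \<open>A\<^sub>k\<close>: the set \<open>A\<^sub>1\<close> is the support of \<open>b\<^sub>0\<close>, and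
\<open>A\<^bsub>2k\<^esub>\<close>, \<open>A\<^bsub>2k+1\<^esub>\<close> are the sets where \<open>b\<^sub>0 b\<^sub>k\<close> is \<open>1\<close> and \<open>-1\<close>. The factor \<open>b\<^sub>0\<close> is needed because \<open>b\<^sub>0\<close>
plays the role of the constant function but takes both signs.

Thus the functions \<open>b\<^sub>0 b\<^sub>k\<close> have the same sign pattern on the tree of the sets \<open>A\<^sub>k\<close> as the Haar
functions on the tree of the \<open>I\<^sub>k\<close>, except that a little measure is lost at each node. Such trees
are studied abstractly in the locale \<open>haar_tree\<close>. The sup-norms of corresponding linear
combinations depend only on the sign pattern, hence (ii) holds with constant \<open>1\<close>
(\<open>tree_dual_norm_eq\<close>). For two trees, the operator that replaces one system by
the other in \<open>L\<^sup>1\<close> is, by duality, controlled by the \<open>L\<^sup>1\<close>-norms of the images of normalized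
indicators of tree nodes, and these are computed along a branch: they exceed \<open>1\<close> by at most twice
the sum of the losses on it (\<open>path_norm_le\<close>, \<open>tree_projection_bound\<close>). As the Haar system
itself loses nothing, one inequality in (i) holds with constant \<open>1\<close> and the other one with
\<open>1 + 4\<delta>\<close>. Applied to the Haar system twice, the same bound says that the partial sum projections are
contractions, so that the Haar system is a Schauder basis.

Filling the target is possible because of a density argument. Only points of \<open>L\<close> can be covered by
late intervals with index in \<open>M\<close>, so the target must lie almost entirely in \<open>L\<close>. To ensure this for
all later targets, player (II) uses only intervals \<open>J\<close> for which \<open>J - L\<close> is a tiny fraction of \<open>J\<close>;
the other ones are negligible by a Markov type estimate (\<open>dyadic_cover_in_limsup\<close>).

Conditions (iii) and (iv) hold, whatever the signs, as soon as all indices in \<open>E\<^sub>k\<close> are large. A space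
in \<open>cof(X)\<close> is, up to a finite rank correction, the kernel of finitely many functionals \<open>\<phi>\<close>, and
the numbers \<open>\<phi>(h\<^sub>J)\<^sup>2 / |J|\<close> are summable by Bessel's inequality, so that Cauchy and Schwarz bound
\<open>\<Sum>\<^bsub>J\<in>E\<^esub> |\<phi>(h\<^sub>J)|\<close> for disjoint families (\<open>block_near_subspace\<close>). The distance
to a weak-star closed space of finite codimension is bounded by the values at finitely many
\<open>y \<in> L\<^sup>1\<close>, and \<open>x\<^sub>k\<^sup>*\<close> vanishes on the initial partial sums of the Haar expansion of \<open>y\<close>
(\<open>dual_block_near_subspace\<close>).\<close>

section \<open>Functions and functionals on $L^1$\<close>

abbreviation "U \<equiv> unit_lebesgue"

lemma finite_measure_unit: "finite_measure U"
  by (rule finite_measure_lebesgue_on) auto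

interpretation U: finite_measure U by (rule finite_measure_unit)

lemma measure_unit_space: "measure U (space U) = 1"
  by (simp add: measure_restrict_space)

lemma integrable_bounded_mult:
  fixes f \<phi> :: "real \<Rightarrow> real"
  assumes f: "integrable U f" and \<phi>: "\<phi> \<in> borel_measurable U" and b: "\<And>x. \<bar>\<phi> x\<bar> \<le> M"
  shows "integrable U (\<lambda>x. f x * \<phi> x)"
proof (rule Bochner_Integration.integrable_bound)
  show "integrable U (\<lambda>x. M * f x)" using f by simp
  show "(\<lambda>x. f x * \<phi> x) \<in> borel_measurable U" using f \<phi> by measurable
  have "\<bar>f x\<bar> * \<bar>\<phi> x\<bar> \<le> \<bar>f x\<bar> * \<bar>M\<bar>" for x
    using b[of x] by (intro mult_left_mono) auto
  then show "AE x in U. norm (f x * \<phi> x) \<le> norm (M * f x)"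
    by (simp add: abs_mult mult.commute)
qed

lemma integrable_bounded:
  fixes \<phi> :: "real \<Rightarrow> real"
  assumes "\<phi> \<in> borel_measurable U" "\<And>x. \<bar>\<phi> x\<bar> \<le> M"
  shows "integrable U \<phi>"
  using integrable_bounded_mult[of "\<lambda>_. 1", OF _ assms] by simp

lemma L1_rel_refl: "integrable U f \<Longrightarrow> L1_rel f f"
  by (simp add: L1_rel_def)

lemma rep_L1_rel: "L1_rel (rep_L1 x) (rep_L1 x)"
  by (rule Quotient_rep_reflp[OF Quotient_L1])

lemma integrable_rep_L1: "integrable U (rep_L1 x)"
  using rep_L1_rel[of x] by (simp add: L1_rel_def)

lemma abs_rep_L1: "abs_L1 (rep_L1 x) = x"
  by (rule Quotient_abs_rep[OF Quotient_L1])

lemma rep_abs_L1: "integrable U f \<Longrightarrow> AE x in U. rep_L1 (abs_L1 f) x = f x"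
  using Quotient_rep_abs[OF Quotient_L1, of f] by (simp add: L1_rel_def)

lemma norm_abs_L1: "integrable U f \<Longrightarrow> norm (abs_L1 f) = (LINT x|U. \<bar>f x\<bar>)"
  by (simp add: norm_L1.abs_eq L1_rel_refl)

lemma abs_L1_add: "integrable U f \<Longrightarrow> integrable U g \<Longrightarrow> abs_L1 f + abs_L1 g = abs_L1 (\<lambda>x. f x + g x)"
  by (simp add: plus_L1.abs_eq L1_rel_refl)

lemma abs_L1_diff: "integrable U f \<Longrightarrow> integrable U g \<Longrightarrow> abs_L1 f - abs_L1 g = abs_L1 (\<lambda>x. f x - g x)"
  by (simp add: minus_L1.abs_eq L1_rel_refl)

lemma abs_L1_scaleR: "integrable U f \<Longrightarrow> c *\<^sub>R abs_L1 f = abs_L1 (\<lambda>x. c * f x)"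
  by (simp add: scaleR_L1.abs_eq L1_rel_refl)

lemma abs_L1_sum:
  assumes "finite S" and "\<And>k. k \<in> S \<Longrightarrow> integrable U (f k)"
  shows "(\<Sum>k\<in>S. a k *\<^sub>R abs_L1 (f k)) = abs_L1 (\<lambda>x. \<Sum>k\<in>S. a k * f k x)"
  using assms
proof (induction S rule: finite_induct)
  case empty
  then show ?case by (simp add: zero_L1_def)
next
  case (insert k S)
  then show ?case by (simp add: abs_L1_scaleR abs_L1_add)
qed

lemma dist_abs_L1: "integrable U f \<Longrightarrow> integrable U g \<Longrightarrow> dist (abs_L1 f) (abs_L1 g) = (LINT x|U. \<bar>f x - g x\<bar>)"
  by (simp add: dist_norm abs_L1_diff norm_abs_L1)

text \<open>The functional \<open>f \<mapsto> \<integral> f \<phi>\<close>. It is defined through representatives, so it has this meaning for bounded measurable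
\<open>\<phi>\<close> only.\<close>

definition dual_of :: "(real \<Rightarrow> real) \<Rightarrow> L1 \<Rightarrow>\<^sub>L real"
  where "dual_of \<phi> = Blinfun (\<lambda>f. LINT x|U. rep_L1 f x * \<phi> x)"

lemma rep_abs_integral:
  assumes "integrable U f" "\<phi> \<in> borel_measurable U"
  shows "(LINT x|U. rep_L1 (abs_L1 f) x * \<phi> x) = (LINT x|U. f x * \<phi> x)"
proof (rule integral_cong_AE)
  show "AE x in U. rep_L1 (abs_L1 f) x * \<phi> x = f x * \<phi> x"
    using rep_abs_L1[OF assms(1)] by eventually_elim simp
qed (use assms integrable_rep_L1[of "abs_L1 f"] in auto)

lemma
  assumes \<phi>: "\<phi> \<in> borel_measurable U" and b: "\<And>x. \<bar>\<phi> x\<bar> \<le> M"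
  shows dual_of_apply: "integrable U f \<Longrightarrow> blinfun_apply (dual_of \<phi>) (abs_L1 f) = (LINT x|U. f x * \<phi> x)"
    and norm_dual_of_le: "norm (dual_of \<phi>) \<le> M"
proof -
  let ?F = "\<lambda>f. LINT x|U. rep_L1 f x * \<phi> x"
  have M: "0 \<le> M" using b[of 0] by simp
  note [simp] = integrable_bounded_mult[OF _ \<phi> b]
  have lin: "?F (x + y) = ?F x + ?F y" "?F (r *\<^sub>R x) = r *\<^sub>R ?F x" for x y r
  proof -
    obtain f g where fg: "integrable U f" "integrable U g" and xy: "x = abs_L1 f" "y = abs_L1 g"
      using integrable_rep_L1 abs_rep_L1 by metis
    have "?F (x + y) = (LINT x|U. (f x + g x) * \<phi> x)"
      unfolding xy abs_L1_add[OF fg] using fg \<phi> by (intro rep_abs_integral) auto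
    also have "\<dots> = ?F x + ?F y" unfolding xy using fg
      by (simp add: rep_abs_integral \<phi> distrib_right Bochner_Integration.integral_add)
    finally show "?F (x + y) = ?F x + ?F y" .
    have "?F (r *\<^sub>R x) = (LINT x|U. (r * f x) * \<phi> x)"
      unfolding xy abs_L1_scaleR[OF fg(1)] using fg \<phi> by (intro rep_abs_integral) auto
    also have "\<dots> = r *\<^sub>R ?F x" unfolding xy using fg
      by (simp add: rep_abs_integral \<phi> mult.assoc)
    finally show "?F (r *\<^sub>R x) = r *\<^sub>R ?F x" .
  qed
  have bd: "norm (?F x) \<le> norm x * M" for x
  proof -
    define f where "f = rep_L1 x"
    have f: "integrable U f" "x = abs_L1 f" by (simp_all add: f_def integrable_rep_L1 abs_rep_L1)
    have "\<bar>LINT x|U. f x * \<phi> x\<bar> \<le> (LINT x|U. \<bar>f x\<bar> * M)"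
    proof (rule order_trans[OF integral_abs_bound], rule integral_mono)
      show "\<bar>f x * \<phi> x\<bar> \<le> \<bar>f x\<bar> * M" for x
        using b[of x] by (simp add: abs_mult mult_left_mono)
    qed (use f in auto)
    then show ?thesis using f by (simp add: f_def[symmetric] norm_abs_L1 rep_abs_integral \<phi>)
  qed
  have bl: "bounded_linear ?F" by (rule bounded_linear_intro[OF lin bd])
  have app: "blinfun_apply (dual_of \<phi>) x = ?F x" for x
    by (simp add: dual_of_def bounded_linear_Blinfun_apply[OF bl])
  show "blinfun_apply (dual_of \<phi>) (abs_L1 f) = (LINT x|U. f x * \<phi> x)" if "integrable U f"
    by (simp add: app rep_abs_integral that \<phi>)
  show "norm (dual_of \<phi>) \<le> M"
    by (rule norm_blinfun_bound[OF M]) (use bd in \<open>simp add: app mult.commute[of M]\<close>)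
qed

lemma dual_of_sum:
  assumes "finite S" "\<And>k. k \<in> S \<Longrightarrow> \<phi> k \<in> borel_measurable U" "\<And>k x. k \<in> S \<Longrightarrow> \<bar>\<phi> k x\<bar> \<le> M k"
  shows "(\<Sum>k\<in>S. a k *\<^sub>R dual_of (\<phi> k)) = dual_of (\<lambda>x. \<Sum>k\<in>S. a k * \<phi> k x)"
proof (rule blinfun_eqI)
  fix x :: L1
  obtain f where f: "integrable U f" "x = abs_L1 f" using integrable_rep_L1 abs_rep_L1 by metis
  have b: "\<bar>\<Sum>k\<in>S. a k * \<phi> k x\<bar> \<le> (\<Sum>k\<in>S. \<bar>a k\<bar> * M k)" for x
    by (rule order_trans[OF sum_abs sum_mono]) (simp add: abs_mult assms mult_left_mono)
  have m: "(\<lambda>x. \<Sum>k\<in>S. a k * \<phi> k x) \<in> borel_measurable U" using assms by measurable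
  have "(LINT x|U. f x * (\<Sum>k\<in>S. a k * \<phi> k x)) = (LINT x|U. (\<Sum>k\<in>S. a k * (f x * \<phi> k x)))"
    by (simp add: sum_distrib_left algebra_simps)
  also have "\<dots> = (\<Sum>k\<in>S. a k * (LINT x|U. f x * \<phi> k x))"
    using assms by (subst Bochner_Integration.integral_sum) (auto intro!: integrable_bounded_mult f)
  finally show "blinfun_apply (\<Sum>k\<in>S. a k *\<^sub>R dual_of (\<phi> k)) x = blinfun_apply (dual_of (\<lambda>x. \<Sum>k\<in>S. a k * \<phi> k x)) x"
    using assms by (simp add: f dual_of_apply[OF m b] blinfun.sum_left blinfun.scaleR_left dual_of_apply[OF assms(2,3)])
qed

section \<open>Trees of sets and their Haar functions\<close>

text \<open>The nodes of the tree are the numbers \<open>k \<ge> 1\<close>, and the parent of \<open>k\<close> is \<open>k div 2\<close>. The value is the sign that the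
function of index \<open>j\<close> has on node \<open>k\<close>: it is \<open>\<plusminus>1\<close> if node \<open>k\<close> lies below the left or right child of
\<open>j\<close>, or if \<open>j = 0\<close>, which stands for the constant function; otherwise it is \<open>0\<close>, in particular for \<open>j = k\<close>.\<close>

fun haar_sign :: "nat \<Rightarrow> nat \<Rightarrow> real"
  where "haar_sign j k =
    (if k \<le> 1 then (if j = 0 then 1 else 0)
     else if k div 2 = j then (if even k then 1 else - 1)
     else haar_sign j (k div 2))"

declare haar_sign.simps [simp del]

lemma haar_sign_1 [simp]: "haar_sign j 1 = (if j = 0 then 1 else 0)" "haar_sign j (Suc 0) = (if j = 0 then 1 else 0)"
  by (simp_all add: haar_sign.simps)

lemma haar_sign_children:
  assumes "1 \<le> k"
  shows "haar_sign j (2 * k) = (if j = k then 1 else haar_sign j k)"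
    and "haar_sign j (2 * k + 1) = (if j = k then - 1 else haar_sign j k)"
proof -
  show "haar_sign j (2 * k) = (if j = k then 1 else haar_sign j k)"
    using assms by (subst haar_sign.simps) auto
  show "haar_sign j (2 * k + 1) = (if j = k then - 1 else haar_sign j k)"
    using assms by (subst haar_sign.simps) auto
qed

lemma heap_induct [consumes 1, case_names root left right]:
  assumes "1 \<le> k" and "P 1"
    and "\<And>k. 1 \<le> k \<Longrightarrow> P k \<Longrightarrow> P (2 * k)" and "\<And>k. 1 \<le> k \<Longrightarrow> P k \<Longrightarrow> P (2 * k + 1)"
  shows "P (k::nat)"
  using assms(1)
proof (induction k rule: less_induct)
  case (less k)
  show ?case
  proof (cases "k = 1")
    case False
    then have "1 \<le> k div 2" "k div 2 < k" using less.prems by auto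
    then have "P (k div 2)" using less.IH by blast
    moreover have "k = 2 * (k div 2) \<or> k = 2 * (k div 2) + 1" by arith
    ultimately show ?thesis using assms(3,4)[OF \<open>1 \<le> k div 2\<close>] by metis
  qed (use assms(2) in simp)
qed

lemma haar_sign_eq_0: "1 \<le> k \<Longrightarrow> k div 2 < j \<Longrightarrow> haar_sign j k = 0"
  by (induction k rule: heap_induct) (auto simp: haar_sign_children simp del: One_nat_def)

text \<open>A sum over all \<open>j\<close> would have the same nonzero terms: they belong to \<open>0\<close> and to the proper
ancestors of \<open>k\<close>, which are at most \<open>k div 2\<close>.\<close>

definition path_sum :: "(nat \<Rightarrow> real) \<Rightarrow> nat \<Rightarrow> real"
  where "path_sum g k = (\<Sum>j\<le>k div 2. haar_sign j k * g j)"

lemma path_sum_eq: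
  assumes "1 \<le> k" "k < 2 * n"
  shows "(\<Sum>j<n. haar_sign j k * g j) = path_sum g k"
  unfolding path_sum_def
  by (rule sum.mono_neutral_right) (use assms haar_sign_eq_0[of k] in auto)

lemma path_sum_children:
  assumes "1 \<le> k"
  shows "path_sum g (2 * k) = path_sum g k + g k" and "path_sum g (2 * k + 1) = path_sum g k - g k"
proof -
  have "(\<Sum>j<Suc k. haar_sign j (2 * k) * g j) = (\<Sum>j<k. haar_sign j k * g j) + g k"
    "(\<Sum>j<Suc k. haar_sign j (2 * k + 1) * g j) = (\<Sum>j<k. haar_sign j k * g j) - g k"
    by (simp_all add: haar_sign_children[OF assms] del: Suc_eq_plus1 One_nat_def add_Suc_right)
  then show "path_sum g (2 * k) = path_sum g k + g k" "path_sum g (2 * k + 1) = path_sum g k - g k"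
    using assms by (simp_all add: path_sum_eq del: sum.lessThan_Suc)
qed

lemma path_sum_1 [simp]: "path_sum g 1 = g 0" "path_sum g (Suc 0) = g 0"
  by (simp_all add: path_sum_def)

text \<open>The Haar-like functions of a family of sets indexed by the nodes, all multiplied by one function \<open>s\<close> with values \<open>\<plusminus>1\<close>.
For the Haar system \<open>s = 1\<close>; in the game \<open>s\<close> is the sign of the block that replaces the constant
function.\<close>

definition tree_fun :: "(nat \<Rightarrow> real set) \<Rightarrow> (real \<Rightarrow> real) \<Rightarrow> nat \<Rightarrow> real \<Rightarrow> real"
  where "tree_fun A s k x = s x * (if k = 0 then indicator (A 1) x
    else indicator (A (2 * k)) x - indicator (A (2 * k + 1)) x)"

definition tree_weight :: "(nat \<Rightarrow> real set) \<Rightarrow> nat \<Rightarrow> real"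
  where "tree_weight A k = (if k = 0 then measure U (A 1) else 2 * measure U (A (2 * k)))"

text \<open>At node \<open>k\<close> at most the fraction \<open>\<delta> / 2\<^sup>k\<close> of the measure of \<open>A k\<close> is lost, that is, not passed on
to the children. Their sum over a branch is at most \<open>\<delta>\<close>, which is what the norm estimates see.\<close>

locale haar_tree =
  fixes A :: "nat \<Rightarrow> real set" and s :: "real \<Rightarrow> real" and \<delta> :: real
  assumes A_sets: "1 \<le> k \<Longrightarrow> A k \<in> sets U"
    and children_subset: "1 \<le> k \<Longrightarrow> A (2 * k) \<union> A (2 * k + 1) \<subseteq> A k"
    and children_disjoint: "1 \<le> k \<Longrightarrow> A (2 * k) \<inter> A (2 * k + 1) = {}"
    and children_measure: "1 \<le> k \<Longrightarrow> measure U (A (2 * k)) = measure U (A (2 * k + 1))"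
    and A_pos: "1 \<le> k \<Longrightarrow> 0 < measure U (A k)"
    and s_meas [measurable]: "s \<in> borel_measurable U"
    and s_sign: "s x = 1 \<or> s x = - 1"
    and \<delta>_nonneg: "0 \<le> \<delta>"
    and loss: "1 \<le> k \<Longrightarrow> (1 - \<delta> / 2 ^ k) * measure U (A k) \<le> 2 * measure U (A (2 * k))"
begin

abbreviation "r \<equiv> tree_fun A s"
abbreviation "w \<equiv> tree_weight A"

lemma child_subset: "1 \<le> k \<Longrightarrow> A (2 * k) \<subseteq> A k" "1 \<le> k \<Longrightarrow> A (2 * k + 1) \<subseteq> A k"
  using children_subset by auto

lemma s_square: "s x * s x = 1" and abs_s: "\<bar>s x\<bar> = 1"
  using s_sign[of x] by auto

lemma weight_pos: "0 < w k"
  using A_pos[of 1] A_pos[of "2 * k"] by (auto simp: tree_weight_def)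

lemma integral_node: "1 \<le> k \<Longrightarrow> integrable U (indicator (A k) :: real \<Rightarrow> real)"
  "1 \<le> k \<Longrightarrow> (LINT x|U. indicator (A k) x) = measure U (A k)"
  using A_sets[of k] sets.sets_into_space[OF A_sets[of k]]
  by (auto simp: U.emeasure_finite less_top[symmetric] Int_absorb2)

lemma tree_fun_measurable [measurable]: "r k \<in> borel_measurable U"
proof -
  have A1 [measurable]: "A 1 \<in> sets U" using A_sets by simp
  show ?thesis
  proof (cases "k = 0")
    case True
    have "(\<lambda>x. s x * indicator (A 1) x) \<in> borel_measurable U" by measurable
    with True show ?thesis by (simp add: tree_fun_def[abs_def])
  next
    case False
    then have [measurable]: "A (2 * k) \<in> sets U" "A (2 * k + 1) \<in> sets U"
      using A_sets[of "2 * k"] A_sets[of "2 * k + 1"] by simp_all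
    show ?thesis using False unfolding tree_fun_def[abs_def] by measurable
  qed
qed

lemma abs_tree_fun_le: "\<bar>r k x\<bar> \<le> 1"
  by (auto simp: tree_fun_def abs_mult abs_s indicator_def)

lemma integrable_tree_fun: "integrable U (r k)"
  by (rule integrable_bounded[OF tree_fun_measurable abs_tree_fun_le])

text \<open>Two nodes whose sets meet are comparable. In terms of indices: a smaller node that meets \<open>k\<close>
is at most the parent of \<open>k\<close>. The induction compares the parent of \<open>k\<close> with \<open>j\<close>.\<close>

lemma meet_ancestor:
  "x \<in> A j \<Longrightarrow> x \<in> A k \<Longrightarrow> 1 \<le> j \<Longrightarrow> j < k \<Longrightarrow> j \<le> k div 2"
proof (induction k arbitrary: j rule: less_induct)
  case (less k)
  show ?case
  proof (rule ccontr)
    let ?m = "k div 2"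
    assume "\<not> j \<le> ?m"
    then have mj: "?m < j" by simp
    have m: "1 \<le> ?m" using less.prems by auto
    have k: "k = 2 * ?m \<or> k = 2 * ?m + 1" by arith
    then have "x \<in> A ?m" using child_subset[OF m] less.prems(2) by auto
    then have "?m \<le> j div 2" using less.IH[OF \<open>j < k\<close> _ less.prems(1) m mj] by blast
    then have "j = 2 * ?m" "k = 2 * ?m + 1" using \<open>j < k\<close> k by auto
    then show False using children_disjoint[OF m] less.prems by (metis disjoint_iff)
  qed
qed

lemma meet_subset:
  "x \<in> A j \<Longrightarrow> x \<in> A k \<Longrightarrow> 1 \<le> j \<Longrightarrow> j \<le> k \<Longrightarrow> A k \<subseteq> A j"
proof (induction k rule: less_induct)
  case (less k)
  show ?case
  proof (cases "j = k")
    case False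
    let ?m = "k div 2"
    have j: "j \<le> ?m" using meet_ancestor[OF less.prems(1-3)] False less.prems(4) by simp
    then have m: "1 \<le> ?m" "?m < k" using less.prems by auto
    have "k = 2 * ?m \<or> k = 2 * ?m + 1" by arith
    then have sub: "A k \<subseteq> A ?m" using child_subset[OF m(1)] by metis
    then show ?thesis using less.IH[OF m(2) less.prems(1) _ less.prems(3) j] less.prems(2) by blast
  qed simp
qed

lemma tree_fun_outside:
  assumes "1 \<le> k" "x \<notin> A k"
  shows "r k x = 0"
proof -
  have "x \<notin> A (2 * k)" "x \<notin> A (2 * k + 1)" using child_subset[OF assms(1)] assms(2) by blast+
  then show ?thesis using assms by (simp add: tree_fun_def)
qed

lemma tree_fun_on_node:
  "1 \<le> k \<Longrightarrow> j < k \<Longrightarrow> x \<in> A k \<Longrightarrow> r j x = s x * haar_sign j k"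
proof (induction k arbitrary: j rule: less_induct)
  case (less k)
  show ?case
  proof (cases "k = 1")
    case True
    then show ?thesis using less.prems by (simp add: tree_fun_def)
  next
    case False
    let ?m = "k div 2"
    have m: "1 \<le> ?m" "?m < k" using less.prems False by auto
    have k: "k = 2 * ?m \<or> k = 2 * ?m + 1" by arith
    then have xm: "x \<in> A ?m" using child_subset[OF m(1)] less.prems(3) by auto
    have sgn: "haar_sign j k = haar_sign j ?m" if "j \<noteq> ?m"
      using haar_sign_children[OF m(1), of j] that k by metis
    consider "j < ?m" | "j = ?m" | "?m < j" by linarith
    then show ?thesis
    proof cases
      case 1
      then show ?thesis using less.IH[OF m(2,1) 1 xm] sgn by simp
    next
      case 2
      show ?thesis
      proof (cases "even k")
        case True
        then have "k = 2 * j" using 2 by simp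
        moreover from this have "x \<notin> A (2 * j + 1)" using children_disjoint[OF m(1)] 2 less.prems(3) by auto
        ultimately show ?thesis using less.prems m 2 haar_sign_children(1)[OF m(1), of j]
          by (simp add: tree_fun_def)
      next
        case False
        then have kj: "k = 2 * j + 1" using 2 by presburger
        moreover from this have "x \<notin> A (2 * j)" using children_disjoint[OF m(1)] 2 less.prems(3) by auto
        ultimately show ?thesis using less.prems m 2 haar_sign_children(2)[OF m(1), of j]
          by (simp add: tree_fun_def)
      qed
    next
      case 3
      then have j: "1 \<le> j" using m by simp
      have "x \<notin> A j" using meet_ancestor[OF _ less.prems(3) j less.prems(2)] 3 by auto
      then have "r j x = 0" by (rule tree_fun_outside[OF j])
      then show ?thesis using haar_sign_eq_0[of k j] 3 less.prems by simp
    qed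
  qed
qed

text \<open>Every point follows a branch of the tree, up to the last node \<open>K < 2n\<close> whose set contains it.
The functions of index below \<open>n\<close> take there the values prescribed by \<open>K\<close>, whether or not the point is
lost at \<open>K\<close>. So pointwise values of linear combinations depend only on the sign pattern.\<close>

lemma tree_fun_path:
  assumes "1 \<le> n"
  obtains "\<And>k. r k x = 0" | K where "1 \<le> K" "K < 2 * n" "\<And>k. k < n \<Longrightarrow> r k x = s x * haar_sign k K"
proof (cases "x \<in> A 1")
  case False
  have "x \<notin> A k" if "1 \<le> k" for k
    using that
  proof (induction k rule: heap_induct)
    case (left k)
    then show ?case using child_subset(1) by blast
  next
    case (right k)
    then show ?case using child_subset(2) by blast
  qed (rule False)
  then have "r k x = 0" for k
    using False tree_fun_outside[of k] by (cases "k = 0") (auto simp: tree_fun_def)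
  then show ?thesis by (rule that(1))
next
  case True
  define P where "P K \<longleftrightarrow> 1 \<le> K \<and> K < 2 * n \<and> x \<in> A K" for K
  define K where "K = (GREATEST K. P K)"
  have P1: "P 1" using assms True by (simp add: P_def)
  have PK: "P K" unfolding K_def by (rule GreatestI_nat[of P _ "2 * n", OF P1]) (simp add: P_def)
  have max: "y \<le> K" if "P y" for y
    unfolding K_def by (rule Greatest_le_nat[of P _ "2 * n", OF that]) (simp add: P_def)
  show ?thesis
  proof (rule that(2))
    show "1 \<le> K" "K < 2 * n" using PK by (auto simp: P_def)
    show "r k x = s x * haar_sign k K" if "k < n" for k
    proof (cases "k < K")
      case True
      then show ?thesis using tree_fun_on_node PK by (auto simp: P_def)
    next
      case False
      then have k: "1 \<le> k" "K \<le> k" using PK by (auto simp: P_def)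
      then have "\<not> P (2 * k)" "\<not> P (2 * k + 1)" using max[of "2 * k"] max[of "2 * k + 1"] by auto
      then have "x \<notin> A (2 * k)" "x \<notin> A (2 * k + 1)" using that k by (auto simp: P_def)
      then have "r k x = 0" using k by (simp add: tree_fun_def)
      moreover have "haar_sign k K = 0" using haar_sign_eq_0[of K k] PK k by (auto simp: P_def)
      ultimately show ?thesis by simp
    qed
  qed
qed

lemma integral_node_diff:
  assumes "1 \<le> k"
  shows "integrable U (\<lambda>x. indicator (A (2 * k)) x - indicator (A (2 * k + 1)) x :: real)"
    "(LINT x|U. (indicator (A (2 * k)) x - indicator (A (2 * k + 1)) x :: real)) = 0"
  using assms integral_node[of "2 * k"] integral_node[of "2 * k + 1"] children_measure[OF assms] by simp_all

text \<open>The function of smaller index is constant, up to the factor \<open>s\<close>, on the support of the other one,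
whose product with \<open>s\<close> has mean \<open>0\<close>.\<close>

lemma orthogonal_less:
  assumes "j < k"
  shows "(LINT x|U. r j x * r k x) = 0"
proof -
  have k: "1 \<le> k" using assms by simp
  have "r j x * r k x = haar_sign j k * (indicator (A (2 * k)) x - indicator (A (2 * k + 1)) x)" for x
  proof (cases "x \<in> A k")
    case True
    have "r j x * r k x = (s x * s x) * (haar_sign j k * (indicator (A (2 * k)) x - indicator (A (2 * k + 1)) x))"
      unfolding tree_fun_on_node[OF k assms True] using k by (simp add: tree_fun_def)
    then show ?thesis by (simp only: s_square mult_1)
  next
    case False
    then have "x \<notin> A (2 * k)" "x \<notin> A (2 * k + 1)" using child_subset[OF k] by blast+
    then show ?thesis using tree_fun_outside[OF k False] by (simp add: indicator_def)
  qed
  then show ?thesis using integral_node_diff[OF k] by simp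
qed

lemma orthogonal: "(LINT x|U. r j x * r k x) = (if j = k then w k else 0)"
proof (cases "j = k")
  case True
  have "r 0 x * r 0 x = indicator (A 1) x" for x
    using s_square[of x] by (auto simp: tree_fun_def indicator_def)
  moreover have "r k x * r k x = indicator (A (2 * k)) x + indicator (A (2 * k + 1)) x" if "1 \<le> k" for x
    using s_square[of x] children_disjoint[OF that] that by (auto simp: tree_fun_def indicator_def)
  ultimately show ?thesis
    using True integral_node[of "2 * k"] integral_node[of "2 * k + 1"] integral_node[of 1] children_measure[of k]
    by (cases "k = 0") (auto simp: tree_weight_def)
next
  case False
  then show ?thesis using orthogonal_less[of j k] orthogonal_less[of k j]
    by (cases "j < k") (auto simp: mult.commute)
qed

text \<open>For the Haar system, the path sum of the functions \<open>r k / w k\<close> along the branch to \<open>K\<close> is the indicator of \<open>A K\<close>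
divided by its measure. In general it equals \<open>\<plusminus>S\<close> on \<open>A K\<close>, where \<open>S\<close> is the sum of the numbers
\<open>1 / w j\<close> on the branch, and the last condition measures how far its \<open>L\<^sup>1\<close>-norm is from \<open>1\<close>. The term
\<open>2 (1 - S |A K|)\<close> is there to make the induction work: the excess norm created at \<open>K\<close> is
\<open>1 - S w K\<close>, and this defect is only halved when passing to a child.\<close>

definition path_inv :: "nat \<Rightarrow> real \<Rightarrow> bool"
  where "path_inv K S \<longleftrightarrow> 0 \<le> S \<and> S * measure U (A K) \<le> 1 \<and>
    (\<forall>x\<in>A K. path_sum (\<lambda>k. r k x / w k) K = s x * S) \<and>
    (LINT x|U. \<bar>path_sum (\<lambda>k. r k x / w k) K\<bar>) + 2 * (1 - S * measure U (A K)) \<le> 1 + 4 * \<delta> - 4 * \<delta> / 2 ^ K"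

text \<open>Adding or subtracting \<open>r K / w K\<close> changes the absolute value \<open>S\<close> to \<open>S + 1 / w K\<close> on one child and to
\<open>1 / w K - S\<close> on the other one, so the norm grows by \<open>1 - S w K\<close>. On the child \<open>K'\<close> twice the new defect
is \<open>1 - S w K\<close> as well. Both together exceed twice the old defect by \<open>2 S (|A K| - w K)\<close>, which is at most twice
the loss.\<close>

lemma path_norm_step:
  assumes K: "1 \<le> K" and inv: "path_inv K S" and K': "K' = 2 * K \<or> K' = 2 * K + 1"
  shows "path_inv K' (S + 1 / w K)"
proof -
  define G where "G x = path_sum (\<lambda>k. r k x / w k) K" for x
  define G' where "G' x = path_sum (\<lambda>k. r k x / w k) K'" for x
  have S: "0 \<le> S" "S * measure U (A K) \<le> 1" and GS: "\<And>x. x \<in> A K \<Longrightarrow> G x = s x * S"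
    and GI: "(LINT x|U. \<bar>G x\<bar>) + 2 * (1 - S * measure U (A K)) \<le> 1 + 4 * \<delta> - 4 * \<delta> / 2 ^ K"
    using inv by (auto simp: path_inv_def G_def)
  have wK: "w K = 2 * measure U (A (2 * K))" "w K = 2 * measure U (A (2 * K + 1))"
    using K children_measure[OF K] by (simp_all add: tree_weight_def)
  have "measure U (A (2 * K)) + measure U (A (2 * K + 1)) = measure U (A (2 * K) \<union> A (2 * K + 1))"
    using K children_disjoint[OF K] A_sets[of "2 * K"] A_sets[of "2 * K + 1"]
    by (intro U.finite_measure_Union[symmetric]) auto
  also have "\<dots> \<le> measure U (A K)"
    using children_subset[OF K] A_sets[OF K] by (rule U.finite_measure_mono)
  finally have wA: "w K \<le> measure U (A K)" using wK by simp
  have "S * w K \<le> S * measure U (A K)" using wA S by (intro mult_left_mono)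
  then have Sw: "S * w K \<le> 1" using S by simp
  then have Sw': "S \<le> 1 / w K" using weight_pos[of K] by (simp add: field_simps)
  have G'G: "G' x = G x + (if K' = 2 * K then 1 else - 1) * r K x / w K" for x
    using K' path_sum_children[OF K] unfolding G_def G'_def by auto
  have absG': "\<bar>G' x\<bar> = \<bar>G x\<bar> + (1 / w K) * indicator (A K') x
      + (1 / w K - 2 * S) * indicator (A (4 * K + 1 - K')) x" for x
  proof -
    have K1: "0 < K" using K by simp
    have *: "\<bar>s x * S + s x * (1 / w K)\<bar> = S + 1 / w K" "\<bar>s x * S - s x * (1 / w K)\<bar> = 1 / w K - S"
      using s_sign[of x] S Sw' weight_pos[of K] by auto
    consider "x \<notin> A K" | "x \<in> A (2 * K)" | "x \<in> A (2 * K + 1)" | "x \<in> A K" "x \<notin> A (2 * K)" "x \<notin> A (2 * K + 1)"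
      by blast
    then show ?thesis
    proof cases
      case 1
      then have "x \<notin> A (2 * K)" "x \<notin> A (2 * K + 1)" using child_subset[OF K] by blast+
      moreover have "K' = 2 * K \<and> 4 * K + 1 - K' = 2 * K + 1 \<or> K' = 2 * K + 1 \<and> 4 * K + 1 - K' = 2 * K"
        using K' by auto
      ultimately show ?thesis using tree_fun_outside[OF K 1] by (auto simp: G'G)
    next
      case 2
      then have x: "x \<in> A K" "x \<notin> A (2 * K + 1)" using child_subset[OF K] children_disjoint[OF K] by blast+
      then have r: "r K x = s x" using 2 K1 by (simp add: tree_fun_def)
      have "\<bar>G x\<bar> = S" using GS[OF x(1)] S by (simp add: abs_mult abs_s)
      then show ?thesis using K' 2 x * GS[OF x(1)] by (auto simp: G'G r)
    next
      case 3
      then have x: "x \<in> A K" "x \<notin> A (2 * K)" using child_subset[OF K] children_disjoint[OF K] by blast+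
      then have r: "r K x = - s x" using 3 K1 by (simp add: tree_fun_def)
      have "\<bar>G x\<bar> = S" using GS[OF x(1)] S by (simp add: abs_mult abs_s)
      then show ?thesis using K' 3 x * GS[OF x(1)] by (auto simp: G'G r)
    next
      case 4
      then have "r K x = 0" using K by (simp add: tree_fun_def)
      then show ?thesis using 4 K' by (auto simp: G'G)
    qed
  qed
  have intG: "integrable U G"
    unfolding G_def[abs_def] path_sum_def by (intro Bochner_Integration.integrable_sum) (simp add: integrable_tree_fun)
  have Kc: "1 \<le> K'" "1 \<le> 4 * K + 1 - K'" using K K' by auto
  have mK': "measure U (A K') = w K / 2" "measure U (A (4 * K + 1 - K')) = w K / 2"
    using K' wK by auto
  have "(LINT x|U. \<bar>G' x\<bar>) = (LINT x|U. \<bar>G x\<bar>) + (1 / w K) * (LINT x|U. indicator (A K') x)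
      + (1 / w K - 2 * S) * (LINT x|U. indicator (A (4 * K + 1 - K')) x)"
    unfolding absG' using intG integral_node(1)[OF Kc(1)] integral_node(1)[OF Kc(2)] by simp
  also have "\<dots> = (LINT x|U. \<bar>G x\<bar>) + (1 / w K) * (w K / 2) + (1 / w K - 2 * S) * (w K / 2)"
    by (simp only: integral_node(2)[OF Kc(1)] integral_node(2)[OF Kc(2)] mK')
  also have "\<dots> = (LINT x|U. \<bar>G x\<bar>) + (1 - S * w K)" using weight_pos[of K] by (simp add: field_simps)
  finally have int: "(LINT x|U. \<bar>G' x\<bar>) = (LINT x|U. \<bar>G x\<bar>) + (1 - S * w K)" .
  have SK': "(S + 1 / w K) * measure U (A K') = (S * w K + 1) / 2"
    using weight_pos[of K] by (simp add: mK' field_simps)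
  have "S * measure U (A K) - S * w K = S * (measure U (A K) - w K)" by (simp add: algebra_simps)
  also have "\<dots> \<le> S * (\<delta> / 2 ^ K * measure U (A K))"
    using loss[OF K] wK S by (intro mult_left_mono) (auto simp: algebra_simps)
  also have "\<dots> = \<delta> / 2 ^ K * (S * measure U (A K))" by simp
  also have "\<dots> \<le> \<delta> / 2 ^ K * 1" using S \<delta>_nonneg by (intro mult_left_mono) auto
  finally have loss': "S * measure U (A K) - S * w K \<le> \<delta> / 2 ^ K" by simp
  have "4 * \<delta> / 2 ^ K' \<le> 4 * \<delta> / 2 ^ (K + 1)"
    using K K' \<delta>_nonneg by (intro divide_left_mono power_increasing mult_nonneg_nonneg) auto
  also have "\<dots> = 2 * \<delta> / 2 ^ K" by simp
  finally have dK: "4 * \<delta> / 2 ^ K' \<le> 2 * \<delta> / 2 ^ K" .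
  have GA: "G' x = s x * (S + 1 / w K)" if x: "x \<in> A K'" for x
  proof -
    have xK: "x \<in> A K" using x K' child_subset[OF K] by blast
    have "r K x = (if K' = 2 * K then s x else - s x)"
    proof (cases "K' = 2 * K")
      case True
      then have "x \<notin> A (2 * K + 1)" using x children_disjoint[OF K] by blast
      then show ?thesis using True x K by (simp add: tree_fun_def)
    next
      case False
      then have "x \<notin> A (2 * K)" "x \<in> A (2 * K + 1)" using x K' children_disjoint[OF K] by blast+
      then show ?thesis using False K by (simp add: tree_fun_def)
    qed
    then show ?thesis using GS[OF xK] by (auto simp: G'G algebra_simps)
  qed
  show ?thesis unfolding path_inv_def
  proof (intro conjI ballI)
    show "0 \<le> S + 1 / w K" using S weight_pos[of K] by simp
    show "(S + 1 / w K) * measure U (A K') \<le> 1" unfolding SK' using Sw by simp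
    show "path_sum (\<lambda>k. r k x / w k) K' = s x * (S + 1 / w K)" if "x \<in> A K'" for x
      using GA[OF that] by (simp add: G'_def)
    show "(LINT x|U. \<bar>path_sum (\<lambda>k. r k x / w k) K'\<bar>) + 2 * (1 - (S + 1 / w K) * measure U (A K'))
        \<le> 1 + 4 * \<delta> - 4 * \<delta> / 2 ^ K'"
    proof -
      have "I' + 2 * (1 - (q + 1) / 2) \<le> 1 + 4 * \<delta> - d'"
        if "I' = I + (1 - q)" "I + 2 * (1 - m) \<le> 1 + 4 * \<delta> - d" "m - q \<le> e" "d' \<le> d / 2" "d = 4 * e"
        for I I' q m d d' e :: real
      proof -
        have "I + 2 - 2 * m \<le> 1 + 4 * \<delta> - d" using that(2) by (simp add: right_diff_distrib)
        then have "I' + (1 - q) \<le> 1 + 4 * \<delta> - d'" using that(1,3,4,5) by linarith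
        moreover have "2 * (1 - (q + 1) / 2) = 1 - q" by (simp add: field_simps)
        ultimately show ?thesis by simp
      qed
      moreover have "4 * \<delta> / 2 ^ K' \<le> 4 * \<delta> / 2 ^ K / 2" using dK by simp
      moreover have "4 * \<delta> / 2 ^ K = 4 * (\<delta> / 2 ^ K)" by simp
      ultimately show ?thesis using int GI loss' by (simp only: SK' G'_def)
    qed
  qed
qed

lemma path_inv_exists:
  assumes "1 \<le> K"
  shows "\<exists>S. path_inv K S"
  using assms
proof (induction K rule: heap_induct)
  case root
  have "\<bar>r 0 x / w 0\<bar> = indicator (A 1) x / w 0" for x
    using weight_pos[of 0] by (auto simp: tree_fun_def abs_mult abs_s indicator_def)
  then have "(LINT x|U. \<bar>r 0 x / w 0\<bar>) = 1"
    using integral_node[of 1] weight_pos[of 0] A_pos[of 1] by (simp add: tree_weight_def)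
  then show ?case using weight_pos[of 0] A_pos[of 1] \<delta>_nonneg
    by (intro exI[of _ "1 / w 0"]) (auto simp: path_inv_def tree_weight_def tree_fun_def)
next
  case (left K)
  then show ?case using path_norm_step[of K] by blast
next
  case (right K)
  then show ?case using path_norm_step[of K] by blast
qed

lemma path_norm_le:
  assumes "1 \<le> K"
  shows "(LINT x|U. \<bar>path_sum (\<lambda>k. r k x / w k) K\<bar>) \<le> 1 + 4 * \<delta>"
proof -
  obtain S where "S * measure U (A K) \<le> 1"
    "(LINT x|U. \<bar>path_sum (\<lambda>k. r k x / w k) K\<bar>) + 2 * (1 - S * measure U (A K)) \<le> 1 + 4 * \<delta> - 4 * \<delta> / 2 ^ K"
    using path_inv_exists[OF assms] unfolding path_inv_def by blast
  moreover have "0 \<le> 4 * \<delta> / 2 ^ K" using \<delta>_nonneg by simp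
  moreover have "a \<le> 1 + 4 * \<delta>" if "m \<le> 1" "a + 2 * (1 - m) \<le> 1 + 4 * \<delta> - d" "0 \<le> d" for a m d :: real
  proof -
    have "2 * m \<le> 2" using that(1) by simp
    moreover have "a + 2 - 2 * m \<le> 1 + 4 * \<delta> - d" using that(2) by (simp add: right_diff_distrib)
    ultimately show ?thesis using that(3) by linarith
  qed
  ultimately show ?thesis by blast
qed

end

text \<open>The operator sends a function to the expansion in the first tree whose coefficients are the
inner products with the second tree. Its norm is found by duality: test the image with its sign \<open>\<psi>\<close>. The
adjoint sends \<open>\<psi>\<close> to a function \<open>H\<close> in the span of the second tree, whose values are, by
\<open>tree_fun_path\<close>, the integrals of \<open>\<psi>\<close> against path sums of the first tree. These have
\<open>L\<^sup>1\<close>-norm at most \<open>1 + 4\<delta>\<close>, where \<open>\<delta>\<close> belongs to the first tree.\<close>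

lemma tree_projection_bound:
  assumes T: "haar_tree A s \<delta>" and T': "haar_tree A' s' \<delta>'" and f: "integrable U f"
  shows "(LINT x|U. \<bar>\<Sum>k<n. (LINT y|U. f y * tree_fun A' s' k y) * tree_fun A s k x / tree_weight A k\<bar>)
    \<le> (1 + 4 * \<delta>) * (LINT x|U. \<bar>f x\<bar>)"
proof -
  interpret T: haar_tree A s \<delta> by (rule T)
  interpret T': haar_tree A' s' \<delta>' by (rule T')
  define g where "g x = (\<Sum>k<n. (LINT y|U. f y * T'.r k y) * T.r k x / T.w k)" for x
  have intg: "integrable U g"
    unfolding g_def[abs_def] by (intro Bochner_Integration.integrable_sum) (simp add: T.integrable_tree_fun)
  \<comment> \<open>The sign of the image, so that its norm becomes an integral.\<close>
  define \<psi> where "\<psi> x = sgn (g x)" for x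
  have \<psi>: "\<psi> \<in> borel_measurable U" unfolding \<psi>_def[abs_def] using intg by measurable
  have \<psi>1: "\<bar>\<psi> x\<bar> \<le> 1" for x by (simp add: \<psi>_def sgn_if)
  define c where "c k = (LINT x|U. T.r k x * \<psi> x) / T.w k" for k
  have ir\<psi>: "integrable U (\<lambda>x. T.r k x * \<psi> x)" for k
    by (rule integrable_bounded_mult[OF T.integrable_tree_fun \<psi> \<psi>1])
  have ifr: "integrable U (\<lambda>x. f x * T'.r k x)" for k
    by (rule integrable_bounded_mult[OF f T'.tree_fun_measurable T'.abs_tree_fun_le])
  define H where "H x = (\<Sum>k<n. c k * T'.r k x)" for x
  have Hm: "H \<in> borel_measurable U" unfolding H_def[abs_def] by measurable
  have Hb: "\<bar>H x\<bar> \<le> 1 + 4 * \<delta>" for x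
  proof (cases "n = 0")
    case True
    then show ?thesis using T.\<delta>_nonneg by (simp add: H_def)
  next
    case False
    then have n: "1 \<le> n" by simp
    show ?thesis
    proof (rule T'.tree_fun_path[OF n, of x])
      assume "\<And>k. T'.r k x = 0"
      then show ?thesis using T.\<delta>_nonneg by (simp add: H_def)
    next
      fix K assume K: "1 \<le> K" "K < 2 * n" and r: "\<And>k. k < n \<Longrightarrow> T'.r k x = s' x * haar_sign k K"
      let ?R = "\<lambda>x. path_sum (\<lambda>k. T.r k x / T.w k) K"
      have R: "?R y = (\<Sum>k<n. haar_sign k K * (T.r k y / T.w k))" for y
        by (rule path_sum_eq[OF K, symmetric])
      have iR: "integrable U ?R"
        unfolding R by (intro Bochner_Integration.integrable_sum) (simp add: T.integrable_tree_fun)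
      have "H x = s' x * (\<Sum>k<n. c k * haar_sign k K)"
        unfolding H_def sum_distrib_left by (intro sum.cong) (auto simp: r)
      then have "\<bar>H x\<bar> = \<bar>\<Sum>k<n. c k * haar_sign k K\<bar>" by (simp add: abs_mult T'.abs_s)
      also have "(\<Sum>k<n. c k * haar_sign k K) = (\<Sum>k<n. haar_sign k K / T.w k * (LINT y|U. T.r k y * \<psi> y))"
        by (rule sum.cong) (simp_all add: c_def)
      also have "\<dots> = (LINT y|U. (\<Sum>k<n. haar_sign k K / T.w k * (T.r k y * \<psi> y)))"
        using ir\<psi> by simp
      also have "\<dots> = (LINT y|U. ?R y * \<psi> y)"
        unfolding R sum_distrib_right by (intro Bochner_Integration.integral_cong sum.cong refl) simp
      also have "\<bar>\<dots>\<bar> \<le> (LINT y|U. \<bar>?R y\<bar>)"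
      proof (rule order_trans[OF integral_abs_bound], rule integral_mono)
        show "\<bar>?R y * \<psi> y\<bar> \<le> \<bar>?R y\<bar>" for y
          using mult_left_mono[OF \<psi>1, of "\<bar>?R y\<bar>" y] by (simp add: abs_mult)
        show "integrable U (\<lambda>x. \<bar>?R x * \<psi> x\<bar>)"
          using integrable_bounded_mult[OF iR \<psi> \<psi>1] by simp
      qed (use iR in simp)
      also have "\<dots> \<le> 1 + 4 * \<delta>" by (rule T.path_norm_le[OF K(1)])
      finally show ?thesis .
    qed
  qed
  have "(LINT x|U. \<bar>g x\<bar>) = (LINT x|U. g x * \<psi> x)"
    unfolding \<psi>_def by (simp add: abs_sgn)
  also have "\<dots> = (LINT x|U. (\<Sum>k<n. (LINT y|U. f y * T'.r k y) / T.w k * (T.r k x * \<psi> x)))"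
    unfolding g_def sum_distrib_right by (intro Bochner_Integration.integral_cong sum.cong refl) simp
  also have "\<dots> = (\<Sum>k<n. (LINT y|U. f y * T'.r k y) * c k)"
    using ir\<psi> by (simp add: c_def times_divide_eq_left[symmetric] del: times_divide_eq_left)
  also have "\<dots> = (LINT y|U. (\<Sum>k<n. c k * (f y * T'.r k y)))"
    using ifr by simp (rule sum.cong, simp_all)
  also have "\<dots> = (LINT y|U. f y * H y)"
    unfolding H_def sum_distrib_left by (intro Bochner_Integration.integral_cong sum.cong refl) simp
  also have "\<dots> \<le> (LINT y|U. (1 + 4 * \<delta>) * \<bar>f y\<bar>)"
  proof (rule integral_mono)
    show "integrable U (\<lambda>y. f y * H y)" by (rule integrable_bounded_mult[OF f Hm Hb])
    show "f y * H y \<le> (1 + 4 * \<delta>) * \<bar>f y\<bar>" for y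
    proof -
      have "f y * H y \<le> \<bar>f y\<bar> * \<bar>H y\<bar>" by (metis abs_ge_self abs_mult)
      also have "\<dots> \<le> \<bar>f y\<bar> * (1 + 4 * \<delta>)" by (intro mult_left_mono Hb) simp
      finally show ?thesis by (simp add: mult.commute)
    qed
  qed (use f in simp)
  finally show ?thesis unfolding g_def by simp
qed

text \<open>The special case in which the function is itself a linear combination in the second tree; its
inner products recover the coefficients by orthogonality.\<close>

lemma tree_norm_compare:
  assumes T: "haar_tree A s \<delta>" and T': "haar_tree A' s' \<delta>'"
  shows "(LINT x|U. \<bar>\<Sum>k<n. a k / tree_weight A k * tree_fun A s k x\<bar>)
    \<le> (1 + 4 * \<delta>) * (LINT x|U. \<bar>\<Sum>k<n. a k / tree_weight A' k * tree_fun A' s' k x\<bar>)"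
proof -
  interpret T: haar_tree A s \<delta> by (rule T)
  interpret T': haar_tree A' s' \<delta>' by (rule T')
  define f where "f x = (\<Sum>k<n. a k / T'.w k * T'.r k x)" for x
  have f: "integrable U f"
    unfolding f_def[abs_def] by (intro Bochner_Integration.integrable_sum) (simp add: T'.integrable_tree_fun)
  have irr: "integrable U (\<lambda>x. T'.r j x * T'.r k x)" for j k
    by (rule integrable_bounded_mult[OF T'.integrable_tree_fun T'.tree_fun_measurable T'.abs_tree_fun_le])
  have coeff: "(LINT y|U. f y * T'.r k y) = a k" if "k < n" for k
  proof -
    have "(LINT y|U. f y * T'.r k y) = (LINT y|U. (\<Sum>j<n. a j / T'.w j * (T'.r j y * T'.r k y)))"
      unfolding f_def sum_distrib_right by (intro Bochner_Integration.integral_cong sum.cong refl) simp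
    also have "\<dots> = (\<Sum>j<n. a j / T'.w j * (if j = k then T'.w k else 0))"
      using irr by (simp add: T'.orthogonal)
    also have "\<dots> = (\<Sum>j<n. if j = k then a j else 0)"
      using T'.weight_pos[of k] by (intro sum.cong) auto
    finally show ?thesis using that by simp
  qed
  have "(\<Sum>k<n. (LINT y|U. f y * T'.r k y) * T.r k x / T.w k) = (\<Sum>k<n. a k / T.w k * T.r k x)" for x
    by (intro sum.cong) (auto simp: coeff)
  with tree_projection_bound[OF T T' f, of n] show ?thesis by (simp add: f_def)
qed

context haar_tree
begin

text \<open>The normalized indicator of node \<open>K\<close>, with sign \<open>s\<close>, evaluates a function of the tree at \<open>K\<close>: functions of
smaller index are constant there, the other ones have mean \<open>0\<close> on \<open>A K\<close> after multiplication by \<open>s\<close>.\<close>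

lemma node_indicator:
  assumes K: "1 \<le> K"
  defines "f \<equiv> \<lambda>x. s x * indicator (A K) x / measure U (A K)"
  shows "integrable U f" "(LINT x|U. \<bar>f x\<bar>) = 1" "(LINT x|U. f x * r k x) = haar_sign k K"
proof -
  have bm: "(\<lambda>x. s x * indicator (A K) x) \<in> borel_measurable U"
    using A_sets[OF K] by measurable
  have "integrable U (\<lambda>x. s x * indicator (A K) x)"
    by (rule integrable_bounded[OF bm, of 1]) (auto simp: abs_mult abs_s indicator_def)
  then show "integrable U f" unfolding f_def by simp
  have "\<bar>f x\<bar> = indicator (A K) x / measure U (A K)" for x
    by (auto simp: f_def abs_mult abs_s indicator_def)
  then show "(LINT x|U. \<bar>f x\<bar>) = 1"
    using integral_node(2)[OF K] A_pos[OF K] by simp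
  show "(LINT x|U. f x * r k x) = haar_sign k K"
  proof (cases "k < K")
    case True
    have "f x * r k x = haar_sign k K * (indicator (A K) x / measure U (A K))" for x
      using tree_fun_on_node[OF K True, of x] s_square[of x] by (cases "x \<in> A K") (auto simp: f_def)
    then show ?thesis using integral_node(2)[OF K] A_pos[OF K] by simp
  next
    case False
    then have k: "1 \<le> k" "K \<le> k" using K by auto
    have "f x * r k x = (if A k \<inter> A K = {} then 0 else
      (indicator (A (2 * k)) x - indicator (A (2 * k + 1)) x) / measure U (A K))" for x
    proof (cases "A k \<inter> A K = {}")
      case True
      then have "x \<in> A K \<Longrightarrow> r k x = 0" using tree_fun_outside[OF k(1), of x] by blast
      then show ?thesis using True by (cases "x \<in> A K") (simp_all add: f_def)
    next
      case False
      then obtain y where "y \<in> A K" "y \<in> A k" by blast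
      then have sub: "A k \<subseteq> A K" by (rule meet_subset[OF _ _ K k(2)])
      show ?thesis
      proof (cases "x \<in> A k")
        case True
        then show ?thesis using sub k s_square[of x] False by (auto simp: f_def tree_fun_def indicator_def)
      next
        case x: False
        then have "x \<notin> A (2 * k)" "x \<notin> A (2 * k + 1)" using child_subset[OF k(1)] by blast+
        then show ?thesis using tree_fun_outside[OF k(1) x] by simp
      qed
    qed
    then have "(\<lambda>x. f x * r k x) = (if A k \<inter> A K = {} then (\<lambda>x. 0) else
        (\<lambda>x. (indicator (A (2 * k)) x - indicator (A (2 * k + 1)) x) / measure U (A K)))"
      by (auto simp: fun_eq_iff)
    then have "(LINT x|U. f x * r k x) = 0"
      using integral_node_diff(2)[OF k(1)] by (simp del: One_nat_def)
    moreover have "haar_sign k K = 0" using haar_sign_eq_0[OF K, of k] k K by simp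
    ultimately show ?thesis by simp
  qed
qed

text \<open>The right-hand side does not mention the sets, hence the dual norm is the same for all trees.\<close>

lemma dual_norm_le_iff:
  "norm (\<Sum>k<n. c k *\<^sub>R dual_of (r k)) \<le> M \<longleftrightarrow> 0 \<le> M \<and> (\<forall>K\<ge>1. \<bar>\<Sum>k<n. c k * haar_sign k K\<bar> \<le> M)"
proof -
  have eq: "(\<Sum>k<n. c k *\<^sub>R dual_of (r k)) = dual_of (\<lambda>x. \<Sum>k<n. c k * r k x)"
    by (rule dual_of_sum[where M = "\<lambda>_. 1"]) (auto simp: abs_tree_fun_le tree_fun_measurable)
  have m: "(\<lambda>x. \<Sum>k<n. c k * r k x) \<in> borel_measurable U" by measurable
  show ?thesis
  proof (intro iffI conjI allI impI)
    assume M: "norm (\<Sum>k<n. c k *\<^sub>R dual_of (r k)) \<le> M"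
    show "0 \<le> M" using M norm_ge_zero order_trans by blast
    fix K :: nat assume K: "1 \<le> K"
    let ?f = "\<lambda>x. s x * indicator (A K) x / measure U (A K)"
    note nf = node_indicator[OF K]
    have app: "blinfun_apply (\<Sum>k<n. c k *\<^sub>R dual_of (r k)) (abs_L1 ?f) = (\<Sum>k<n. c k * haar_sign k K)"
      using nf(3) by (simp add: blinfun.sum_left blinfun.scaleR_left dual_of_apply[OF tree_fun_measurable abs_tree_fun_le nf(1)])
    have "\<bar>\<Sum>k<n. c k * haar_sign k K\<bar> \<le> norm (\<Sum>k<n. c k *\<^sub>R dual_of (r k)) * norm (abs_L1 ?f)"
      using norm_blinfun[of "\<Sum>k<n. c k *\<^sub>R dual_of (r k)" "abs_L1 ?f"] unfolding app real_norm_def .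
    then show "\<bar>\<Sum>k<n. c k * haar_sign k K\<bar> \<le> M" using M nf(1,2) by (simp add: norm_abs_L1)
  next
    assume M: "0 \<le> M \<and> (\<forall>K\<ge>1. \<bar>\<Sum>k<n. c k * haar_sign k K\<bar> \<le> M)"
    have "\<bar>\<Sum>k<n. c k * r k x\<bar> \<le> M" for x
    proof (cases "n = 0")
      case False
      then have n: "1 \<le> n" by simp
      show ?thesis
      proof (rule tree_fun_path[OF n, of x])
        fix K assume K: "1 \<le> K" and r: "\<And>k. k < n \<Longrightarrow> r k x = s x * haar_sign k K"
        have "(\<Sum>k<n. c k * r k x) = s x * (\<Sum>k<n. c k * haar_sign k K)"
          unfolding sum_distrib_left by (intro sum.cong) (auto simp: r)
        then show ?thesis using M K by (simp add: abs_mult abs_s)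
      qed (use M in simp)
    qed (use M in simp)
    then show "norm (\<Sum>k<n. c k *\<^sub>R dual_of (r k)) \<le> M"
      unfolding eq by (intro norm_dual_of_le m)
  qed
qed

end

lemma tree_dual_norm_eq:
  assumes "haar_tree A s \<delta>" "haar_tree A' s' \<delta>'"
  shows "norm (\<Sum>k<n. c k *\<^sub>R dual_of (tree_fun A s k)) = norm (\<Sum>k<n. c k *\<^sub>R dual_of (tree_fun A' s' k))"
  using haar_tree.dual_norm_le_iff[OF assms(1)] haar_tree.dual_norm_le_iff[OF assms(2)]
  by (intro antisym) blast+

section \<open>The Haar system is a Schauder basis\<close>

context haar_tree
begin

lemma integral_abs_tree_fun: "(LINT x|U. \<bar>r k x\<bar>) = w k"
proof -
  have "\<bar>r k x\<bar> = r k x * r k x" for x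
    using s_sign[of x] by (auto simp: tree_fun_def indicator_def)
  then show ?thesis using orthogonal[of k k] by simp
qed

text \<open>Discard every node whose set meets the set of a smaller node of the family. Since nodes that meet are nested,
this leaves a disjoint family with the same union, which is then exhausted by its finite parts.\<close>

lemma finite_subfamily:
  assumes C: "C \<subseteq> {1..}" and \<epsilon>: "0 < \<epsilon>"
  obtains B where "finite B" "B \<subseteq> C" "disjoint_family_on A B"
    "measure U (\<Union>k\<in>C. A k) - \<epsilon> < measure U (\<Union>k\<in>B. A k)"
proof -
  \<comment> \<open>A point lies in the set of the least node of \<open>C\<close> that contains it, and this node survives.\<close>
  define C' where "C' = {k\<in>C. \<forall>j\<in>C. j < k \<longrightarrow> A j \<inter> A k = {}}"
  have C'C: "C' \<subseteq> C" by (auto simp: C'_def)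
  have sets: "k \<in> C \<Longrightarrow> A k \<in> sets U" for k using C A_sets by auto
  have "(\<Union>k\<in>C. A k) \<subseteq> (\<Union>k\<in>C'. A k)"
  proof
    fix x assume "x \<in> (\<Union>k\<in>C. A k)"
    then obtain k where k: "k \<in> C \<and> x \<in> A k" by blast
    define m where "m = (LEAST k. k \<in> C \<and> x \<in> A k)"
    have m: "m \<in> C" "x \<in> A m" using LeastI[of "\<lambda>k. k \<in> C \<and> x \<in> A k", OF k] by (auto simp: m_def)
    have "A j \<inter> A m = {}" if j: "j \<in> C" "j < m" for j
    proof (rule ccontr)
      assume "A j \<inter> A m \<noteq> {}"
      then obtain y where "y \<in> A j" "y \<in> A m" by blast
      then have "A m \<subseteq> A j" using meet_subset[of y j m] j C by auto
      then have "j \<in> C \<and> x \<in> A j" using m(2) j(1) by blast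
      then have "m \<le> j" unfolding m_def by (rule Least_le)
      then show False using j(2) by simp
    qed
    then show "x \<in> (\<Union>k\<in>C'. A k)" using m by (auto simp: C'_def)
  qed
  then have un: "(\<Union>k\<in>C'. A k) = (\<Union>k\<in>C. A k)" using C'C by blast
  define F where "F m = (\<Union>k\<in>C' \<inter> {..<m}. A k)" for m
  have "(\<lambda>m. measure U (F m)) \<longlonglongrightarrow> measure U (\<Union>m. F m)"
  proof (rule U.finite_Lim_measure_incseq)
    show "range F \<subseteq> sets U" using sets C'C by (auto simp: F_def)
    show "incseq F" by (auto simp: F_def incseq_def intro: less_le_trans)
  qed
  also have "(\<Union>m. F m) = (\<Union>k\<in>C. A k)" unfolding un[symmetric] by (auto simp: F_def)
  finally have "\<forall>\<^sub>F m in sequentially. measure U (\<Union>k\<in>C. A k) - \<epsilon> < measure U (F m)"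
    using \<epsilon> by (intro order_tendstoD) auto
  then obtain m where m: "measure U (\<Union>k\<in>C. A k) - \<epsilon> < measure U (F m)"
    by (meson eventually_sequentially order_refl)
  show ?thesis
  proof (rule that)
    show "disjoint_family_on A (C' \<inter> {..<m})"
      unfolding disjoint_family_on_def
    proof (intro ballI impI)
      fix i j assume "i \<in> C' \<inter> {..<m}" "j \<in> C' \<inter> {..<m}" "i \<noteq> j"
      then show "A i \<inter> A j = {}" by (cases "i < j") (auto simp: C'_def)
    qed
  qed (use m C'C in \<open>auto simp: F_def\<close>)
qed

end

lemma dyadic_enum_cases:
  fixes k :: nat
  assumes "1 \<le> k"
  obtains j i where "1 \<le> i" "i \<le> 2 ^ j" "k = 2 ^ j + i - 1"
proof (rule that)
  show "1 \<le> k + 1 - 2 ^ floor_log k" "k + 1 - 2 ^ floor_log k \<le> 2 ^ floor_log k"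
    "k = 2 ^ floor_log k + (k + 1 - 2 ^ floor_log k) - 1"
    using floor_log_exp2_le[of k] floor_log_exp2_gt[of k] assms by auto
qed

lemma dyadic_enum_halves:
  assumes "1 \<le> k"
  shows "dyadic_enum (2 * k) = left_half (dyadic_enum k)" "dyadic_enum (2 * k + 1) = right_half (dyadic_enum k)"
proof -
  obtain j i where ji: "1 \<le> i" "i \<le> 2 ^ j" "k = 2 ^ j + i - 1" using dyadic_enum_cases[OF assms] .
  have k: "dyadic_enum k = dyadic j i" using dyadic_enum_eq[OF ji(1,2)] ji(3) by simp
  have "2 ^ Suc j + (2 * i - 1) - 1 = 2 * k" "2 ^ Suc j + 2 * i - 1 = 2 * k + 1" using ji by simp_all
  then have "dyadic_enum (2 * k) = dyadic (Suc j) (2 * i - 1)" "dyadic_enum (2 * k + 1) = dyadic (Suc j) (2 * i)"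
    using ji dyadic_enum_eq[of "2 * i - 1" "Suc j"] dyadic_enum_eq[of "2 * i" "Suc j"] by auto
  then show "dyadic_enum (2 * k) = left_half (dyadic_enum k)" "dyadic_enum (2 * k + 1) = right_half (dyadic_enum k)"
    using left_half_dyadic[OF ji(1), of j] k by simp_all
qed

lemma dyadic_enum_Un: "1 \<le> k \<Longrightarrow> dyadic_enum (2 * k) \<union> dyadic_enum (2 * k + 1) = dyadic_enum k"
  and dyadic_enum_disjoint: "1 \<le> k \<Longrightarrow> dyadic_enum (2 * k) \<inter> dyadic_enum (2 * k + 1) = {}"
  unfolding dyadic_enum_halves left_half_def right_half_def by auto

lemma dyadic_enum_1: "dyadic_enum 1 = {0..<1}"
  using dyadic_enum_eq[of 1 0] by (simp add: dyadic_def)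

lemma dyadic_enum_interval:
  assumes "1 \<le> k"
  obtains a where "0 \<le> a" "a + 1 / 2 ^ floor_log k \<le> 1" "dyadic_enum k = {a..<a + 1 / 2 ^ floor_log k}"
proof -
  obtain j i where ji: "1 \<le> i" "i \<le> 2 ^ j" "k = 2 ^ j + i - 1" using dyadic_enum_cases[OF assms] .
  have j: "floor_log k = j" using ji by (intro floor_log_eqI) auto
  have "real i \<le> 2 ^ j" using ji(2) by (metis of_nat_le_iff of_nat_numeral of_nat_power)
  then show ?thesis
    using ji(1) dyadic_enum_eq[OF ji(1,2)] unfolding j ji(3)[symmetric]
    by (intro that[of "(real i - 1) / 2 ^ j"]) (simp_all add: j dyadic_def add_divide_distrib[symmetric])
qed

lemma dyadic_enum_subset_unit:
  assumes "1 \<le> k"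
  shows "dyadic_enum k \<subseteq> {0..<1}"
proof -
  obtain a where "0 \<le> a" "a + 1 / 2 ^ floor_log k \<le> 1" "dyadic_enum k = {a..<a + 1 / 2 ^ floor_log k}"
    by (rule dyadic_enum_interval[OF assms])
  then show ?thesis by auto
qed

lemma
  fixes k :: nat
  assumes "1 \<le> k"
  shows dyadic_enum_sets: "dyadic_enum k \<in> sets U"
    and dyadic_enum_measure: "measure U (dyadic_enum k) = 1 / 2 ^ floor_log k"
proof -
  obtain a where a: "0 \<le> a" "a + 1 / 2 ^ floor_log k \<le> 1" and k: "dyadic_enum k = {a..<a + 1 / 2 ^ floor_log k}"
    by (rule dyadic_enum_interval[OF assms])
  have sub: "dyadic_enum k \<subseteq> {0..1}" unfolding k using a by auto
  show "dyadic_enum k \<in> sets U"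
    using sub unfolding sets_restrict_space by (intro image_eqI[of _ _ "dyadic_enum k"]) (auto simp: k)
  show "measure U (dyadic_enum k) = 1 / 2 ^ floor_log k"
    using sub by (subst measure_restrict_space) (auto simp: k)
qed

abbreviation "haar \<equiv> tree_fun dyadic_enum (\<lambda>_. 1)"
abbreviation "haar_weight \<equiv> tree_weight dyadic_enum"

lemma dyadic_children_measure:
  assumes "1 \<le> k"
  shows "measure U (dyadic_enum (2 * k)) = measure U (dyadic_enum k) / 2"
    "measure U (dyadic_enum (2 * k + 1)) = measure U (dyadic_enum k) / 2"
  using assms dyadic_enum_measure[of k] dyadic_enum_measure[of "2 * k"] dyadic_enum_measure[of "2 * k + 1"]
  by (simp_all add: floor_log_rec)

interpretation H: haar_tree dyadic_enum "\<lambda>_. 1" 0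
proof
  fix k :: nat assume k: "1 \<le> k"
  show "dyadic_enum k \<in> sets U" by (rule dyadic_enum_sets[OF k])
  show "dyadic_enum (2 * k) \<union> dyadic_enum (2 * k + 1) \<subseteq> dyadic_enum k" using dyadic_enum_Un[OF k] by simp
  show "dyadic_enum (2 * k) \<inter> dyadic_enum (2 * k + 1) = {}" by (rule dyadic_enum_disjoint[OF k])
  show "measure U (dyadic_enum (2 * k)) = measure U (dyadic_enum (2 * k + 1))"
    using dyadic_children_measure[OF k] by simp
  show "0 < measure U (dyadic_enum k)" by (simp add: dyadic_enum_measure[OF k])
  show "(1 - 0 / 2 ^ k) * measure U (dyadic_enum k) \<le> 2 * measure U (dyadic_enum (2 * k))"
    using dyadic_children_measure[OF k] by simp
qed simp_all

lemma haar_weight_eq: "1 \<le> k \<Longrightarrow> haar_weight k = measure U (dyadic_enum k)"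
  by (simp add: tree_weight_def dyadic_children_measure)

lemma haar_fun_eq: "haar_fun (dyadic_enum k) = haar k"
proof (cases "k = 0")
  case True
  then show ?thesis using dyadic_enum_1
    by (simp add: fun_eq_iff haar_fun_def tree_fun_def dyadic_enum_def[of 0])
next
  case False
  then have k: "1 \<le> k" by simp
  have "dyadic_enum k \<noteq> {}" using False by (simp add: dyadic_enum_def dyadic_nonempty)
  then show ?thesis using False dyadic_enum_halves[OF k]
    by (simp add: fun_eq_iff haar_fun_def tree_fun_def)
qed

lemma normalized_haar_eq: "normalized_haar k = (1 / haar_weight k) *\<^sub>R abs_L1 (haar k)"
  by (simp add: normalized_haar_def Let_def haar_fun_eq norm_abs_L1[OF H.integrable_tree_fun] H.integral_abs_tree_fun inverse_eq_divide)

lemma norm_normalized_haar: "norm (normalized_haar k) = 1"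
  using H.weight_pos[of k] by (simp add: normalized_haar_eq norm_abs_L1[OF H.integrable_tree_fun] H.integral_abs_tree_fun)

lemma haar_sum_eq: "finite S \<Longrightarrow> (\<Sum>k\<in>S. a k *\<^sub>R normalized_haar k) = abs_L1 (\<lambda>x. \<Sum>k\<in>S. a k / haar_weight k * haar k x)"
  by (simp add: normalized_haar_eq abs_L1_sum[OF _ H.integrable_tree_fun])

definition haar_dual :: "nat \<Rightarrow> L1 \<Rightarrow>\<^sub>L real"
  where "haar_dual k = dual_of (haar k)"

lemma haar_dual_apply: "integrable U f \<Longrightarrow> blinfun_apply (haar_dual k) (abs_L1 f) = (LINT x|U. f x * haar k x)"
  unfolding haar_dual_def by (rule dual_of_apply[OF H.tree_fun_measurable H.abs_tree_fun_le])

lemma haar_dual_biorthogonal: "is_biorthogonal normalized_haar k (haar_dual k)"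
  unfolding is_biorthogonal_def
  using H.weight_pos by (simp add: normalized_haar_eq blinfun.scaleR_right haar_dual_apply[OF H.integrable_tree_fun] H.orthogonal less_imp_neq[symmetric])

definition haar_proj :: "nat \<Rightarrow> L1 \<Rightarrow> L1"
  where "haar_proj n x = (\<Sum>k<n. blinfun_apply (haar_dual k) x *\<^sub>R normalized_haar k)"

text \<open>Both trees in \<open>tree_projection_bound\<close> are the dyadic one, which has no losses.\<close>

lemma norm_haar_proj_le: "norm (haar_proj n x) \<le> norm x"
proof -
  obtain f where f: "integrable U f" "x = abs_L1 f" using integrable_rep_L1 abs_rep_L1 by metis
  have i: "integrable U (\<lambda>x. \<Sum>k<n. a k * haar k x)" for a :: "nat \<Rightarrow> real"
    by (intro Bochner_Integration.integrable_sum) (simp add: H.integrable_tree_fun)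
  have "norm (haar_proj n x) = (LINT x|U. \<bar>\<Sum>k<n. (LINT y|U. f y * haar k y) * haar k x / haar_weight k\<bar>)"
    unfolding haar_proj_def haar_sum_eq[OF finite_lessThan] norm_abs_L1[OF i] f(2) haar_dual_apply[OF f(1)] by simp
  also have "\<dots> \<le> (1 + 4 * 0) * (LINT x|U. \<bar>f x\<bar>)"
    by (rule tree_projection_bound[OF H.haar_tree_axioms H.haar_tree_axioms f(1)])
  finally show ?thesis by (simp add: f norm_abs_L1)
qed

lemma haar_proj_diff: "haar_proj n (x - y) = haar_proj n x - haar_proj n y"
  by (simp add: haar_proj_def blinfun.diff_right scaleR_diff_left sum_subtractf)

lemma dyadic_point: 
  assumes "x \<in> {0..<1}"
  shows "\<exists>k\<ge>n. 1 \<le> k \<and> x \<in> dyadic_enum k"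
proof (induction n)
  case 0
  then show ?case using assms dyadic_enum_1 by (intro exI[of _ 1]) simp
next
  case (Suc n)
  then obtain k where k: "k \<ge> n" "1 \<le> k" "x \<in> dyadic_enum k" by blast
  then have "x \<in> dyadic_enum (2 * k) \<or> x \<in> dyadic_enum (2 * k + 1)" using dyadic_enum_Un[OF k(2)] by blast
  then show ?case
  proof
    assume "x \<in> dyadic_enum (2 * k)"
    then show ?thesis using k by (intro exI[of _ "2 * k"]) auto
  next
    assume "x \<in> dyadic_enum (2 * k + 1)"
    then show ?thesis using k by (intro exI[of _ "2 * k + 1"]) auto
  qed
qed

lemma dyadic_diameter:
  assumes "1 \<le> k" "x \<in> dyadic_enum k" "y \<in> dyadic_enum k"
  shows "\<bar>x - y\<bar> < 2 / real k"
proof -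
  obtain a where "dyadic_enum k = {a..<a + 1 / 2 ^ floor_log k}" by (rule dyadic_enum_interval[OF assms(1)])
  then have "\<bar>x - y\<bar> < 1 / 2 ^ floor_log k" using assms(2,3) by auto
  also have "\<dots> \<le> 2 / real k"
  proof -
    have "real k < 2 * 2 ^ floor_log k"
      using floor_log_exp2_gt[of k] by (metis of_nat_less_iff of_nat_mult of_nat_numeral of_nat_power power_Suc)
    then show ?thesis using assms(1) by (simp add: field_simps)
  qed
  finally show ?thesis .
qed

lemma open_dyadic_union:
  assumes "open T"
  shows "(\<Union>k\<in>{k. 1 \<le> k \<and> dyadic_enum k \<subseteq> T}. dyadic_enum k) = T \<inter> {0..<1}"
proof
  show "(\<Union>k\<in>{k. 1 \<le> k \<and> dyadic_enum k \<subseteq> T}. dyadic_enum k) \<subseteq> T \<inter> {0..<1}"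
    using dyadic_enum_subset_unit by blast
  show "T \<inter> {0..<1} \<subseteq> (\<Union>k\<in>{k. 1 \<le> k \<and> dyadic_enum k \<subseteq> T}. dyadic_enum k)"
  proof
    fix x assume x: "x \<in> T \<inter> {0..<1}"
    then obtain d where d: "0 < d" "\<And>y. dist y x < d \<Longrightarrow> y \<in> T" using assms unfolding open_dist by blast
    obtain n where n: "2 / d < real n" using reals_Archimedean2 by blast
    obtain k where k: "k \<ge> n" "1 \<le> k" "x \<in> dyadic_enum k" using dyadic_point[of x n] x by blast
    have "2 / d < real k" using n k(1) by (meson less_le_trans of_nat_le_iff)
    then have "2 / real k < d" using d(1) k(2) by (simp add: field_simps)
    have "dyadic_enum k \<subseteq> T"
    proof
      fix y assume "y \<in> dyadic_enum k"
      then have "\<bar>y - x\<bar> < 2 / real k" using k by (intro dyadic_diameter) auto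
      then show "y \<in> T" using \<open>2 / real k < d\<close> by (intro d(2)) (simp add: dist_real_def)
    qed
    then show "x \<in> (\<Union>k\<in>{k. 1 \<le> k \<and> dyadic_enum k \<subseteq> T}. dyadic_enum k)" using k by blast
  qed
qed

lemma integral_indicator_unit: 
  assumes "S \<in> sets U"
  shows "integrable U (indicator S :: real \<Rightarrow> real)" "(LINT x|U. indicator S x) = measure U S"
  using assms sets.sets_into_space[OF assms] by (auto simp: U.emeasure_finite less_top[symmetric] Int_absorb2)

lemma dist_indicator:
  assumes "S \<in> sets U" "T \<in> sets U"
  shows "dist (abs_L1 (indicator S)) (abs_L1 (indicator T)) = measure U (S - T) + measure U (T - S)"
proof -
  have "\<bar>indicator S x - indicator T x\<bar> = (indicator (S - T) x + indicator (T - S) x :: real)" for x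
    by (auto simp: indicator_def)
  then have "dist (abs_L1 (indicator S)) (abs_L1 (indicator T)) = (LINT x|U. indicator (S - T) x + indicator (T - S) x)"
    using integral_indicator_unit(1)[OF assms(1)] integral_indicator_unit(1)[OF assms(2)] by (simp add: dist_abs_L1)
  also have "\<dots> = (LINT x|U. indicator (S - T) x) + (LINT x|U. indicator (T - S) x)"
    using assms by (intro Bochner_Integration.integral_add integral_indicator_unit) auto
  finally show ?thesis using assms integral_indicator_unit(2)[of "S - T"] integral_indicator_unit(2)[of "T - S"] by simp
qed

text \<open>The indicators of the halves of an interval are half the sum and half the difference of its indicator and its Haar
function.\<close>

lemma dyadic_indicator_span:
  "1 \<le> k \<Longrightarrow> abs_L1 (indicator (dyadic_enum k)) \<in> span (range normalized_haar)"
proof (induction k rule: heap_induct)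
  case root
  have "abs_L1 (indicator (dyadic_enum 1)) = haar_weight 0 *\<^sub>R normalized_haar 0"
    using H.weight_pos[of 0] by (simp add: normalized_haar_eq tree_fun_def[abs_def])
  then show ?case by (simp add: span_base span_scale)
next
  case (left k)
  have "abs_L1 (haar k) = haar_weight k *\<^sub>R normalized_haar k"
    using H.weight_pos[of k] by (simp add: normalized_haar_eq)
  then have h: "abs_L1 (haar k) \<in> span (range normalized_haar)" by (simp add: span_base span_scale)
  have "indicator (dyadic_enum (2 * k)) = (\<lambda>x. (1 / 2) * (indicator (dyadic_enum k) x + haar k x))"
    using left.hyps dyadic_enum_Un[OF left.hyps] dyadic_enum_disjoint[OF left.hyps]
    by (auto simp: fun_eq_iff tree_fun_def indicator_def)
  then have "abs_L1 (indicator (dyadic_enum (2 * k))) = (1 / 2) *\<^sub>R (abs_L1 (indicator (dyadic_enum k)) + abs_L1 (haar k))"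
    using H.integral_node(1)[OF left.hyps] H.integrable_tree_fun[of k] by (simp add: abs_L1_add abs_L1_scaleR)
  then show ?case using h left.IH by (metis span_add span_scale)
next
  case (right k)
  have "abs_L1 (haar k) = haar_weight k *\<^sub>R normalized_haar k"
    using H.weight_pos[of k] by (simp add: normalized_haar_eq)
  then have h: "abs_L1 (haar k) \<in> span (range normalized_haar)" by (simp add: span_base span_scale)
  have "indicator (dyadic_enum (2 * k + 1)) = (\<lambda>x. (1 / 2) * (indicator (dyadic_enum k) x - haar k x))"
    using right.hyps dyadic_enum_Un[OF right.hyps] dyadic_enum_disjoint[OF right.hyps]
    by (auto simp: fun_eq_iff tree_fun_def indicator_def)
  then have "abs_L1 (indicator (dyadic_enum (2 * k + 1))) = (1 / 2) *\<^sub>R (abs_L1 (indicator (dyadic_enum k)) - abs_L1 (haar k))"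
    using H.integral_node(1)[OF right.hyps] H.integrable_tree_fun[of k] by (simp add: abs_L1_diff abs_L1_scaleR)
  then show ?case using h right.IH by (metis span_diff span_scale)
qed

text \<open>A measurable set is approximated by an open one, an open set is a union of dyadic intervals, and finitely many disjoint
ones among them are enough. The point \<open>1\<close>, which no dyadic interval contains, is a null set.\<close>

lemma indicator_closure_span:
  assumes S: "S \<in> sets U"
  shows "abs_L1 (indicator S) \<in> closure (span (range normalized_haar))"
  unfolding closure_approachable
proof (intro allI impI)
  fix e :: real assume e: "0 < e"
  have SL: "S \<in> sets lebesgue" and S01: "S \<subseteq> {0..1}"
    using S sets_restrict_space_iff[of "{0..1}" lebesgue S] by auto
  obtain T where T: "open T" "S \<subseteq> T" "T - S \<in> lmeasurable" "emeasure lebesgue (T - S) < ennreal (e / 2)"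
    using sets_lebesgue_outer_open[OF SL, of "e / 2"] e by auto
  let ?C = "{k. 1 \<le> k \<and> dyadic_enum k \<subseteq> T}"
  obtain B where B: "finite B" "B \<subseteq> ?C" "disjoint_family_on dyadic_enum B"
    and mB: "measure U (\<Union>k\<in>?C. dyadic_enum k) - e / 2 < measure U (\<Union>k\<in>B. dyadic_enum k)"
    using H.finite_subfamily[of ?C "e / 2"] e by auto
  define V where "V = T \<inter> {0..<1}"
  define W where "W = (\<Union>k\<in>B. dyadic_enum k)"
  have VC: "V = (\<Union>k\<in>?C. dyadic_enum k)" using open_dyadic_union[OF T(1)] by (simp add: V_def)
  have WV: "W \<subseteq> V" unfolding VC W_def using B(2) by blast
  have Vs: "V \<in> sets U" unfolding VC using dyadic_enum_sets by (intro sets.countable_UN') auto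
  have Ws: "W \<in> sets U" unfolding W_def using B(1,2) dyadic_enum_sets by (intro sets.finite_UN) auto
  have "measure U (S - V) \<le> measure U {1}"
  proof (rule U.finite_measure_mono)
    show "S - V \<subseteq> {1}" using S01 T(2) by (auto simp: V_def)
    show "{1} \<in> sets U" by (simp add: sets_restrict_space_iff)
  qed
  also have "\<dots> = 0" by (simp add: measure_restrict_space)
  finally have SV: "measure U (S - V) = 0" using measure_nonneg[of U "S - V"] by linarith
  have "measure U (V - S) = measure lebesgue (V - S)"
    using Vs S by (subst measure_restrict_space) (auto simp: V_def)
  also have "\<dots> \<le> measure lebesgue (T - S)"
  proof (rule measure_mono_fmeasurable)
    show "V - S \<subseteq> T - S" by (auto simp: V_def)
    show "V - S \<in> sets lebesgue" using T(1) SL unfolding V_def by auto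
  qed (rule T(3))
  also have "\<dots> < e / 2" using T(3,4) e by (simp add: emeasure_eq_measure2 ennreal_less_iff)
  finally have VS: "measure U (V - S) < e / 2" .
  have "measure U (V - W) = measure U V - measure U W"
    using Vs Ws WV by (intro U.finite_measure_Diff) auto
  also have "\<dots> < e / 2" using mB by (simp add: VC W_def)
  finally have VW: "measure U (V - W) < e / 2" .
  have W: "abs_L1 (indicator W) = (\<Sum>k\<in>B. 1 *\<^sub>R abs_L1 (indicator (dyadic_enum k)))"
  proof -
    have "indicator W = (\<lambda>x. \<Sum>k\<in>B. 1 * indicator (dyadic_enum k) x :: real)"
      unfolding W_def using indicator_UN_disjoint[OF B(1,3)] by (intro ext) simp
    then show ?thesis using B H.integral_node(1) by (subst abs_L1_sum) auto
  qed
  have "abs_L1 (indicator W) \<in> span (range normalized_haar)"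
    unfolding W using B(2) by (intro span_sum span_scale dyadic_indicator_span) auto
  moreover have "dist (abs_L1 (indicator W)) (abs_L1 (indicator S)) < e"
  proof -
    have "dist (abs_L1 (indicator W)) (abs_L1 (indicator S))
      \<le> dist (abs_L1 (indicator V)) (abs_L1 (indicator W)) + dist (abs_L1 (indicator V)) (abs_L1 (indicator S))"
      by (rule dist_triangle3)
    also have "\<dots> = measure U (V - W) + measure U (W - V) + (measure U (V - S) + measure U (S - V))"
      by (simp add: dist_indicator Vs Ws S)
    also have "W - V = {}" using WV by blast
    finally show ?thesis using VW VS SV by simp
  qed
  ultimately show "\<exists>y\<in>span (range normalized_haar). dist y (abs_L1 (indicator S)) < e" by blast
qed

lemma subspace_closure:
  fixes S :: "'a::real_normed_vector set"
  assumes S: "subspace S"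
  shows "subspace (closure S)"
proof (rule subspaceI)
  show "0 \<in> closure S" using subspace_0[OF S] closure_subset by blast
  fix x y :: 'a and c :: real
  assume x: "x \<in> closure S"
  then obtain X where X: "\<And>n. X n \<in> S" "X \<longlonglongrightarrow> x" unfolding closure_sequential by blast
  show "c *\<^sub>R x \<in> closure S"
    unfolding closure_sequential using X subspace_scale[OF S]
    by (intro exI[of _ "\<lambda>n. c *\<^sub>R X n"]) (auto intro: tendsto_intros)
  assume "y \<in> closure S"
  then obtain Y where Y: "\<And>n. Y n \<in> S" "Y \<longlonglongrightarrow> y" unfolding closure_sequential by blast
  show "x + y \<in> closure S"
    unfolding closure_sequential using X Y subspace_add[OF S]
    by (intro exI[of _ "\<lambda>n. X n + Y n"]) (auto intro: tendsto_intros)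
qed

text \<open>Induction over integrable functions, from indicators through sums to dominated limits.\<close>

lemma haar_span_dense: "closure (span (range normalized_haar)) = UNIV"
proof -
  let ?S = "closure (span (range normalized_haar))"
  have sub: "subspace ?S" by (simp add: subspace_closure)
  have all: "abs_L1 f \<in> ?S" if "integrable U f" for f
    using that
  proof (induction f rule: integrable_induct)
    case (base A c)
    have "abs_L1 (\<lambda>x. indicator A x *\<^sub>R c) = c *\<^sub>R abs_L1 (indicator A)"
      using integral_indicator_unit(1)[OF base(1)] by (simp add: abs_L1_scaleR mult.commute)
    then show ?case using subspace_scale[OF sub indicator_closure_span[OF base(1)]] by simp
  next
    case (add f g)
    then show ?case using subspace_add[OF sub, of "abs_L1 f" "abs_L1 g"] by (simp add: abs_L1_add)
  next
    case (lim f s)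
    have lims: "\<And>x. x \<in> space U \<Longrightarrow> (\<lambda>i. s i x) \<longlonglongrightarrow> f x" by (fact lim)
    have bound: "\<And>i x. x \<in> space U \<Longrightarrow> norm (s i x) \<le> 2 * norm (f x)" by (fact lim)
    have ints: "\<And>i. integrable U (s i)" "integrable U f" by (fact lim)+
    have mem: "\<And>i. abs_L1 (s i) \<in> ?S" by (fact lim)
    have "(\<lambda>i. LINT x|U. \<bar>s i x - f x\<bar>) \<longlonglongrightarrow> (LINT x|U. 0)"
    proof (rule integral_dominated_convergence[where w = "\<lambda>x. 3 * \<bar>f x\<bar>"])
      show "AE x in U. (\<lambda>i. \<bar>s i x - f x\<bar>) \<longlonglongrightarrow> 0"
        by (intro AE_I2 tendsto_rabs_zero LIM_zero lims)
      show "AE x in U. norm \<bar>s i x - f x\<bar> \<le> 3 * \<bar>f x\<bar>" for i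
      proof (rule AE_I2)
        fix x assume "x \<in> space U"
        from bound[OF this, of i] show "norm \<bar>s i x - f x\<bar> \<le> 3 * \<bar>f x\<bar>"
          unfolding real_norm_def by linarith
      qed
    qed (use ints in auto)
    then have "(\<lambda>i. dist (abs_L1 (s i)) (abs_L1 f)) \<longlonglongrightarrow> 0" using ints by (simp add: dist_abs_L1)
    then have "(\<lambda>i. abs_L1 (s i)) \<longlonglongrightarrow> abs_L1 f" by (rule tendsto_dist_iff[THEN iffD2])
    then show ?case using closed_sequentially[of ?S "\<lambda>i. abs_L1 (s i)"] mem by simp
  qed
  have "x \<in> ?S" for x using all[OF integrable_rep_L1[of x]] unfolding abs_rep_L1 .
  then show ?thesis by blast
qed

text \<open>The projections are contractions and eventually fix each element of the dense span.\<close>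

lemma haar_proj_tendsto: "(\<lambda>n. haar_proj n x) \<longlonglongrightarrow> x"
proof (rule metric_LIMSEQ_I)
  fix e :: real assume e: "0 < e"
  have "x \<in> closure (span (range normalized_haar))" "0 < e / 2" using haar_span_dense e by simp_all
  then obtain y where y: "y \<in> span (range normalized_haar)" "dist y x < e / 2"
    unfolding closure_approachable by blast
  have "\<exists>N. \<forall>n\<ge>N. haar_proj n y = y"
    using y(1)
  proof (induction y rule: span_induct_alt)
    case base
    then show ?case by (simp add: haar_proj_def)
  next
    case (step c z y)
    then obtain N k where N: "\<And>n. n \<ge> N \<Longrightarrow> haar_proj n y = y" and k: "z = normalized_haar k" by blast
    have "haar_proj n (c *\<^sub>R z + y) = c *\<^sub>R z + y" if n: "n \<ge> max N (Suc k)" for n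
    proof -
      have "haar_proj n (c *\<^sub>R z) = (\<Sum>j<n. (if j = k then c else 0) *\<^sub>R normalized_haar j)"
        unfolding haar_proj_def k blinfun.scaleR_right
        using haar_dual_biorthogonal unfolding is_biorthogonal_def by (intro sum.cong) auto
      also have "\<dots> = (\<Sum>j<n. if j = k then c *\<^sub>R normalized_haar k else 0)" by (intro sum.cong) auto
      finally have "haar_proj n (c *\<^sub>R z) = c *\<^sub>R z" using n by (simp add: k)
      moreover have "haar_proj n (c *\<^sub>R z + y) = haar_proj n (c *\<^sub>R z) + haar_proj n y"
        by (simp add: haar_proj_def blinfun.add_right scaleR_add_left sum.distrib)
      ultimately show ?thesis using N n by simp
    qed
    then show ?case by blast
  qed
  then obtain N where N: "\<And>n. n \<ge> N \<Longrightarrow> haar_proj n y = y" by blast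
  have "dist (haar_proj n x) x < e" if "n \<ge> N" for n
  proof -
    have "haar_proj n x - x = haar_proj n (x - y) + (y - x)" by (simp add: haar_proj_diff N[OF that])
    then have "norm (haar_proj n x - x) \<le> norm (haar_proj n (x - y)) + norm (y - x)" by (metis norm_triangle_ineq)
    also have "\<dots> \<le> norm (x - y) + norm (y - x)" by (simp add: norm_haar_proj_le)
    also have "\<dots> < e" using y(2) by (simp add: dist_norm norm_minus_commute)
    finally show ?thesis by (simp add: dist_norm)
  qed
  then show "\<exists>N. \<forall>n\<ge>N. dist (haar_proj n x) x < e" by blast
qed

theorem normalized_schauder_basis_haar: "normalized_schauder_basis normalized_haar"
  unfolding normalized_schauder_basis_def schauder_basis_def
proof (intro conjI allI norm_normalized_haar)
  fix x
  show "\<exists>!a. (\<lambda>n. a n *\<^sub>R normalized_haar n) sums x"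
  proof (rule ex1I)
    show "(\<lambda>n. blinfun_apply (haar_dual n) x *\<^sub>R normalized_haar n) sums x"
      using haar_proj_tendsto[of x] by (simp add: sums_def haar_proj_def)
    fix a assume a: "(\<lambda>n. a n *\<^sub>R normalized_haar n) sums x"
    show "a = (\<lambda>n. blinfun_apply (haar_dual n) x)"
    proof
      fix k
      have "(\<lambda>n. blinfun_apply (haar_dual k) (a n *\<^sub>R normalized_haar n)) sums blinfun_apply (haar_dual k) x"
        using a by (rule bounded_linear.sums[OF blinfun.bounded_linear_right])
      moreover have "blinfun_apply (haar_dual k) (a n *\<^sub>R normalized_haar n) = (if n = k then a n else 0)" for n
        using haar_dual_biorthogonal[of k] by (simp add: is_biorthogonal_def blinfun.scaleR_right)
      ultimately have "(\<lambda>n. if n = k then a n else 0) sums blinfun_apply (haar_dual k) x" by simp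
      then show "a k = blinfun_apply (haar_dual k) x" using sums_single[of k a] sums_unique2 by blast
    qed
  qed
qed

lemma biorthogonal_haar: "biorthogonal normalized_haar k = haar_dual k"
  using normalized_schauder_basis_haar haar_dual_biorthogonal
  by (intro biorthogonal_eqI) (auto simp: normalized_schauder_basis_def)

section \<open>Closed subspaces of finite codimension\<close>

text \<open>The coefficient of \<open>b\<close> modulo \<open>W\<close> is a bounded functional on the span of \<open>W\<close> and \<open>b\<close>; here
\<open>d\<close> is a radius such that the ball around \<open>b\<close> misses \<open>W\<close>.\<close>

lemma closed_subspace_separation:
  fixes W :: "'a::real_normed_vector set"
  assumes W: "subspace W" "closed W" and b: "b \<notin> W"
  obtains d where "0 < d" "\<And>x c. x - c *\<^sub>R b \<in> W \<Longrightarrow> \<bar>c\<bar> * d \<le> norm x"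
proof -
  have "open (- W)" using W(2) by (simp add: open_Compl)
  then obtain d where d: "0 < d" "\<And>y. dist y b < d \<Longrightarrow> y \<in> - W"
    using b unfolding open_dist by blast
  have "\<bar>c\<bar> * d \<le> norm x" if w: "x - c *\<^sub>R b \<in> W" for x c
  proof (cases "c = 0")
    case False
    have "(- 1 / c) *\<^sub>R (x - c *\<^sub>R b) \<in> W" using W(1) w by (rule subspace_scale)
    then have "b - (1 / c) *\<^sub>R x \<in> W" using False by (simp add: algebra_simps)
    then have "d \<le> dist (b - (1 / c) *\<^sub>R x) b" using d(2) by (meson ComplD not_le)
    also have "\<dots> = norm x / \<bar>c\<bar>" by (simp add: dist_norm)
    finally show ?thesis using False by (simp add: field_simps)
  qed simp
  with d(1) show ?thesis by (rule that)
qed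

lemma closed_span_insert:
  fixes W :: "'a::real_normed_vector set"
  assumes W: "subspace W" "closed W"
  shows "closed (span (insert b W))"
proof (cases "b \<in> W")
  case True
  then show ?thesis using W by (simp add: insert_absorb span_eq_iff[THEN iffD2])
next
  case False
  obtain d where d: "0 < d" "\<And>x c. x - c *\<^sub>R b \<in> W \<Longrightarrow> \<bar>c\<bar> * d \<le> norm x"
    using closed_subspace_separation[OF W False] by blast
  have sW: "span W = W" using W(1) by simp
  show ?thesis unfolding closed_sequential_limits
  proof (intro allI impI, elim conjE)
    fix x l assume x: "\<forall>n. x n \<in> span (insert b W)" and l: "x \<longlonglongrightarrow> l"
    then have "\<exists>k. x n - k *\<^sub>R b \<in> W" for n using span_breakdown_eq[of "x n" b W] sW by simp
    then obtain c where c: "\<And>n. x n - c n *\<^sub>R b \<in> W" by metis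
    have diff: "\<bar>c m - c n\<bar> * d \<le> norm (x m - x n)" for m n
    proof (rule d(2))
      have "(x m - c m *\<^sub>R b) - (x n - c n *\<^sub>R b) \<in> W" using W(1) c c by (rule subspace_diff)
      then show "x m - x n - (c m - c n) *\<^sub>R b \<in> W" by (simp add: algebra_simps)
    qed
    have "Cauchy c"
    proof (rule metric_CauchyI)
      fix e :: real assume e: "0 < e"
      have "Cauchy x" using l by (rule LIMSEQ_imp_Cauchy)
      then obtain N where N: "\<And>m n. m \<ge> N \<Longrightarrow> n \<ge> N \<Longrightarrow> dist (x m) (x n) < e * d"
        using e d(1) unfolding Cauchy_def by (meson mult_pos_pos)
      have "dist (c m) (c n) < e" if "m \<ge> N" "n \<ge> N" for m n
      proof -
        have "\<bar>c m - c n\<bar> * d < e * d" using diff[of m n] N[OF that] by (simp add: dist_norm)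
        then show ?thesis using d(1) by (simp add: dist_real_def)
      qed
      then show "\<exists>M. \<forall>m\<ge>M. \<forall>n\<ge>M. dist (c m) (c n) < e" by blast
    qed
    then obtain c0 where "c \<longlonglongrightarrow> c0" using Cauchy_convergent convergent_def by blast
    then have "(\<lambda>n. x n - c n *\<^sub>R b) \<longlonglongrightarrow> l - c0 *\<^sub>R b" using l by (intro tendsto_intros)
    then have "l - c0 *\<^sub>R b \<in> W" by (rule closed_sequentially[OF W(2) c])
    then show "l \<in> span (insert b W)" unfolding span_breakdown_eq sW by blast
  qed
qed

text \<open>Induction on the number of vectors that span a complement. The functionals for the larger space
\<open>span (insert b W)\<close> give a bounded operator \<open>Q\<close> into that space, and the coefficient of \<open>b\<close> in \<open>Q x\<close> is the
functional of \<open>x\<close> that is still missing.\<close>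

lemma finite_codim_functionals:
  fixes W :: "'a::real_normed_vector set"
  assumes "finite B" "subspace W" "closed W" "span (W \<union> B) = UNIV"
  shows "\<exists>m (\<phi> :: nat \<Rightarrow> 'a \<Rightarrow> real) v. (\<forall>i. bounded_linear (\<phi> i)) \<and> (\<forall>x. x - (\<Sum>i<m. \<phi> i x *\<^sub>R v i) \<in> W)"
  using assms
proof (induction B arbitrary: W rule: finite_induct)
  case empty
  then have "W = UNIV" by (metis sup_bot_right span_eq_iff)
  then show ?case by (intro exI[of _ 0] exI[of _ "\<lambda>_ _. 0"]) (simp add: bounded_linear_zero)
next
  case (insert b B)
  show ?case
  proof (cases "b \<in> W")
    case True
    then have "W \<union> insert b B = W \<union> B" by blast
    then show ?thesis using insert by simp
  next
    case False
    let ?W = "span (insert b W)"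
    have sW: "span W = W" using insert.prems(1) by simp
    have "W \<union> insert b B \<subseteq> span (?W \<union> B)"
      by (auto intro: span_base span_mono[THEN subsetD, of "insert b W"])
    then have "span (?W \<union> B) = UNIV" 
      using insert.prems(3) span_minimal[OF _ subspace_span] by blast
    from insert.IH[OF subspace_span closed_span_insert[OF insert.prems(1,2)] this]
    obtain m :: nat and \<phi> :: "nat \<Rightarrow> 'a \<Rightarrow> real" and v
      where all: "(\<forall>i. bounded_linear (\<phi> i)) \<and> (\<forall>x. x - (\<Sum>i<m. \<phi> i x *\<^sub>R v i) \<in> ?W)"
      by (elim exE)
    have \<phi>: "\<And>i. bounded_linear (\<phi> i)" and v: "\<And>x. x - (\<Sum>i<m. \<phi> i x *\<^sub>R v i) \<in> ?W"
      using all by blast+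
    define Q where "Q x = x - (\<Sum>i<m. \<phi> i x *\<^sub>R v i)" for x
    have Q: "bounded_linear Q"
      unfolding Q_def[abs_def]
      by (intro bounded_linear_sub bounded_linear_ident bounded_linear_sum bounded_linear_scaleR_const \<phi>)
    obtain d where d: "0 < d" "\<And>x c. x - c *\<^sub>R b \<in> W \<Longrightarrow> \<bar>c\<bar> * d \<le> norm x"
      using closed_subspace_separation[OF insert.prems(1,2) False] by blast
    have "\<exists>k. Q x - k *\<^sub>R b \<in> W" for x
      using v[of x] span_breakdown_eq[of "Q x" b W] sW by (simp add: Q_def)
    then obtain \<psi> where \<psi>: "\<And>x. Q x - \<psi> x *\<^sub>R b \<in> W" by metis
    have uniq: "c = c'" if "x - c *\<^sub>R b \<in> W" "x - c' *\<^sub>R b \<in> W" for x c c'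
    proof -
      have "(x - c *\<^sub>R b) - (x - c' *\<^sub>R b) \<in> W" using insert.prems(1) that by (rule subspace_diff)
      then have "0 - (c - c') *\<^sub>R b \<in> W" by (simp add: algebra_simps)
      from d(2)[OF this] show ?thesis using d(1) by (simp add: mult_le_0_iff)
    qed
    interpret Q: bounded_linear Q by (rule Q)
    obtain C where C: "\<And>x. norm (Q x) \<le> norm x * C" using Q.bounded by blast
    have "bounded_linear \<psi>"
    proof (rule bounded_linear_intro)
      fix x y and r :: real
      have "(Q x - \<psi> x *\<^sub>R b) + (Q y - \<psi> y *\<^sub>R b) \<in> W" using insert.prems(1) \<psi> \<psi> by (rule subspace_add)
      then have "Q (x + y) - (\<psi> x + \<psi> y) *\<^sub>R b \<in> W" by (simp add: Q.add algebra_simps)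
      then show "\<psi> (x + y) = \<psi> x + \<psi> y" using uniq \<psi> by blast
      have "r *\<^sub>R (Q x - \<psi> x *\<^sub>R b) \<in> W" using insert.prems(1) \<psi> by (rule subspace_scale)
      then have "Q (r *\<^sub>R x) - (r *\<^sub>R \<psi> x) *\<^sub>R b \<in> W" by (simp add: Q.scaleR algebra_simps)
      then show "\<psi> (r *\<^sub>R x) = r *\<^sub>R \<psi> x" using uniq \<psi> by blast
      have "\<bar>\<psi> x\<bar> * d \<le> norm x * C" using d(2)[OF \<psi>] C order_trans by blast
      then show "norm (\<psi> x) \<le> norm x * (C / d)" using d(1) by (simp add: field_simps)
    qed
    moreover have "x - (\<Sum>i<Suc m. (\<phi>(m := \<psi>)) i x *\<^sub>R (v(m := b)) i) \<in> W" for x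
      using \<psi>[of x] by (simp add: Q_def algebra_simps)
    ultimately show ?thesis using \<phi>
      by (intro exI[of _ "Suc m"] exI[of _ "\<phi>(m := \<psi>)"] exI[of _ "v(m := b)"]) auto
  qed
qed

definition test_seminorm :: "'a set \<Rightarrow> ('a::real_normed_vector \<Rightarrow>\<^sub>L real) \<Rightarrow> real"
  where "test_seminorm F f = (\<Sum>y\<in>F. \<bar>blinfun_apply f y\<bar>)"

lemma test_seminorm_nonneg: "0 \<le> test_seminorm F f"
  by (simp add: test_seminorm_def sum_nonneg)

lemma test_seminorm_triangle: "test_seminorm F (f + g) \<le> test_seminorm F f + test_seminorm F g"
  unfolding test_seminorm_def sum.distrib[symmetric]
  by (intro sum_mono) (simp add: blinfun.add_left)

lemma test_seminorm_scaleR: "test_seminorm F (c *\<^sub>R f) = \<bar>c\<bar> * test_seminorm F f"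
  by (simp add: test_seminorm_def sum_distrib_left blinfun.scaleR_left abs_mult)

lemma test_seminorm_minus: "test_seminorm F (- f) = test_seminorm F f"
  by (simp add: test_seminorm_def blinfun.minus_left)

lemma test_seminorm_diff: "test_seminorm F (f - g) \<le> test_seminorm F f + test_seminorm F g"
  using test_seminorm_triangle[of F f "- g"] by (simp add: test_seminorm_minus)

lemma test_seminorm_le_norm: "test_seminorm F f \<le> norm f * (\<Sum>y\<in>F. norm y)"
  unfolding test_seminorm_def sum_distrib_left
  by (intro sum_mono) (metis norm_blinfun real_norm_def)

lemma test_seminorm_mono: "finite F' \<Longrightarrow> F \<subseteq> F' \<Longrightarrow> test_seminorm F f \<le> test_seminorm F' f"
  unfolding test_seminorm_def by (rule sum_mono2) auto

text \<open>Some weak-star neighbourhood of \<open>f\<close> does not meet \<open>G\<close>, expressed by a seminorm.\<close>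

definition weakly_separated :: "('a::real_normed_vector \<Rightarrow>\<^sub>L real) set \<Rightarrow> ('a \<Rightarrow>\<^sub>L real) \<Rightarrow> bool"
  where "weakly_separated G f \<longleftrightarrow> (\<exists>F \<epsilon>. finite F \<and> 0 < \<epsilon> \<and> (\<forall>g\<in>G. \<epsilon> \<le> test_seminorm F (f - g)))"

text \<open>A basic neighbourhood of \<open>f\<close> restricts the values at finitely many points; \<open>\<epsilon>\<close> is the least of the
tolerances, with \<open>1\<close> added in case there are none.\<close>

lemma wstar_closed_separated:
  fixes G :: "('a::real_normed_vector \<Rightarrow>\<^sub>L real) set"
  assumes G: "closedin strong_operator_topology G" and f: "f \<notin> G"
  shows "weakly_separated G f"
proof -
  have "openin strong_operator_topology (- G)"
    using G by (simp add: closedin_def strong_operator_topology_topspace Compl_eq_Diff_UNIV)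
  then obtain V where V: "openin euclidean V" "- G = blinfun_apply -` V \<inter> UNIV"
    unfolding strong_operator_topology_def openin_pullback_topology by blast
  have oV: "openin (product_topology (\<lambda>i. euclidean) UNIV) V" using V(1) by (simp add: euclidean_product_topology)
  have fV: "blinfun_apply f \<in> V" using f V(2) by blast
  obtain X where X: "blinfun_apply f \<in> (\<Pi>\<^sub>E i\<in>UNIV. X i)" "\<And>i. openin euclidean (X i)"
      "finite {i. X i \<noteq> topspace euclidean}" "(\<Pi>\<^sub>E i\<in>UNIV. X i) \<subseteq> V"
    using product_topology_open_contains_basis[OF oV fV] by auto
  let ?F = "{i. X i \<noteq> UNIV}"
  have F: "finite ?F" using X(3) by simp
  have "\<exists>e>0. \<forall>z. \<bar>blinfun_apply f y - z\<bar> < e \<longrightarrow> z \<in> X y" for y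
  proof -
    have "open (X y)" "blinfun_apply f y \<in> X y" using X(1,2) by (auto simp: PiE_def)
    then show ?thesis unfolding open_dist by (metis dist_real_def abs_minus_commute)
  qed
  then obtain e where e: "\<And>y. 0 < e y" "\<And>y z. \<bar>blinfun_apply f y - z\<bar> < e y \<Longrightarrow> z \<in> X y"
    by metis
  define \<epsilon> where "\<epsilon> = Min (insert 1 (e ` ?F))"
  have \<epsilon>: "0 < \<epsilon>" "\<And>y. y \<in> ?F \<Longrightarrow> \<epsilon> \<le> e y" using F e(1) by (auto simp: \<epsilon>_def)
  have "\<epsilon> \<le> test_seminorm ?F (f - g)" if g: "g \<in> G" for g
  proof -
    have "blinfun_apply g \<notin> V" using g V(2) by blast
    then obtain y where y: "blinfun_apply g y \<notin> X y" using X(4) by (auto simp: PiE_def)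
    then have yF: "y \<in> ?F" by auto
    have "\<epsilon> \<le> \<bar>blinfun_apply f y - blinfun_apply g y\<bar>" using e(2)[of y] y \<epsilon>(2)[OF yF] by force
    also have "\<dots> \<le> test_seminorm ?F (f - g)"
      unfolding test_seminorm_def blinfun.diff_left using yF F
      by (intro member_le_sum) auto
    finally show ?thesis .
  qed
  then show ?thesis using F \<epsilon>(1) unfolding weakly_separated_def by blast
qed

text \<open>The weak-star counterpart of \<open>closed_subspace_separation\<close>: the coefficient of \<open>v\<close>
modulo \<open>G\<close> is controlled by finitely many evaluations.\<close>

lemma weakly_separated_line:
  assumes G: "subspace G" and sep: "\<forall>g\<in>G. \<epsilon> \<le> test_seminorm F (v - g)" and g: "f - c *\<^sub>R v \<in> G"
    and \<epsilon>: "0 < \<epsilon>"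
  shows "\<bar>c\<bar> * \<epsilon> \<le> test_seminorm F f"
proof (cases "c = 0")
  case False
  have "(- 1 / c) *\<^sub>R (f - c *\<^sub>R v) \<in> G" using G g by (rule subspace_scale)
  then have "v - (1 / c) *\<^sub>R f \<in> G" using False by (simp add: algebra_simps)
  with sep have "\<epsilon> \<le> test_seminorm F (v - (v - (1 / c) *\<^sub>R f))" by blast
  then have "\<epsilon> \<le> test_seminorm F ((1 / c) *\<^sub>R f)" by simp
  then have "\<epsilon> \<le> test_seminorm F f / \<bar>c\<bar>" unfolding test_seminorm_scaleR by simp
  then show ?thesis using False by (simp add: field_simps)
qed (simp add: test_seminorm_nonneg)

text \<open>Adding one vector to a weak-star closed subspace keeps it weak-star closed. Suppose that the
seminorm separating \<open>v\<close> from \<open>G\<close> does not separate \<open>f\<close> from the larger space. Then the elements \<open>h n\<close> that approach \<open>f\<close> have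
coefficients of \<open>v\<close> that form a Cauchy sequence. With its limit \<open>c0\<close>, the vector
\<open>f - c0 v\<close> is outside \<open>G\<close>, and the seminorm that separates it from \<open>G\<close> takes care of coefficients
near \<open>c0\<close>; the first seminorm deals with the other coefficients.\<close>

lemma weakly_separated_span_insert:
  fixes G :: "('a::real_normed_vector \<Rightarrow>\<^sub>L real) set"
  assumes G: "subspace G" and sep: "\<And>f. f \<notin> G \<Longrightarrow> weakly_separated G f" and v: "v \<notin> G"
    and f: "f \<notin> span (insert v G)"
  shows "weakly_separated (span (insert v G)) f"
proof (cases "\<exists>F \<epsilon>. finite F \<and> 0 < \<epsilon> \<and> (\<forall>g\<in>span (insert v G). \<epsilon> \<le> test_seminorm F (f - g))")
  case True
  then show ?thesis unfolding weakly_separated_def .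
next
  case False
  have sG: "span G = G" using G by simp
  obtain F1 \<epsilon>1 where F1: "finite F1" "0 < \<epsilon>1" "\<forall>g\<in>G. \<epsilon>1 \<le> test_seminorm F1 (v - g)"
    using sep[OF v] unfolding weakly_separated_def by (elim exE conjE)
  note line = weakly_separated_line[OF G F1(3) _ F1(2)]
  have "\<exists>g\<in>span (insert v G). test_seminorm F1 (f - g) < 1 / real (Suc n)" for n
    using False F1(1) by (metis not_le of_nat_0_less_iff zero_less_Suc zero_less_divide_1_iff)
  then obtain h where h: "\<And>n. h n \<in> span (insert v G)" "\<And>n. test_seminorm F1 (f - h n) < 1 / real (Suc n)"
    by metis
  then have "\<exists>k. h n - k *\<^sub>R v \<in> G" for n using span_breakdown_eq[of "h n" v G] sG by simp
  then obtain c where c: "\<And>n. h n - c n *\<^sub>R v \<in> G" by metis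
  have cmp: "\<bar>a - c n\<bar> * \<epsilon>1 \<le> test_seminorm F1 (f - g) + 1 / real (Suc n)" if "g - a *\<^sub>R v \<in> G" for a g n
  proof -
    have "(g - a *\<^sub>R v) - (h n - c n *\<^sub>R v) \<in> G" using G that c by (rule subspace_diff)
    then have "(g - h n) - (a - c n) *\<^sub>R v \<in> G" by (simp add: algebra_simps)
    from line[OF this] have "\<bar>a - c n\<bar> * \<epsilon>1 \<le> test_seminorm F1 ((f - h n) - (f - g))" by simp
    also have "\<dots> \<le> test_seminorm F1 (f - h n) + test_seminorm F1 (f - g)" by (rule test_seminorm_diff)
    finally show ?thesis using h(2)[of n] by linarith
  qed
  have inv0: "(\<lambda>n. 1 / real (Suc n)) \<longlonglongrightarrow> 0" by (rule LIMSEQ_Suc[OF lim_1_over_n])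
  have "Cauchy c"
  proof (rule metric_CauchyI)
    fix e :: real assume e: "0 < e"
    then have "0 < e * \<epsilon>1 / 2" using F1(2) by simp
    from LIMSEQ_D[OF inv0 this] obtain N where N: "\<And>n. n \<ge> N \<Longrightarrow> 1 / real (Suc n) < e * \<epsilon>1 / 2" by auto
    have "dist (c m) (c n) < e" if "m \<ge> N" "n \<ge> N" for m n
    proof -
      have "\<bar>c m - c n\<bar> * \<epsilon>1 < e * \<epsilon>1"
        using cmp[OF c, of m n] h(2)[of m] N[OF that(1)] N[OF that(2)] by linarith
      then show ?thesis using F1(2) by (simp add: dist_real_def)
    qed
    then show "\<exists>M. \<forall>m\<ge>M. \<forall>n\<ge>M. dist (c m) (c n) < e" by blast
  qed
  then obtain c0 where c0: "c \<longlonglongrightarrow> c0" using Cauchy_convergent convergent_def by blast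
  have cmp0: "\<bar>a - c0\<bar> * \<epsilon>1 \<le> test_seminorm F1 (f - g)" if "g - a *\<^sub>R v \<in> G" for a g
  proof (rule LIMSEQ_le)
    show "(\<lambda>n. \<bar>a - c n\<bar> * \<epsilon>1) \<longlonglongrightarrow> \<bar>a - c0\<bar> * \<epsilon>1" using c0 by (intro tendsto_intros)
    show "(\<lambda>n. test_seminorm F1 (f - g) + 1 / real (Suc n)) \<longlonglongrightarrow> test_seminorm F1 (f - g)"
      using tendsto_add[OF tendsto_const inv0] by simp
  qed (use cmp[OF that] in blast)
  have "f - c0 *\<^sub>R v \<notin> G" using f unfolding span_breakdown_eq sG by blast
  from sep[OF this] obtain F2 \<epsilon>2 where F2: "finite F2" "0 < \<epsilon>2" "\<forall>g\<in>G. \<epsilon>2 \<le> test_seminorm F2 (f - c0 *\<^sub>R v - g)"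
    unfolding weakly_separated_def by (elim exE conjE)
  \<comment> \<open>Changing \<open>c0\<close> by at most \<open>\<rho>\<close> moves \<open>f - c0 v\<close> by at most half of \<open>\<epsilon>2\<close>.\<close>
  define \<rho> where "\<rho> = \<epsilon>2 / (2 * (test_seminorm F2 v + 1))"
  have q2: "0 \<le> test_seminorm F2 v" by (rule test_seminorm_nonneg)
  have \<rho>: "0 < \<rho>" "\<rho> * test_seminorm F2 v \<le> \<epsilon>2 / 2"
    using F2(2) q2 by (auto simp: \<rho>_def field_simps)
  have "min (\<epsilon>2 / 2) (\<rho> * \<epsilon>1) \<le> test_seminorm (F1 \<union> F2) (f - g)" if g: "g \<in> span (insert v G)" for g
  proof -
    obtain a where a: "g - a *\<^sub>R v \<in> G" using g unfolding span_breakdown_eq sG by blast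
    show ?thesis
    proof (cases "\<bar>a - c0\<bar> \<le> \<rho>")
      case True
      have eq: "(f - g) + (a - c0) *\<^sub>R v = f - c0 *\<^sub>R v - (g - a *\<^sub>R v)" by (simp add: algebra_simps)
      have "\<epsilon>2 \<le> test_seminorm F2 ((f - g) + (a - c0) *\<^sub>R v)"
        using F2(3) a unfolding eq by blast
      also have "\<dots> \<le> test_seminorm F2 (f - g) + \<bar>a - c0\<bar> * test_seminorm F2 v"
        using test_seminorm_triangle[of F2 "f - g" "(a - c0) *\<^sub>R v"] by (simp add: test_seminorm_scaleR)
      also have "\<bar>a - c0\<bar> * test_seminorm F2 v \<le> \<epsilon>2 / 2"
        using mult_right_mono[OF True q2] \<rho>(2) by linarith
      finally have "\<epsilon>2 / 2 \<le> test_seminorm F2 (f - g)" by simp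
      then show ?thesis using test_seminorm_mono[of "F1 \<union> F2" F2 "f - g"] F1(1) F2(1) by simp
    next
      case False
      then have "\<rho> * \<epsilon>1 \<le> \<bar>a - c0\<bar> * \<epsilon>1" using F1(2) by (intro mult_right_mono) auto
      also have "\<dots> \<le> test_seminorm F1 (f - g)" by (rule cmp0[OF a])
      finally show ?thesis using test_seminorm_mono[of "F1 \<union> F2" F1 "f - g"] F1(1) F2(1) by simp
    qed
  qed
  then show ?thesis unfolding weakly_separated_def
    using F1(1,2) F2(1,2) \<rho>(1) by (intro exI[of _ "F1 \<union> F2"] exI[of _ "min (\<epsilon>2 / 2) (\<rho> * \<epsilon>1)"]) auto
qed

text \<open>Induction as in \<open>finite_codim_functionals\<close>. An approximation \<open>h\<close> of \<open>f\<close> in the span of \<open>G\<close> and \<open>v\<close> is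
corrected by its component along \<open>v\<close>, which is small when finitely many values of \<open>f\<close> are.\<close>

lemma finite_codim_wstar_estimate:
  fixes G :: "('a::real_normed_vector \<Rightarrow>\<^sub>L real) set"
  assumes "finite B" "subspace G" "\<forall>f. f \<notin> G \<longrightarrow> weakly_separated G f" "span (G \<union> B) = UNIV"
  shows "\<exists>F K. finite F \<and> 0 \<le> K \<and> (\<forall>f. \<exists>g\<in>G. norm (f - g) \<le> K * test_seminorm F f)"
  using assms
proof (induction B arbitrary: G rule: finite_induct)
  case empty
  then have "G = UNIV" by (metis sup_bot_right span_eq_iff)
  then show ?case by (intro exI[of _ "{}"] exI[of _ 0]) simp
next
  case (insert v B)
  show ?case
  proof (cases "v \<in> G")
    case True
    then have "G \<union> insert v B = G \<union> B" by blast
    then show ?thesis using insert by simp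
  next
    case False
    let ?G = "span (insert v G)"
    have sG: "span G = G" using insert.prems(1) by simp
    have "G \<union> insert v B \<subseteq> span (?G \<union> B)"
      by (auto intro: span_base span_mono[THEN subsetD, of "insert v G"])
    then have "span (?G \<union> B) = UNIV" 
      using insert.prems(3) span_minimal[OF _ subspace_span] by blast
    moreover have "\<forall>f. f \<notin> ?G \<longrightarrow> weakly_separated ?G f"
      using weakly_separated_span_insert[OF insert.prems(1) _ False] insert.prems(2) by blast
    ultimately have "\<exists>F K. finite F \<and> 0 \<le> K \<and> (\<forall>f. \<exists>g\<in>?G. norm (f - g) \<le> K * test_seminorm F f)"
      using insert.IH[OF subspace_span] by blast
    then
    obtain F K where F: "finite F" and K: "0 \<le> K" and FK: "\<And>f. \<exists>g\<in>?G. norm (f - g) \<le> K * test_seminorm F f"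
      by (elim exE conjE) blast
    obtain F1 \<epsilon> where F1: "finite F1" "0 < \<epsilon>" "\<forall>g\<in>G. \<epsilon> \<le> test_seminorm F1 (v - g)"
      using insert.prems(2)[rule_format, OF False] unfolding weakly_separated_def by (elim exE conjE)
    define Y where "Y = (\<Sum>y\<in>F1. norm y)"
    have Y: "0 \<le> Y" by (simp add: Y_def sum_nonneg)
    define L where "L = K + norm v / \<epsilon> * (1 + K * Y)"
    have L: "0 \<le> L" unfolding L_def using K Y F1(2) by simp
    have "\<exists>g\<in>G. norm (f - g) \<le> L * test_seminorm (F \<union> F1) f" for f
    proof -
      define q where "q = test_seminorm (F \<union> F1) f"
      have q: "test_seminorm F f \<le> q" "test_seminorm F1 f \<le> q"
        unfolding q_def using F F1(1) by (auto intro!: test_seminorm_mono)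
      have q0: "0 \<le> q" by (simp add: q_def test_seminorm_nonneg)
      obtain h where h: "h \<in> ?G" "norm (f - h) \<le> K * test_seminorm F f" using FK by blast
      then have fh: "norm (f - h) \<le> K * q" using mult_left_mono[OF q(1) K] by linarith
      obtain c where c: "h - c *\<^sub>R v \<in> G" using h(1) unfolding span_breakdown_eq sG by blast
      have "\<bar>c\<bar> * \<epsilon> \<le> test_seminorm F1 h" by (rule weakly_separated_line[OF insert.prems(1) F1(3) c F1(2)])
      also have "\<dots> = test_seminorm F1 (f - (f - h))" by simp
      also have "\<dots> \<le> test_seminorm F1 f + test_seminorm F1 (f - h)" by (rule test_seminorm_diff)
      also have "\<dots> \<le> q + norm (f - h) * Y"
        using q(2) test_seminorm_le_norm[of F1 "f - h"] by (simp add: Y_def)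
      also have "\<dots> \<le> q + K * q * Y" using mult_right_mono[OF fh Y] by simp
      also have "\<dots> = (1 + K * Y) * q" by (simp add: algebra_simps)
      finally have "\<bar>c\<bar> \<le> (1 + K * Y) * q / \<epsilon>" using F1(2) by (simp add: field_simps)
      then have "\<bar>c\<bar> * norm v \<le> (1 + K * Y) * q / \<epsilon> * norm v" by (rule mult_right_mono) simp
      moreover have "norm (f - (h - c *\<^sub>R v)) \<le> norm (f - h) + \<bar>c\<bar> * norm v"
        using norm_triangle_ineq[of "f - h" "c *\<^sub>R v"] by (simp add: algebra_simps)
      ultimately have "norm (f - (h - c *\<^sub>R v)) \<le> K * q + (1 + K * Y) * q / \<epsilon> * norm v" using fh by linarith
      also have "\<dots> = L * q" by (simp add: L_def algebra_simps add_divide_distrib)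
      finally show ?thesis using c by (auto simp: q_def)
    qed
    then show ?thesis using F F1(1) L by (intro exI[of _ "F \<union> F1"] exI[of _ L]) auto
  qed
qed

section \<open>Late Haar blocks are almost annihilated by finitely many functionals\<close>

lemma abs_haar: "1 \<le> k \<Longrightarrow> \<bar>haar k x\<bar> = indicator (dyadic_enum k) x"
  using dyadic_enum_Un[of k] dyadic_enum_disjoint[of k] by (auto simp: tree_fun_def indicator_def)

lemma abs_disjoint_haar_sum:
  assumes B: "finite B" "B \<subseteq> {1..}" "disjoint_family_on dyadic_enum B" and e: "\<And>k. k \<in> B \<Longrightarrow> \<bar>e k\<bar> = 1"
  shows "\<bar>\<Sum>k\<in>B. e k * haar k x\<bar> = indicator (\<Union>k\<in>B. dyadic_enum k) x"
proof (cases "\<exists>k\<in>B. x \<in> dyadic_enum k")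
  case True
  then obtain k where k: "k \<in> B" "x \<in> dyadic_enum k" by blast
  have "haar j x = 0" if "j \<in> B - {k}" for j
  proof (rule H.tree_fun_outside)
    show "1 \<le> j" using that B(2) by auto
    show "x \<notin> dyadic_enum j" using that B(3) k unfolding disjoint_family_on_def by blast
  qed
  then have "(\<Sum>j\<in>B - {k}. e j * haar j x) = 0" by (intro sum.neutral) simp
  then have "(\<Sum>j\<in>B. e j * haar j x) = e k * haar k x"
    using sum.remove[OF B(1) k(1), of "\<lambda>j. e j * haar j x"] by simp
  moreover have "1 \<le> k" using k(1) B(2) by auto
  moreover have "x \<in> (\<Union>k\<in>B. dyadic_enum k)" using k by blast
  ultimately show ?thesis using k(2) e[OF k(1)] abs_haar[of k x] by (simp add: abs_mult)
next
  case False
  have "haar k x = 0" if "k \<in> B" for k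
    using that False B(2) by (intro H.tree_fun_outside) auto
  then have "(\<Sum>k\<in>B. e k * haar k x) = 0" by (intro sum.neutral) simp
  moreover have "x \<notin> (\<Union>k\<in>B. dyadic_enum k)" using False by blast
  ultimately show ?thesis by simp
qed

lemma measure_disjoint_union:
  assumes "finite B" "B \<subseteq> {1..}" "disjoint_family_on dyadic_enum B"
  shows "measure U (\<Union>k\<in>B. dyadic_enum k) = (\<Sum>k\<in>B. measure U (dyadic_enum k))"
  using assms dyadic_enum_sets by (intro U.finite_measure_finite_Union) auto

lemma measure_unit_le_1: "measure U S \<le> 1"
  using U.bounded_measure[of S] measure_unit_space by simp

lemma integral_abs_power2_le:
  fixes g :: "real \<Rightarrow> real"
  assumes g: "integrable U g" and g2: "integrable U (\<lambda>x. (g x)\<^sup>2)"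
  shows "(LINT x|U. \<bar>g x\<bar>)\<^sup>2 \<le> (LINT x|U. (g x)\<^sup>2)"
proof -
  define m where "m = (LINT x|U. \<bar>g x\<bar>)"
  have "0 \<le> (LINT x|U. (\<bar>g x\<bar> - m)\<^sup>2)" by (rule integral_nonneg_AE) simp
  also have "\<dots> = (LINT x|U. (g x)\<^sup>2 + (m\<^sup>2 - (2 * m) * \<bar>g x\<bar>))"
    by (simp add: power2_diff algebra_simps)
  also have "\<dots> = (LINT x|U. (g x)\<^sup>2) + ((LINT x|U. m\<^sup>2) - (2 * m) * (LINT x|U. \<bar>g x\<bar>))"
    using g g2 by (subst Bochner_Integration.integral_add, simp, simp) (subst Bochner_Integration.integral_diff, auto)
  also have "(LINT x|U. m\<^sup>2) = m\<^sup>2" using measure_unit_space by simp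
  finally show ?thesis by (simp add: m_def[symmetric] power2_eq_square)
qed

text \<open>Bessel's inequality for a functional on \<open>L\<^sup>1\<close>: test \<open>\<phi>\<close> with \<open>\<Sum> \<phi>(h\<^sub>k) h\<^sub>k / |I\<^sub>k|\<close> and bound the \<open>L\<^sup>1\<close>-norm
of this function by its \<open>L\<^sup>2\<close>-norm.\<close>

lemma bessel_functional:
  assumes \<phi>: "bounded_linear (\<phi> :: L1 \<Rightarrow> real)"
  obtains C where "\<And>S. finite S \<Longrightarrow> (\<Sum>k\<in>S. (\<phi> (abs_L1 (haar k)))\<^sup>2 / haar_weight k) \<le> C"
proof -
  interpret \<phi>: bounded_linear \<phi> by (rule \<phi>)
  obtain C where C: "0 \<le> C" "\<And>x. norm (\<phi> x) \<le> norm x * C" using \<phi>.nonneg_bounded by blast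
  have "(\<Sum>k\<in>S. (\<phi> (abs_L1 (haar k)))\<^sup>2 / haar_weight k) \<le> C\<^sup>2" if S: "finite S" for S
  proof -
    define Q where "Q = (\<Sum>k\<in>S. (\<phi> (abs_L1 (haar k)))\<^sup>2 / haar_weight k)"
    define a where "a k = \<phi> (abs_L1 (haar k)) / haar_weight k" for k
    define g where "g x = (\<Sum>k\<in>S. a k * haar k x)" for x
    have Q0: "0 \<le> Q" unfolding Q_def using H.weight_pos by (intro sum_nonneg) (simp add: less_imp_le)
    have gi: "integrable U g" unfolding g_def[abs_def] by (intro Bochner_Integration.integrable_sum) (simp add: H.integrable_tree_fun)
    have irr: "integrable U (\<lambda>x. haar j x * haar k x)" for j k
      by (rule integrable_bounded_mult[OF H.integrable_tree_fun H.tree_fun_measurable H.abs_tree_fun_le])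
    have gg: "(g x)\<^sup>2 = (\<Sum>j\<in>S. \<Sum>k\<in>S. (a j * a k) * (haar j x * haar k x))" for x
      unfolding g_def power2_eq_square sum_product by (intro sum.cong refl) simp
    have g2i: "integrable U (\<lambda>x. (g x)\<^sup>2)"
      unfolding gg by (intro Bochner_Integration.integrable_sum Bochner_Integration.integrable_mult_right irr)
    have "(LINT x|U. (g x)\<^sup>2) = (\<Sum>j\<in>S. \<Sum>k\<in>S. (a j * a k) * (LINT x|U. haar j x * haar k x))"
      unfolding gg by (subst Bochner_Integration.integral_sum)
        (auto intro!: Bochner_Integration.integrable_sum Bochner_Integration.integrable_mult_right irr sum.cong simp: irr)
    also have "\<dots> = (\<Sum>j\<in>S. \<Sum>k\<in>S. if j = k then (a k)\<^sup>2 * haar_weight k else 0)"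
      unfolding H.orthogonal by (intro sum.cong refl) (simp add: power2_eq_square)
    also have "\<dots> = (\<Sum>k\<in>S. (a k)\<^sup>2 * haar_weight k)" using S by simp
    also have "\<dots> = Q" unfolding Q_def a_def using H.weight_pos
      by (intro sum.cong refl) (simp add: power2_eq_square less_imp_neq[symmetric])
    finally have gQ: "(LINT x|U. (g x)\<^sup>2) = Q" .
    have ga: "abs_L1 g = (\<Sum>k\<in>S. a k *\<^sub>R abs_L1 (haar k))"
      unfolding g_def[abs_def] by (rule abs_L1_sum[symmetric, OF S H.integrable_tree_fun])
    have "\<phi> (abs_L1 g) = Q"
      unfolding ga Q_def a_def by (simp add: \<phi>.sum \<phi>.scaleR power2_eq_square)
    then have "Q \<le> (LINT x|U. \<bar>g x\<bar>) * C" using C(2)[of "abs_L1 g"] Q0 by (simp add: norm_abs_L1 gi)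
    then have "Q\<^sup>2 \<le> ((LINT x|U. \<bar>g x\<bar>) * C)\<^sup>2" using Q0 by (rule power_mono)
    also have "\<dots> \<le> Q * C\<^sup>2"
      using integral_abs_power2_le[OF gi g2i] unfolding gQ power_mult_distrib by (intro mult_right_mono) auto
    finally have "Q * Q \<le> Q * C\<^sup>2" by (simp add: power2_eq_square)
    then show ?thesis using Q0 unfolding Q_def[symmetric] by (cases "Q = 0") (auto simp: mult_le_cancel_left)
  qed
  then show ?thesis by (rule that)
qed

text \<open>For disjoint intervals \<open>\<Sum> |I\<^sub>k| \<le> 1\<close>, so Cauchy and Schwarz reduce the sum to a tail of the convergent series
of \<open>\<phi>(h\<^sub>k)\<^sup>2 / |I\<^sub>k|\<close>.\<close>

lemma small_functional:
  assumes \<phi>: "bounded_linear (\<phi> :: L1 \<Rightarrow> real)" and \<epsilon>: "0 < \<epsilon>"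
  shows "\<exists>N. \<forall>B. finite B \<and> B \<subseteq> {1..} \<and> B \<subseteq> {N..} \<and> disjoint_family_on dyadic_enum B \<longrightarrow>
    (\<Sum>k\<in>B. \<bar>\<phi> (abs_L1 (haar k))\<bar>) < \<epsilon>"
proof -
  define b where "b k = (\<phi> (abs_L1 (haar k)))\<^sup>2 / haar_weight k" for k
  have b0: "0 \<le> b k" for k unfolding b_def using H.weight_pos[of k] by simp
  obtain C where C: "\<And>S. finite S \<Longrightarrow> (\<Sum>k\<in>S. b k) \<le> C"
    using bessel_functional[OF \<phi>] unfolding b_def by blast
  have "summable b" by (rule summableI_nonneg_bounded[OF b0 C]) simp
  moreover have "0 < \<epsilon>\<^sup>2" using \<epsilon> by simp
  ultimately obtain N where N: "\<And>m n. m \<ge> N \<Longrightarrow> norm (sum b {m..<n}) < \<epsilon>\<^sup>2"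
    unfolding summable_Cauchy by blast
  have "(\<Sum>k\<in>B. \<bar>\<phi> (abs_L1 (haar k))\<bar>) < \<epsilon>"
    if B: "finite B" "B \<subseteq> {1..}" "B \<subseteq> {N..}" "disjoint_family_on dyadic_enum B" for B
  proof -
    have "(\<Sum>k\<in>B. \<bar>\<phi> (abs_L1 (haar k))\<bar>) = (\<Sum>k\<in>B. sqrt (b k) * sqrt (haar_weight k))"
      using H.weight_pos by (intro sum.cong refl) (simp add: b_def real_sqrt_mult[symmetric] less_imp_neq[symmetric])
    then have "(\<Sum>k\<in>B. \<bar>\<phi> (abs_L1 (haar k))\<bar>)\<^sup>2 \<le> (\<Sum>k\<in>B. (sqrt (b k))\<^sup>2) * (\<Sum>k\<in>B. (sqrt (haar_weight k))\<^sup>2)"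
      using Cauchy_Schwarz_ineq_sum[of "\<lambda>k. sqrt (b k)" "\<lambda>k. sqrt (haar_weight k)" B] by simp
    also have "\<dots> = (\<Sum>k\<in>B. b k) * (\<Sum>k\<in>B. measure U (dyadic_enum k))"
      using B(2) b0 by (simp add: haar_weight_eq subset_iff)
    also have "\<dots> \<le> (\<Sum>k\<in>B. b k) * 1"
      using measure_disjoint_union[OF B(1,2,4)] measure_unit_le_1 b0 by (intro mult_left_mono sum_nonneg) (metis, simp)
    also have "\<dots> \<le> sum b {N..<Suc (Max (insert 0 B))}"
    proof -
      have "B \<subseteq> {N..<Suc (Max (insert 0 B))}" using B(1,3) by (auto simp: less_Suc_eq_le)
      then have "sum b B \<le> sum b {N..<Suc (Max (insert 0 B))}" using b0 by (intro sum_mono2) auto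
      then show ?thesis by simp
    qed
    also have "\<dots> < \<epsilon>\<^sup>2" using N[of N "Suc (Max (insert 0 B))"] by simp
    finally show ?thesis using \<epsilon> by (simp add: power_less_imp_less_base)
  qed
  then show ?thesis by blast
qed

text \<open>The threshold \<open>N\<close> works for all signs at once, and for all normalizations \<open>w\<close> bounded below, since
these are known only after the threshold has been used.\<close>

lemma block_near_subspace:
  assumes W: "W \<in> cof" and tol: "0 < tol" and w0: "0 < w0"
  shows "\<exists>N. \<forall>B e w. finite B \<and> B \<subseteq> {1..} \<and> B \<subseteq> {N..} \<and> disjoint_family_on dyadic_enum B \<and>
    (\<forall>k\<in>B. \<bar>e k\<bar> = 1) \<and> w0 \<le> w \<longrightarrow> infdist (\<Sum>k\<in>B. (e k / w) *\<^sub>R abs_L1 (haar k)) W < tol"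
proof -
  obtain B0 where B0: "finite B0" "subspace W" "closed W" "span (W \<union> B0) = UNIV"
    using W unfolding cof_def finite_codimensional_def by blast
  obtain m :: nat and \<phi> :: "nat \<Rightarrow> L1 \<Rightarrow> real" and v
    where all: "(\<forall>i. bounded_linear (\<phi> i)) \<and> (\<forall>x. x - (\<Sum>i<m. \<phi> i x *\<^sub>R v i) \<in> W)"
    using finite_codim_functionals[OF B0] by (elim exE)
  have \<phi>: "bounded_linear (\<phi> i)" for i using all by blast
  define V where "V = (\<Sum>i<m. norm (v i))"
  have V: "0 \<le> V" by (simp add: V_def sum_nonneg)
  define \<epsilon> where "\<epsilon> = tol * w0 / (V + 1)"
  have \<epsilon>: "0 < \<epsilon>" using tol w0 V by (simp add: \<epsilon>_def)
  from small_functional[OF \<phi> \<epsilon>] obtain N where N: "\<And>i B. finite B \<and> B \<subseteq> {1..} \<and> B \<subseteq> {N i..} \<and> disjoint_family_on dyadic_enum B \<Longrightarrow>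
    (\<Sum>k\<in>B. \<bar>\<phi> i (abs_L1 (haar k))\<bar>) < \<epsilon>" by metis
  define M where "M = (\<Sum>i<m. N i)"
  have NM: "N i \<le> M" if "i < m" for i unfolding M_def using that by (intro member_le_sum) auto
  have "infdist (\<Sum>k\<in>B. (e k / w) *\<^sub>R abs_L1 (haar k)) W < tol"
    if B: "finite B" "B \<subseteq> {1..}" "B \<subseteq> {M..}" "disjoint_family_on dyadic_enum B" and e: "\<forall>k\<in>B. \<bar>e k\<bar> = 1" and w: "w0 \<le> w"
    for B e w
  proof -
    define x where "x = (\<Sum>k\<in>B. (e k / w) *\<^sub>R abs_L1 (haar k))"
    have \<phi>x: "\<bar>\<phi> i x\<bar> \<le> \<epsilon> / w0" if i: "i < m" for i
    proof -
      interpret \<phi>i: bounded_linear "\<phi> i" by (rule \<phi>)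
      have "\<bar>\<phi> i x\<bar> \<le> (\<Sum>k\<in>B. \<bar>e k / w * \<phi> i (abs_L1 (haar k))\<bar>)"
        unfolding x_def \<phi>i.sum by (rule order_trans[OF sum_abs]) (simp add: \<phi>i.scaleR)
      also have "\<dots> = (\<Sum>k\<in>B. \<bar>\<phi> i (abs_L1 (haar k))\<bar>) / w"
        unfolding sum_divide_distrib using e w w0 by (intro sum.cong refl) (simp add: abs_mult)
      also have "\<dots> \<le> \<epsilon> / w0"
      proof (rule frac_le)
        have "B \<subseteq> {N i..}" using B(3) NM[OF i] by (meson atLeast_subset_iff order_trans)
        then show "(\<Sum>k\<in>B. \<bar>\<phi> i (abs_L1 (haar k))\<bar>) \<le> \<epsilon>" using N[of B i] B(1,2,4) by (simp add: less_imp_le)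
      qed (use \<epsilon> w w0 in auto)
      finally show ?thesis .
    qed
    have "infdist x W \<le> dist x (x - (\<Sum>i<m. \<phi> i x *\<^sub>R v i))" using all by (intro infdist_le) blast
    also have "\<dots> = norm (\<Sum>i<m. \<phi> i x *\<^sub>R v i)" by (simp add: dist_norm)
    also have "\<dots> \<le> (\<Sum>i<m. \<bar>\<phi> i x\<bar> * norm (v i))" by (rule order_trans[OF norm_sum]) simp
    also have "\<dots> \<le> (\<Sum>i<m. \<epsilon> / w0 * norm (v i))" using \<phi>x by (intro sum_mono mult_right_mono) auto
    also have "\<dots> = \<epsilon> / w0 * V" by (simp add: V_def sum_distrib_left)
    also have "\<dots> = tol * (V / (V + 1))" using w0 by (simp add: \<epsilon>_def)
    also have "\<dots> < tol * 1" using tol V by (intro mult_strict_left_mono) (auto simp: field_simps)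
    finally show ?thesis by (simp add: x_def)
  qed
  then show ?thesis by blast
qed

text \<open>The block has norm at most \<open>1\<close> because the intervals are disjoint, and it vanishes on the image
of \<open>haar_proj N\<close>. So its value at \<open>y\<close> is at most the norm of \<open>y - haar_proj N y\<close>.\<close>

lemma dual_block_near_subspace:
  assumes G: "G \<in> cof_wstar" and tol: "0 < tol"
  shows "\<exists>N. \<forall>B e. finite B \<and> B \<subseteq> {1..} \<and> B \<subseteq> {N..} \<and> disjoint_family_on dyadic_enum B \<and>
    (\<forall>k\<in>B. \<bar>e k\<bar> = 1) \<longrightarrow> infdist (\<Sum>k\<in>B. e k *\<^sub>R haar_dual k) G < tol"
proof -
  obtain B0 where B0: "finite B0" "subspace G" "closedin strong_operator_topology G" "span (G \<union> B0) = UNIV"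
    using G unfolding cof_wstar_def finite_codimensional_def by blast
  have "\<forall>f. f \<notin> G \<longrightarrow> weakly_separated G f" using wstar_closed_separated[OF B0(3)] by blast
  from finite_codim_wstar_estimate[OF B0(1,2) this B0(4)]
  obtain F K where F: "finite F" and K: "0 \<le> K" and FK: "\<forall>f. \<exists>g\<in>G. norm (f - g) \<le> K * test_seminorm F f"
    by (elim exE conjE)
  define \<epsilon> where "\<epsilon> = tol / ((K + 1) * (real (card F) + 1))"
  have \<epsilon>: "0 < \<epsilon>" using tol K by (simp add: \<epsilon>_def)
  have "\<exists>N. \<forall>n\<ge>N. dist (haar_proj n y) y < \<epsilon>" for y
    using haar_proj_tendsto[of y] \<epsilon> by (rule metric_LIMSEQ_D)
  then obtain N where N: "\<And>y n. n \<ge> N y \<Longrightarrow> dist (haar_proj n y) y < \<epsilon>" by metis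
  define M where "M = (\<Sum>y\<in>F. N y)"
  have NM: "N y \<le> M" if "y \<in> F" for y unfolding M_def using that F by (intro member_le_sum) auto
  have "infdist (\<Sum>k\<in>B. e k *\<^sub>R haar_dual k) G < tol"
    if B: "finite B" "B \<subseteq> {1..}" "B \<subseteq> {M..}" "disjoint_family_on dyadic_enum B" and e: "\<forall>k\<in>B. \<bar>e k\<bar> = 1" for B e
  proof -
    define f where "f = (\<Sum>k\<in>B. e k *\<^sub>R haar_dual k)"
    have feq: "f = dual_of (\<lambda>x. \<Sum>k\<in>B. e k * haar k x)"
      unfolding f_def haar_dual_def by (rule dual_of_sum[where M = "\<lambda>_. 1"]) (auto simp: B(1) H.abs_tree_fun_le H.tree_fun_measurable)
    have "\<bar>\<Sum>k\<in>B. e k * haar k x\<bar> \<le> 1" for x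
      using abs_disjoint_haar_sum[OF B(1,2,4), of e x] e by (simp add: indicator_def)
    then have nf: "norm f \<le> 1" unfolding feq by (intro norm_dual_of_le) measurable
    have fy: "\<bar>blinfun_apply f y\<bar> \<le> \<epsilon>" if y: "y \<in> F" for y
    proof -
      have "blinfun_apply f (normalized_haar j) = 0" if "j < M" for j
        using that B(3) haar_dual_biorthogonal
        by (auto simp: f_def blinfun.sum_left blinfun.scaleR_left is_biorthogonal_def intro!: sum.neutral)
      then have "blinfun_apply f (haar_proj M y) = 0"
        by (simp add: haar_proj_def blinfun.sum_right blinfun.scaleR_right)
      then have "blinfun_apply f y = blinfun_apply f (y - haar_proj M y)" by (simp add: blinfun.diff_right)
      then have "\<bar>blinfun_apply f y\<bar> \<le> norm f * norm (y - haar_proj M y)" using norm_blinfun[of f "y - haar_proj M y"] by simp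
      also have "\<dots> \<le> 1 * norm (y - haar_proj M y)" using nf by (intro mult_right_mono) auto
      also have "\<dots> \<le> \<epsilon>" using N[OF NM[OF y]] by (simp add: dist_norm norm_minus_commute)
      finally show ?thesis .
    qed
    obtain g where g: "g \<in> G" "norm (f - g) \<le> K * test_seminorm F f" using FK by blast
    have "infdist f G \<le> dist f g" using g(1) by (rule infdist_le)
    also have "\<dots> \<le> K * test_seminorm F f" using g(2) by (simp add: dist_norm)
    also have "\<dots> \<le> K * (real (card F) * \<epsilon>)"
      unfolding test_seminorm_def using K fy sum_bounded_above[of F "\<lambda>y. \<bar>blinfun_apply f y\<bar>" \<epsilon>]
      by (intro mult_left_mono) auto
    also have "\<dots> < (K + 1) * ((real (card F) + 1) * \<epsilon>)"
    proof (rule mult_strict_mono)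
      show "real (card F) * \<epsilon> < (real (card F) + 1) * \<epsilon>" using \<epsilon> by (simp add: distrib_right)
    qed (use K \<epsilon> in auto)
    also have "\<dots> = tol" using K by (simp add: \<epsilon>_def)
    finally show ?thesis by (simp add: f_def)
  qed
  then show ?thesis by blast
qed

section \<open>Disjoint dyadic intervals from a prescribed index set\<close>

definition tail_union :: "nat set \<Rightarrow> nat \<Rightarrow> real set"
  where "tail_union M n = (\<Union>k\<in>{k\<in>M. 1 \<le> k \<and> n \<le> k}. dyadic_enum k)"

definition limsup_set :: "nat set \<Rightarrow> real set"
  where "limsup_set M = (\<Inter>n. tail_union M n)"

lemma tail_union_sets: "tail_union M n \<in> sets U"
  unfolding tail_union_def using dyadic_enum_sets by (intro sets.countable_UN') auto

lemma limsup_set_sets: "limsup_set M \<in> sets U"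
  unfolding limsup_set_def by (intro sets.countable_INT') (auto simp: tail_union_sets)

text \<open>Each point of \<open>[0,1)\<close> lies in infinitely many dyadic intervals, hence in infinitely many with index in one of the
two sets.\<close>

lemma limsup_sets_measure:
  assumes "M1 \<union> M2 = UNIV"
  shows "1 \<le> measure U (limsup_set M1) + measure U (limsup_set M2)"
proof -
  have "dyadic_enum 1 \<subseteq> limsup_set M1 \<union> limsup_set M2"
  proof (rule ccontr)
    assume "\<not> ?thesis"
    then obtain x m n where x: "x \<in> {0..<1}" "x \<notin> tail_union M1 m" "x \<notin> tail_union M2 n"
      unfolding limsup_set_def dyadic_enum_1 by blast
    obtain k where "k \<ge> max m n" "1 \<le> k" "x \<in> dyadic_enum k" using dyadic_point[OF x(1)] by blast
    moreover have "k \<in> M1 \<or> k \<in> M2" using assms by blast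
    ultimately show False using x(2,3) unfolding tail_union_def by auto
  qed
  then have "measure U (dyadic_enum 1) \<le> measure U (limsup_set M1 \<union> limsup_set M2)"
    by (intro U.finite_measure_mono sets.Un limsup_set_sets)
  also have "\<dots> \<le> measure U (limsup_set M1) + measure U (limsup_set M2)"
    by (intro measure_Un_le limsup_set_sets)
  finally show ?thesis using dyadic_enum_measure[of 1] by simp
qed

text \<open>Take \<open>n\<close> so large that the union of the intervals with index in \<open>M\<close> from \<open>n\<close> on exceeds \<open>L = limsup_set M\<close> by very
little. Those inside \<open>A\<close> cover \<open>A \<inter> L\<close>, because \<open>A\<close> does not cut late intervals. Intervals that are not almost
contained in \<open>L\<close> carry at least the fraction \<open>d\<close> of their measure in the small excess, so that
in a disjoint family they may be discarded.\<close>

lemma dyadic_cover_in_limsup: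
  assumes A: "A \<in> sets U" and dec: "\<forall>k\<ge>m. 1 \<le> k \<longrightarrow> dyadic_enum k \<subseteq> A \<or> dyadic_enum k \<inter> A = {}"
    and \<epsilon>: "0 < \<epsilon>" and d: "0 < d"
  obtains B where "finite B" "B \<subseteq> M" "B \<subseteq> {1..}" "B \<subseteq> {n..}" "disjoint_family_on dyadic_enum B"
    "\<And>k. k \<in> B \<Longrightarrow> dyadic_enum k \<subseteq> A"
    "\<And>k. k \<in> B \<Longrightarrow> measure U (dyadic_enum k - limsup_set M) \<le> d * measure U (dyadic_enum k)"
    "measure U (A \<inter> limsup_set M) - \<epsilon> < measure U (\<Union>k\<in>B. dyadic_enum k)"
proof -
  let ?L = "limsup_set M"
  have anti: "tail_union M j \<subseteq> tail_union M i" if "i \<le> j" for i j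
    using that unfolding tail_union_def by (intro UN_mono) auto
  have "(\<lambda>i. measure U (tail_union M i)) \<longlonglongrightarrow> measure U ?L"
    unfolding limsup_set_def
    by (rule U.finite_Lim_measure_decseq) (auto simp: tail_union_sets decseq_def dest: anti)
  then have "\<forall>\<^sub>F i in sequentially. measure U (tail_union M i) < measure U ?L + \<epsilon> * d / 2"
    using \<epsilon> d by (intro order_tendstoD) auto
  then obtain i0 where i0: "\<And>i. i \<ge> i0 \<Longrightarrow> measure U (tail_union M i) < measure U ?L + \<epsilon> * d / 2"
    unfolding eventually_sequentially by blast
  define i where "i = max i0 (max m n)"
  have LT: "?L \<subseteq> tail_union M i" unfolding limsup_set_def by blast
  have "measure U (tail_union M i - ?L) = measure U (tail_union M i) - measure U ?L"
    using LT by (intro U.finite_measure_Diff tail_union_sets limsup_set_sets)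
  then have TL: "measure U (tail_union M i - ?L) < \<epsilon> * d / 2" using i0[of i] by (simp add: i_def)
  define C where "C = {k\<in>M. 1 \<le> k \<and> i \<le> k \<and> dyadic_enum k \<subseteq> A}"
  have AC: "A \<inter> ?L \<subseteq> (\<Union>k\<in>C. dyadic_enum k)"
  proof
    fix x assume x: "x \<in> A \<inter> ?L"
    then have "x \<in> tail_union M i" using LT by blast
    then obtain k where k: "k \<in> M" "1 \<le> k" "i \<le> k" "x \<in> dyadic_enum k" unfolding tail_union_def by blast
    then have "dyadic_enum k \<subseteq> A" using dec[rule_format, of k] x by (auto simp: i_def)
    then show "x \<in> (\<Union>k\<in>C. dyadic_enum k)" using k by (auto simp: C_def)
  qed
  have C1: "C \<subseteq> {1..}" by (auto simp: C_def)
  have "0 < \<epsilon> / 2" using \<epsilon> by simp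
  from H.finite_subfamily[OF C1 this] obtain B0 where B0: "finite B0" "B0 \<subseteq> C" "disjoint_family_on dyadic_enum B0"
    and mB0: "measure U (\<Union>k\<in>C. dyadic_enum k) - \<epsilon> / 2 < measure U (\<Union>k\<in>B0. dyadic_enum k)" .
  have s: "k \<in> B0 \<Longrightarrow> dyadic_enum k \<in> sets U" for k using B0(2) C1 dyadic_enum_sets by auto
  define B where "B = {k\<in>B0. measure U (dyadic_enum k - ?L) \<le> d * measure U (dyadic_enum k)}"
  define D where "D = B0 - B"
  have D: "finite D" "D \<subseteq> B0" "D \<subseteq> {1..}" using B0 C1 by (auto simp: D_def)
  have Dd: "disjoint_family_on dyadic_enum D" using B0(3) D(2) by (rule disjoint_family_on_mono[rotated])
  have "d * measure U (\<Union>k\<in>D. dyadic_enum k) = (\<Sum>k\<in>D. d * measure U (dyadic_enum k))"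
    by (simp add: measure_disjoint_union[OF D(1,3) Dd] sum_distrib_left)
  also have "\<dots> \<le> (\<Sum>k\<in>D. measure U (dyadic_enum k - ?L))"
    by (intro sum_mono) (auto simp: D_def B_def)
  also have "\<dots> = measure U (\<Union>k\<in>D. dyadic_enum k - ?L)"
  proof (rule U.finite_measure_finite_Union[symmetric])
    show "disjoint_family_on (\<lambda>k. dyadic_enum k - ?L) D"
      using Dd unfolding disjoint_family_on_def by blast
    show "(\<lambda>k. dyadic_enum k - ?L) ` D \<subseteq> sets U" using D(2) s limsup_set_sets by blast
  qed (rule D(1))
  also have "\<dots> \<le> measure U (tail_union M i - ?L)"
  proof (rule U.finite_measure_mono)
    show "(\<Union>k\<in>D. dyadic_enum k - ?L) \<subseteq> tail_union M i - ?L"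
      using D(2) B0(2) by (auto simp: tail_union_def C_def)
  qed (intro sets.Diff tail_union_sets limsup_set_sets)
  also have "\<dots> < \<epsilon> * d / 2" by (rule TL)
  finally have "d * measure U (\<Union>k\<in>D. dyadic_enum k) < d * (\<epsilon> / 2)" by (simp add: mult.commute)
  then have mD: "measure U (\<Union>k\<in>D. dyadic_enum k) < \<epsilon> / 2" using d by simp
  have sB: "(\<Union>k\<in>B. dyadic_enum k) \<in> sets U" "(\<Union>k\<in>D. dyadic_enum k) \<in> sets U"
    using s B0(1) D by (auto simp: B_def intro!: sets.finite_UN)
  have "measure U (A \<inter> ?L) \<le> measure U (\<Union>k\<in>C. dyadic_enum k)"
    using C1 dyadic_enum_sets by (intro U.finite_measure_mono[OF AC] sets.countable_UN') auto
  also have "\<dots> < measure U (\<Union>k\<in>B0. dyadic_enum k) + \<epsilon> / 2" using mB0 by simp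
  also have "(\<Union>k\<in>B0. dyadic_enum k) = (\<Union>k\<in>B. dyadic_enum k) \<union> (\<Union>k\<in>D. dyadic_enum k)"
    by (auto simp: D_def B_def)
  also have "measure U \<dots> \<le> measure U (\<Union>k\<in>B. dyadic_enum k) + measure U (\<Union>k\<in>D. dyadic_enum k)"
    by (intro measure_Un_le sB)
  finally have "measure U (A \<inter> ?L) - \<epsilon> < measure U (\<Union>k\<in>B. dyadic_enum k)" using mD by simp
  moreover have "B \<subseteq> B0" by (auto simp: B_def)
  moreover have "disjoint_family_on dyadic_enum B" using B0(3) \<open>B \<subseteq> B0\<close> by (rule disjoint_family_on_mono[rotated])
  ultimately show ?thesis using B0(1,2)
    by (intro that[of B]) (auto simp: B_def C_def i_def intro: finite_subset)
qed

section \<open>Blocks of a play form a tree\<close>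

definition haar_block :: "(nat \<Rightarrow> nat set) \<Rightarrow> (nat \<Rightarrow> nat \<Rightarrow> real) \<Rightarrow> nat \<Rightarrow> real \<Rightarrow> real"
  where "haar_block B e k x = (\<Sum>J\<in>B k. e k J * haar J x)"

definition block_set :: "(nat \<Rightarrow> nat set) \<Rightarrow> nat \<Rightarrow> real set"
  where "block_set B k = (\<Union>J\<in>B k. dyadic_enum J)"

text \<open>The part of \<open>[0,1)\<close> that block \<open>k\<close> is to fill. It depends on the blocks and signs of earlier
turns only. For \<open>k \<ge> 1\<close> these are the sets of the tree.\<close>

definition target :: "(nat \<Rightarrow> nat set) \<Rightarrow> (nat \<Rightarrow> nat \<Rightarrow> real) \<Rightarrow> nat \<Rightarrow> real set"
  where "target B e k =
    (if k = 0 then {0..<1} else if k = 1 then block_set B 0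
     else {x. haar_block B e 0 x * haar_block B e (k div 2) x = (if even k then 1 else - 1)})"

text \<open>The constants are chosen for the recursion: a block \<open>p\<close> that lies in \<open>limsup_set M\<close> up to the fraction
\<open>\<delta> / 2\<^bsup>2p+3\<^esup>\<close> has children \<open>k \<le> 2p + 1\<close> that do so up to the fraction \<open>\<delta> / 2\<^bsup>k+1\<^esup>\<close>. This leaves another
\<open>\<delta> / 2\<^bsup>k+1\<^esup>\<close> for the error in filling the target, within a total loss of \<open>\<delta> / 2\<^sup>k\<close>. Indices increase from block to block so
that earlier blocks are constant on the intervals of later ones.\<close>

definition good_block :: "real \<Rightarrow> nat set \<Rightarrow> (nat \<Rightarrow> nat set) \<Rightarrow> (nat \<Rightarrow> nat \<Rightarrow> real) \<Rightarrow> nat \<Rightarrow> bool"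
  where "good_block \<delta> M B e k \<longleftrightarrow>
    finite (B k) \<and> B k \<subseteq> M \<and> B k \<subseteq> {1..} \<and> (\<forall>j<k. \<forall>i\<in>B j. \<forall>J\<in>B k. i < J) \<and>
    disjoint_family_on dyadic_enum (B k) \<and> block_set B k \<subseteq> target B e k \<and>
    (\<forall>J\<in>B k. measure U (dyadic_enum J - limsup_set M) \<le> \<delta> / 2 ^ (2 * k + 3) * measure U (dyadic_enum J)) \<and>
    (if k = 0 then 1 / 4 else (1 - \<delta> / 2 ^ k) * measure U (target B e k)) \<le> measure U (block_set B k) \<and>
    0 < measure U (block_set B k)"

definition unimodular :: "(nat \<Rightarrow> nat set) \<Rightarrow> (nat \<Rightarrow> nat \<Rightarrow> real) \<Rightarrow> nat \<Rightarrow> bool"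
  where "unimodular B e k \<longleftrightarrow> (\<forall>J\<in>B k. \<bar>e k J\<bar> = 1)"

lemma target_cong:
  assumes "\<And>j. j < k \<Longrightarrow> B j = B' j" "\<And>j. j < k \<Longrightarrow> e j = e' j"
  shows "target B e k = target B' e' k"
proof -
  have "haar_block B e j = haar_block B' e' j" "block_set B j = block_set B' j" if "j < k" for j
    using assms[OF that] by (auto simp: haar_block_def[abs_def] block_set_def)
  moreover have "k div 2 < k" "0 < k" if "k \<noteq> 0" using that by auto
  ultimately show ?thesis by (auto simp: target_def)
qed

lemma good_block_cong:
  assumes "\<And>j. j \<le> k \<Longrightarrow> B j = B' j" "\<And>j. j < k \<Longrightarrow> e j = e' j"
  shows "good_block \<delta> M B e k = good_block \<delta> M B' e' k"
proof -
  have "target B e k = target B' e' k" by (rule target_cong) (auto simp: assms)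
  moreover have "block_set B k = block_set B' k" by (simp add: block_set_def assms)
  moreover have "(\<forall>j<k. \<forall>i\<in>B j. \<forall>J\<in>B k. i < J) = (\<forall>j<k. \<forall>i\<in>B' j. \<forall>J\<in>B' k. i < J)"
    using assms(1) by simp
  ultimately show ?thesis using assms(1)[of k] by (simp add: good_block_def)
qed

lemma haar_block_integrable: "integrable U (haar_block B e k)"
  unfolding haar_block_def[abs_def] by (intro Bochner_Integration.integrable_sum) (simp add: H.integrable_tree_fun)

lemma haar_block_meas [measurable]: "haar_block B e k \<in> borel_measurable U"
  using haar_block_integrable by simp

context
  fixes \<delta> :: real and M :: "nat set" and B :: "nat \<Rightarrow> nat set" and e :: "nat \<Rightarrow> nat \<Rightarrow> real"
  assumes \<delta>: "0 < \<delta>" "\<delta> < 1"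
begin

lemma block_set_sets: "good_block \<delta> M B e k \<Longrightarrow> block_set B k \<in> sets U"
  unfolding block_set_def good_block_def using dyadic_enum_sets by (intro sets.finite_UN) auto

lemma abs_haar_block:
  assumes "good_block \<delta> M B e k" "unimodular B e k"
  shows "\<bar>haar_block B e k x\<bar> = indicator (block_set B k) x"
  unfolding haar_block_def block_set_def
  using assms by (intro abs_disjoint_haar_sum) (auto simp: good_block_def unimodular_def)

lemma haar_block_nonzero_iff:
  assumes "good_block \<delta> M B e k" "unimodular B e k"
  shows "haar_block B e k x \<noteq> 0 \<longleftrightarrow> x \<in> block_set B k"
  using abs_haar_block[OF assms, of x] by (cases "x \<in> block_set B k") auto

lemma block_set_subset:
  assumes "1 \<le> k" "good_block \<delta> M B e 0" "unimodular B e 0" "good_block \<delta> M B e k"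
  shows "block_set B k \<subseteq> block_set B 0"
proof -
  have "x \<in> block_set B 0" if "x \<in> target B e k" for x
  proof (cases "k = 1")
    case False
    then have "haar_block B e 0 x \<noteq> 0" using that assms(1) by (auto simp: target_def split: if_splits)
    then show ?thesis using haar_block_nonzero_iff[OF assms(2,3)] by simp
  qed (use that in \<open>simp add: target_def\<close>)
  then show ?thesis using assms(4) by (auto simp: good_block_def)
qed

text \<open>The two halves have equal measure because \<open>b\<^sub>0 b\<^sub>k\<close> has integral \<open>0\<close>, by orthogonality of Haar functions from
different blocks.\<close>

lemma target_children:
  assumes k: "1 \<le> k" and g0: "good_block \<delta> M B e 0" "unimodular B e 0" and gk: "good_block \<delta> M B e k" "unimodular B e k"
  shows "target B e (2 * k) \<union> target B e (2 * k + 1) = block_set B k" (is ?un)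
    and "target B e (2 * k) \<inter> target B e (2 * k + 1) = {}"
    and "target B e (2 * k) \<in> sets U" "target B e (2 * k + 1) \<in> sets U"
    and "measure U (target B e (2 * k)) = measure U (block_set B k) / 2"
    and "measure U (target B e (2 * k + 1)) = measure U (block_set B k) / 2"
proof -
  let ?b = "\<lambda>x. haar_block B e 0 x * haar_block B e k x"
  let ?l = "target B e (2 * k)" and ?r = "target B e (2 * k + 1)"
  have l: "?l = {x. ?b x = 1}" and r: "?r = {x. ?b x = - 1}"
    using k by (auto simp: target_def)
  have b: "\<bar>?b x\<bar> = indicator (block_set B k) x" for x
    using abs_haar_block[OF g0, of x] abs_haar_block[OF gk, of x] block_set_subset[OF k g0 gk(1)]
    by (auto simp: abs_mult indicator_def)
  have "x \<in> ?l \<union> ?r \<longleftrightarrow> x \<in> block_set B k" for x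
    using b[of x] unfolding l r by (auto simp: indicator_def abs_if split: if_splits)
  then show un: ?un by blast
  show dis: "?l \<inter> ?r = {}" unfolding l r by auto
  have "block_set B k \<subseteq> space U" using block_set_sets[OF gk(1)] by (rule sets.sets_into_space)
  then have sub: "?l \<subseteq> space U" "?r \<subseteq> space U" using un by auto
  have bm: "?b \<in> borel_measurable U" by measurable
  have "{x\<in>space U. ?b x = 1} \<in> sets U" "{x\<in>space U. ?b x = - 1} \<in> sets U"
    using bm by measurable
  moreover have "{x\<in>space U. ?b x = 1} = ?l" "{x\<in>space U. ?b x = - 1} = ?r" using sub unfolding l r by auto
  ultimately show ls: "?l \<in> sets U" and rs: "?r \<in> sets U" by simp_all
  have bi: "?b x = indicator ?l x - indicator ?r x" for x
  proof (cases "x \<in> block_set B k")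
    case True
    then have "x \<in> ?l \<or> x \<in> ?r" using un by blast
    then show ?thesis unfolding l r by (auto simp: indicator_def)
  next
    case False
    then have "?b x = 0" using b[of x] by simp
    then show ?thesis unfolding l r by (simp add: indicator_def)
  qed
  have irr: "integrable U (\<lambda>x. haar i x * haar J x)" for i J
    by (rule integrable_bounded_mult[OF H.integrable_tree_fun H.tree_fun_measurable H.abs_tree_fun_le])
  have lt: "i < J" if "i \<in> B 0" "J \<in> B k" for i J using gk(1) that k by (auto simp: good_block_def)
  have "(LINT x|U. ?b x) = (LINT x|U. (\<Sum>i\<in>B 0. \<Sum>J\<in>B k. (e 0 i * e k J) * (haar i x * haar J x)))"
    unfolding haar_block_def sum_product
    by (intro Bochner_Integration.integral_cong sum.cong refl) simp
  also have "\<dots> = (\<Sum>i\<in>B 0. \<Sum>J\<in>B k. (e 0 i * e k J) * (LINT x|U. haar i x * haar J x))"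
    by (subst Bochner_Integration.integral_sum)
      (auto intro!: Bochner_Integration.integrable_sum Bochner_Integration.integrable_mult_right irr sum.cong simp: irr)
  also have "\<dots> = 0" using lt by (intro sum.neutral ballI) (simp add: H.orthogonal less_imp_neq)
  finally have "(LINT x|U. ?b x) = 0" .
  moreover have "(LINT x|U. ?b x) = measure U ?l - measure U ?r"
    unfolding bi using integral_indicator_unit[OF ls] integral_indicator_unit[OF rs] by (simp only: Bochner_Integration.integral_diff)
  ultimately have eq: "measure U ?l = measure U ?r" by simp
  have "measure U (block_set B k) = measure U ?l + measure U ?r"
    unfolding un[symmetric] by (rule U.finite_measure_Union[OF ls rs dis])
  then show "measure U ?l = measure U (block_set B k) / 2" "measure U ?r = measure U (block_set B k) / 2"
    using eq by simp_all
qed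

lemma block_set_full:
  assumes g: "good_block \<delta> M B e k"
  shows "measure U (block_set B k - limsup_set M) \<le> \<delta> / 2 ^ (2 * k + 3) * measure U (block_set B k)"
proof -
  have f: "finite (B k)" "B k \<subseteq> {1..}" "disjoint_family_on dyadic_enum (B k)" using g by (auto simp: good_block_def)
  have s: "J \<in> B k \<Longrightarrow> dyadic_enum J - limsup_set M \<in> sets U" for J
    using f(2) dyadic_enum_sets limsup_set_sets by (intro sets.Diff) auto
  have "measure U (block_set B k - limsup_set M) = measure U (\<Union>J\<in>B k. dyadic_enum J - limsup_set M)"
    by (simp add: block_set_def)
  also have "\<dots> \<le> (\<Sum>J\<in>B k. measure U (dyadic_enum J - limsup_set M))"
    using s by (intro measure_UNION_le f(1)) auto
  also have "\<dots> \<le> (\<Sum>J\<in>B k. \<delta> / 2 ^ (2 * k + 3) * measure U (dyadic_enum J))"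
    using g by (intro sum_mono) (auto simp: good_block_def)
  also have "\<dots> = \<delta> / 2 ^ (2 * k + 3) * measure U (block_set B k)"
    unfolding block_set_def measure_disjoint_union[OF f] sum_distrib_left ..
  finally show ?thesis .
qed

text \<open>The last claim says that the target does not cut intervals of large index, as the blocks that define it are
constant on them. This is what \<open>dyadic_cover_in_limsup\<close> asks for.\<close>

lemma target_full:
  assumes k: "1 \<le> k" and good: "\<And>j. j < k \<Longrightarrow> good_block \<delta> M B e j" and sg: "\<And>j. j < k \<Longrightarrow> unimodular B e j"
  shows "target B e k \<in> sets U" "0 < measure U (target B e k)"
    "measure U (target B e k - limsup_set M) \<le> \<delta> / 2 ^ (k + 1) * measure U (target B e k)"
    "\<exists>m. \<forall>J\<ge>m. 1 \<le> J \<longrightarrow> dyadic_enum J \<subseteq> target B e k \<or> dyadic_enum J \<inter> target B e k = {}"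
proof -
  define p where "p = (if k = 1 then 0 else k div 2)"
  have pk: "p < k" "k \<le> 2 * p + 1" using k by (auto simp: p_def)
  have g0: "good_block \<delta> M B e 0" "unimodular B e 0" using good[of 0] sg[of 0] k by auto
  have gp: "good_block \<delta> M B e p" "unimodular B e p" using good[OF pk(1)] sg[OF pk(1)] by auto
  have main: "target B e k \<in> sets U \<and> target B e k \<subseteq> block_set B p \<and> measure U (block_set B p) \<le> 2 * measure U (target B e k)
    \<and> measure U (block_set B p) / 2 \<le> measure U (target B e k)"
  proof (cases "k = 1")
    case True
    then show ?thesis using block_set_sets[OF g0(1)] by (simp add: p_def target_def)
  next
    case False
    then have p1: "1 \<le> p" and kp: "k = 2 * p \<or> k = 2 * p + 1" using k by (auto simp: p_def)
    from kp show ?thesis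
    proof
      assume "k = 2 * p"
      then show ?thesis using target_children[OF p1 g0 gp] by auto
    next
      assume "k = 2 * p + 1"
      then show ?thesis using target_children[OF p1 g0 gp] by auto
    qed
  qed
  then show ts: "target B e k \<in> sets U" by simp
  show "0 < measure U (target B e k)" using main gp(1) by (simp add: good_block_def)
  have "measure U (target B e k - limsup_set M) \<le> measure U (block_set B p - limsup_set M)"
    using main block_set_sets[OF gp(1)] limsup_set_sets by (intro U.finite_measure_mono) auto
  also have "\<dots> \<le> \<delta> / 2 ^ (2 * p + 3) * measure U (block_set B p)" by (rule block_set_full[OF gp(1)])
  also have "\<dots> \<le> \<delta> / 2 ^ (2 * p + 3) * (2 * measure U (target B e k))"
    using main \<delta> by (intro mult_left_mono) auto
  also have "\<dots> = \<delta> / 2 ^ (2 * p + 2) * measure U (target B e k)" by (simp add: power_add)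
  also have "\<dots> \<le> \<delta> / 2 ^ (k + 1) * measure U (target B e k)"
    using pk \<delta> by (intro mult_right_mono divide_left_mono power_increasing) auto
  finally show "measure U (target B e k - limsup_set M) \<le> \<delta> / 2 ^ (k + 1) * measure U (target B e k)" .
  have fin: "finite (B 0 \<union> B p)" using g0 gp by (auto simp: good_block_def)
  define m where "m = Suc (Max (insert 0 (B 0 \<union> B p)))"
  have mB: "i < m" if "i \<in> B 0 \<union> B p" for i using fin that by (auto simp: m_def less_Suc_eq_le)
  have const: "haar_block B e q x = haar_block B e q y"
    if "q = 0 \<or> q = p" "m \<le> J" "1 \<le> J" "x \<in> dyadic_enum J" "y \<in> dyadic_enum J" for q J x y
  proof -
    have "haar i x = haar i y" if "i \<in> B q" for i
    proof -
      have "i < J" using mB[of i] that \<open>q = 0 \<or> q = p\<close> \<open>m \<le> J\<close> by auto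
      then show ?thesis using H.tree_fun_on_node[OF \<open>1 \<le> J\<close>, of i] \<open>x \<in> _\<close> \<open>y \<in> _\<close> by simp
    qed
    then show ?thesis by (simp add: haar_block_def)
  qed
  have mem: "x \<in> target B e k \<longleftrightarrow> (if k = 1 then haar_block B e 0 x \<noteq> 0
      else haar_block B e 0 x * haar_block B e p x = (if even k then 1 else - 1))" for x
    using haar_block_nonzero_iff[OF g0, of x] k by (auto simp: target_def p_def)
  have "dyadic_enum J \<subseteq> target B e k \<or> dyadic_enum J \<inter> target B e k = {}" if J: "m \<le> J" "1 \<le> J" for J
  proof -
    have "x \<in> target B e k \<longleftrightarrow> y \<in> target B e k" if "x \<in> dyadic_enum J" "y \<in> dyadic_enum J" for x y
      using const[of 0 J x y] const[of p J x y] J that unfolding mem by simp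
    then show ?thesis by blast
  qed
  then show "\<exists>m. \<forall>J\<ge>m. 1 \<le> J \<longrightarrow> dyadic_enum J \<subseteq> target B e k \<or> dyadic_enum J \<inter> target B e k = {}" by blast
qed

text \<open>The number \<open>low\<close> is a lower bound for the measure of the block that is known before the block is chosen;
it provides the normalization bound in \<open>block_near_subspace\<close>.\<close>

lemma good_block_exists:
  assumes L: "1 / 2 \<le> measure U (limsup_set M)"
    and good: "\<And>j. j < k \<Longrightarrow> good_block \<delta> M B e j" and sg: "\<And>j. j < k \<Longrightarrow> unimodular B e j"
    and W: "W \<in> cof" and G: "G \<in> cof_wstar" and tol: "0 < tol"
  shows "\<exists>E. good_block \<delta> M (B(k := E)) e k \<and> (\<forall>s. (\<forall>J\<in>E. \<bar>s J\<bar> = 1) \<longrightarrow>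
    infdist (\<Sum>J\<in>E. (s J / measure U (block_set (B(k := E)) k)) *\<^sub>R abs_L1 (haar J)) W < tol \<and>
    infdist (\<Sum>J\<in>E. s J *\<^sub>R haar_dual J) G < tol)"
proof -
  define T where "T = target B e k"
  \<comment> \<open>For \<open>k = 0\<close> half of \<open>[0,1)\<close> can be covered, which leaves \<open>1/4\<close> after an error of \<open>1/4\<close>.\<close>
  define low where "low = (if k = 0 then 1 / 4 else (1 - \<delta> / 2 ^ k) * measure U T)"
  define \<epsilon> where "\<epsilon> = (if k = 0 then 1 / 4 else \<delta> / 2 ^ (k + 1) * measure U T)"
  have \<delta>k: "\<delta> / 2 ^ k < 1"
  proof -
    have "\<delta> / 2 ^ k \<le> \<delta> / 1" using \<delta> by (intro divide_left_mono) auto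
    also have "\<dots> < 1" using \<delta> by simp
    finally show ?thesis .
  qed
  have "T \<in> sets U \<and> 0 < low \<and> 0 < \<epsilon> \<and> low \<le> measure U (T \<inter> limsup_set M) - \<epsilon> \<and>
    (\<exists>m. \<forall>J\<ge>m. 1 \<le> J \<longrightarrow> dyadic_enum J \<subseteq> T \<or> dyadic_enum J \<inter> T = {})"
  proof (cases "k = 0")
    case True
    have T1: "T = {0..<1}" using True by (simp add: T_def target_def)
    have sub: "dyadic_enum J \<subseteq> T" if "1 \<le> J" for J
      unfolding T1 by (rule dyadic_enum_subset_unit[OF that])
    have "limsup_set M \<subseteq> T"
    proof
      fix x assume "x \<in> limsup_set M"
      then have "x \<in> tail_union M 0" unfolding limsup_set_def by blast
      then obtain J where "1 \<le> J" "x \<in> dyadic_enum J" unfolding tail_union_def by blast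
      then show "x \<in> T" using sub by blast
    qed
    then have "T \<inter> limsup_set M = limsup_set M" by blast
    then show ?thesis using True L sub dyadic_enum_sets[of 1] unfolding dyadic_enum_1 T1[symmetric]
      by (auto simp: low_def \<epsilon>_def)
  next
    case False
    then have k1: "1 \<le> k" by simp
    note tf = target_full[OF k1 good sg, folded T_def]
    have Tp: "0 < measure U T" and TL: "measure U (T - limsup_set M) \<le> \<delta> / 2 ^ (k + 1) * measure U T"
      and Ts: "T \<in> sets U" using tf by blast+
    have "measure U T = measure U (T \<inter> limsup_set M) + measure U (T - limsup_set M)"
    proof -
      have "measure U ((T \<inter> limsup_set M) \<union> (T - limsup_set M)) = measure U (T \<inter> limsup_set M) + measure U (T - limsup_set M)"
        using Ts limsup_set_sets by (intro U.finite_measure_Union) auto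
      moreover have "(T \<inter> limsup_set M) \<union> (T - limsup_set M) = T" by blast
      ultimately show ?thesis by simp
    qed
    have "(1 - \<delta> / 2 ^ k) * measure U T \<le> measure U (T \<inter> limsup_set M) - \<delta> / 2 ^ (k + 1) * measure U T"
    proof -
      have "(1 - \<delta> / 2 ^ k) * measure U T = measure U T - 2 * (\<delta> / 2 ^ (k + 1) * measure U T)"
        by (simp add: left_diff_distrib)
      then show ?thesis
        using TL \<open>measure U T = measure U (T \<inter> limsup_set M) + measure U (T - limsup_set M)\<close> by linarith
    qed
    then show ?thesis using False Ts Tp tf(4) \<delta> \<delta>k by (simp add: low_def \<epsilon>_def)
  qed
  then obtain m where Ts: "T \<in> sets U" and low: "0 < low" "low \<le> measure U (T \<inter> limsup_set M) - \<epsilon>" and \<epsilon>: "0 < \<epsilon>"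
    and m: "\<forall>J\<ge>m. 1 \<le> J \<longrightarrow> dyadic_enum J \<subseteq> T \<or> dyadic_enum J \<inter> T = {}" by blast
  obtain Na where Na: "\<And>E s w. finite E \<and> E \<subseteq> {1..} \<and> E \<subseteq> {Na..} \<and> disjoint_family_on dyadic_enum E \<and>
    (\<forall>J\<in>E. \<bar>s J\<bar> = 1) \<and> low \<le> w \<Longrightarrow> infdist (\<Sum>J\<in>E. (s J / w) *\<^sub>R abs_L1 (haar J)) W < tol"
    using block_near_subspace[OF W tol low(1)] by blast
  obtain Nb where Nb: "\<And>E s. finite E \<and> E \<subseteq> {1..} \<and> E \<subseteq> {Nb..} \<and> disjoint_family_on dyadic_enum E \<and>
    (\<forall>J\<in>E. \<bar>s J\<bar> = 1) \<Longrightarrow> infdist (\<Sum>J\<in>E. s J *\<^sub>R haar_dual J) G < tol"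
    using dual_block_near_subspace[OF G tol] by blast
  have fin: "finite (\<Union>j<k. B j)" using good by (auto simp: good_block_def)
  define Nc where "Nc = Suc (Max (insert 0 (\<Union>j<k. B j)))"
  have Nc: "i < Nc" if "i \<in> B j" "j < k" for i j
  proof -
    have "i \<le> Max (insert 0 (\<Union>j<k. B j))" using fin that by (intro Max_ge) auto
    then show ?thesis by (simp add: Nc_def)
  qed
  define d where "d = \<delta> / 2 ^ (2 * k + 3)"
  have d: "0 < d" using \<delta> by (simp add: d_def)
  obtain E where E: "finite E" "E \<subseteq> M" "E \<subseteq> {1..}" "E \<subseteq> {max Na (max Nb Nc)..}" "disjoint_family_on dyadic_enum E"
    "\<And>J. J \<in> E \<Longrightarrow> dyadic_enum J \<subseteq> T"
    "\<And>J. J \<in> E \<Longrightarrow> measure U (dyadic_enum J - limsup_set M) \<le> d * measure U (dyadic_enum J)"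
    "measure U (T \<inter> limsup_set M) - \<epsilon> < measure U (\<Union>J\<in>E. dyadic_enum J)"
    by (rule dyadic_cover_in_limsup[OF Ts m \<epsilon> d, where M = M and n = "max Na (max Nb Nc)"]) (rule that)
  let ?B = "B(k := E)"
  have T': "target ?B e k = T" unfolding T_def by (rule target_cong) auto
  have bs: "block_set ?B k = (\<Union>J\<in>E. dyadic_enum J)" by (simp add: block_set_def)
  have w: "low \<le> measure U (block_set ?B k)" using E(8) low(2) unfolding bs by simp
  have N: "E \<subseteq> {Na..}" "E \<subseteq> {Nb..}" "E \<subseteq> {Nc..}" using E(4) by auto
  have "good_block \<delta> M ?B e k"
    unfolding good_block_def T'
  proof (intro conjI)
    show "\<forall>j<k. \<forall>i\<in>?B j. \<forall>J\<in>?B k. i < J" using Nc N(3) by (auto dest: less_le_trans)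
    show "block_set ?B k \<subseteq> T" using E(6) unfolding bs by blast
    show "\<forall>J\<in>?B k. measure U (dyadic_enum J - limsup_set M) \<le> \<delta> / 2 ^ (2 * k + 3) * measure U (dyadic_enum J)"
      using E(7) by (simp add: d_def)
    show "(if k = 0 then 1 / 4 else (1 - \<delta> / 2 ^ k) * measure U T) \<le> measure U (block_set ?B k)"
      using w by (simp add: low_def)
    show "0 < measure U (block_set ?B k)" using w low(1) by simp
  qed (use E in auto)
  moreover have "infdist (\<Sum>J\<in>E. (s J / measure U (block_set ?B k)) *\<^sub>R abs_L1 (haar J)) W < tol"
    "infdist (\<Sum>J\<in>E. s J *\<^sub>R haar_dual J) G < tol" if "\<forall>J\<in>E. \<bar>s J\<bar> = 1" for s
    using Na[of E s] Nb[of E s] E(1,3,5) N(1,2) w that by blast+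
  ultimately show ?thesis by blast
qed

text \<open>Here \<open>\<sigma>\<close> is the sign of \<open>b\<^sub>0\<close>, extended by \<open>1\<close> off its support. On the set where \<open>b\<^sub>0 b\<^sub>k = \<plusminus>1\<close> the block \<open>b\<^sub>k\<close>
equals \<open>\<plusminus>\<sigma>\<close>, so the blocks are exactly the tree functions.\<close>

lemma good_blocks_tree:
  assumes good: "\<And>k. good_block \<delta> M B e k" and sg: "\<And>k. unimodular B e k"
  defines "\<sigma> \<equiv> \<lambda>x. if haar_block B e 0 x < 0 then - 1 else 1 :: real"
  shows "haar_tree (target B e) \<sigma> \<delta>"
    and "tree_fun (target B e) \<sigma> k = haar_block B e k"
    and "tree_weight (target B e) k = measure U (block_set B k)"
proof -
  note tc = target_children[OF _ good sg good sg]
  show tree: "haar_tree (target B e) \<sigma> \<delta>"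
  proof
    fix k :: nat and x :: real
    show "\<sigma> \<in> borel_measurable U" unfolding \<sigma>_def by measurable
    show "\<sigma> x = 1 \<or> \<sigma> x = - 1" by (simp add: \<sigma>_def)
    show "0 \<le> \<delta>" using \<delta> by simp
    assume k: "1 \<le> k"
    show "target B e k \<in> sets U" "0 < measure U (target B e k)" using target_full[OF k good sg] by blast+
    show "target B e (2 * k) \<union> target B e (2 * k + 1) \<subseteq> target B e k"
      using tc(1)[OF k] good[of k] by (simp add: good_block_def)
    show "target B e (2 * k) \<inter> target B e (2 * k + 1) = {}" by (rule tc(2)[OF k])
    show "measure U (target B e (2 * k)) = measure U (target B e (2 * k + 1))"
      unfolding tc(5,6)[OF k] ..
    show "(1 - \<delta> / 2 ^ k) * measure U (target B e k) \<le> 2 * measure U (target B e (2 * k))"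
      using good[of k] k unfolding tc(5)[OF k] by (simp add: good_block_def)
  qed
  show "tree_weight (target B e) k = measure U (block_set B k)"
    using tc(5)[of k] by (cases "k = 0") (simp_all add: tree_weight_def target_def)
  show "tree_fun (target B e) \<sigma> k = haar_block B e k"
  proof
    fix x
    have b0: "\<bar>haar_block B e 0 x\<bar> = indicator (block_set B 0) x" by (rule abs_haar_block[OF good sg])
    show "tree_fun (target B e) \<sigma> k x = haar_block B e k x"
    proof (cases "k = 0")
      case True
      then show ?thesis using b0
        by (cases "x \<in> block_set B 0") (auto simp: tree_fun_def target_def \<sigma>_def abs_if split: if_splits)
    next
      case False
      then have k: "1 \<le> k" by simp
      have bk: "\<bar>haar_block B e k x\<bar> = indicator (block_set B k) x" by (rule abs_haar_block[OF good sg])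
      have sub: "block_set B k \<subseteq> block_set B 0" by (rule block_set_subset[OF k good sg good])
      have t: "target B e (2 * k) = {x. haar_block B e 0 x * haar_block B e k x = 1}"
        "target B e (2 * k + 1) = {x. haar_block B e 0 x * haar_block B e k x = - 1}"
        using k by (auto simp: target_def)
      consider "x \<notin> block_set B k" | "x \<in> block_set B k" "x \<in> block_set B 0" using sub by blast
      then show ?thesis
      proof cases
        case 1
        then show ?thesis using bk k unfolding tree_fun_def t by simp
      next
        case 2
        then have "haar_block B e k x = 1 \<or> haar_block B e k x = - 1" "haar_block B e 0 x = 1 \<or> haar_block B e 0 x = - 1"
          using bk b0 by (auto simp: abs_if split: if_splits)
        then show ?thesis using k unfolding tree_fun_def t \<sigma>_def by auto
      qed
    qed
  qed
qed

end

section \<open>A winning strategy\<close>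

text \<open>Sums over the support of \<open>a\<close> become sums over an initial segment.\<close>

lemma impartially_equivalentI:
  assumes C: "1 \<le> C" and xy: "\<And>a n. norm (\<Sum>i<n. a i *\<^sub>R x i) \<le> sqrt C * norm (\<Sum>i<n. a i *\<^sub>R y i)"
    and yx: "\<And>a n. norm (\<Sum>i<n. a i *\<^sub>R y i) \<le> norm (\<Sum>i<n. a i *\<^sub>R x i)"
  shows "impartially_equivalent C x y"
  unfolding impartially_equivalent_def
proof (intro allI impI)
  fix a :: "nat \<Rightarrow> real" assume fin: "finite {i. a i \<noteq> 0}"
  define n where "n = Suc (Max (insert 0 {i. a i \<noteq> 0}))"
  have sub: "{i. a i \<noteq> 0} \<subseteq> {..<n}" using fin by (auto simp: n_def less_Suc_eq_le)
  have x: "(\<Sum>i | a i \<noteq> 0. a i *\<^sub>R x i) = (\<Sum>i<n. a i *\<^sub>R x i)" using sub by (intro sum.mono_neutral_left) auto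
  have y: "(\<Sum>i | a i \<noteq> 0. a i *\<^sub>R y i) = (\<Sum>i<n. a i *\<^sub>R y i)" using sub by (intro sum.mono_neutral_left) auto
  have "1 / sqrt C * norm (\<Sum>i<n. a i *\<^sub>R y i) \<le> 1 * norm (\<Sum>i<n. a i *\<^sub>R y i)"
    using C by (intro mult_right_mono) auto
  then show "1 / sqrt C * norm (\<Sum>i | a i \<noteq> 0. a i *\<^sub>R y i) \<le> norm (\<Sum>i | a i \<noteq> 0. a i *\<^sub>R x i) \<and>
      norm (\<Sum>i | a i \<noteq> 0. a i *\<^sub>R x i) \<le> sqrt C * norm (\<Sum>i | a i \<noteq> 0. a i *\<^sub>R y i)"
    unfolding x y using xy[of a n] yx[of a n] by linarith
qed

definition favoured_part :: "nat set \<times> nat set \<Rightarrow> nat"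
  where "favoured_part N = (if 1 / 2 \<le> measure U (limsup_set (fst N)) then 1 else 2)"

definition favoured_set :: "nat set \<times> nat set \<Rightarrow> nat set"
  where "favoured_set N = (if 1 / 2 \<le> measure U (limsup_set (fst N)) then fst N else snd N)"

text \<open>The move in turn \<open>k\<close> is acceptable after the earlier moves \<open>q j\<close> and sign choices \<open>\<epsilon> j\<close>, for \<open>j < k\<close>, when
player (I) has played \<open>p\<close>. The signs \<open>s\<close> are those that player (I) may still choose.\<close>

definition good_move :: "real \<Rightarrow> nat set \<times> nat set \<Rightarrow> (nat \<Rightarrow> step2) \<Rightarrow> (nat \<Rightarrow> step3) \<Rightarrow> nat \<Rightarrow> L1 step1 \<Rightarrow> bool"
  where "good_move \<delta> N q \<epsilon> k p \<longleftrightarrow>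
    part (q k) = favoured_part N \<and>
    lam (q k) = (\<lambda>J\<in>supp (q k). measure U (dyadic_enum J) / measure U (block_set (\<lambda>j. supp (q j)) k)) \<and>
    mu (q k) = (\<lambda>J\<in>supp (q k). 1) \<and>
    good_block \<delta> (favoured_set N) (\<lambda>j. supp (q j)) \<epsilon> k \<and>
    (\<forall>s. (\<forall>J\<in>supp (q k). \<bar>s J\<bar> = 1) \<longrightarrow>
      infdist (\<Sum>J\<in>supp (q k). (s J / measure U (block_set (\<lambda>j. supp (q j)) k)) *\<^sub>R abs_L1 (haar J)) (primal_space p) < tolerance p \<and>
      infdist (\<Sum>J\<in>supp (q k). s J *\<^sub>R haar_dual J) (dual_space p) < tolerance p)"

lemma good_move_cong:
  assumes "\<And>j. j \<le> k \<Longrightarrow> q j = q' j" "\<And>j. j < k \<Longrightarrow> \<epsilon> j = \<epsilon>' j"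
  shows "good_move \<delta> N q \<epsilon> k p = good_move \<delta> N q' \<epsilon>' k p"
proof -
  have "good_block \<delta> (favoured_set N) (\<lambda>j. supp (q j)) \<epsilon> k = good_block \<delta> (favoured_set N) (\<lambda>j. supp (q' j)) \<epsilon>' k"
    by (rule good_block_cong) (simp_all add: assms)
  moreover have "block_set (\<lambda>j. supp (q j)) k = block_set (\<lambda>j. supp (q' j)) k"
    by (simp add: block_set_def assms)
  moreover have "q k = q' k" using assms(1) by simp
  ultimately show ?thesis unfolding good_move_def by simp
qed

text \<open>Any acceptable move will do. The function given to \<open>good_move\<close> has the earlier moves below the length of the
history and the candidate at that position, and \<open>good_move\<close> looks at these positions only.\<close>

definition haar_strategy :: "real \<Rightarrow> L1 strategy"
  where "haar_strategy \<delta> N hist p = (SOME q.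
    good_move \<delta> N ((\<lambda>j. fst (snd (hist ! j)))(length hist := q)) (\<lambda>j. snd (snd (hist ! j))) (length hist) p)"

lemma legal_signs: "legal_step3 q s \<Longrightarrow> J \<in> supp q \<Longrightarrow> \<bar>s J\<bar> = 1"
  unfolding legal_step3_def by (auto dest!: PiE_mem)

text \<open>By induction the earlier blocks are good, so \<open>good_block_exists\<close> provides an acceptable move and the chosen
one is acceptable.\<close>

lemma haar_strategy_good:
  assumes \<delta>: "0 < \<delta>" "\<delta> < 1" and N: "N1 \<union> N2 = UNIV" and p: "\<And>k. legal_step1 (p k)"
    and q: "\<And>k. q k = haar_strategy \<delta> (N1, N2) (map (\<lambda>j. (p j, q j, \<epsilon> j)) [0..<k]) (p k)"
    and \<epsilon>: "\<And>k. legal_step3 (q k) (\<epsilon> k)"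
  shows "good_move \<delta> (N1, N2) q \<epsilon> k (p k)"
proof (induction k rule: less_induct)
  case (less k)
  let ?N = "(N1, N2)"
  let ?M = "favoured_set ?N"
  let ?hist = "map (\<lambda>j. (p j, q j, \<epsilon> j)) [0..<k]"
  let ?B = "\<lambda>j. supp (q j)"
  have L: "1 / 2 \<le> measure U (limsup_set ?M)"
    using limsup_sets_measure[OF N] by (auto simp: favoured_set_def)
  have good: "good_block \<delta> ?M ?B \<epsilon> j" if "j < k" for j using less[OF that] by (simp add: good_move_def)
  have sg: "unimodular ?B \<epsilon> j" for j using legal_signs[OF \<epsilon>] by (simp add: unimodular_def)
  have "primal_space (p k) \<in> cof" "dual_space (p k) \<in> cof_wstar" "0 < tolerance (p k)"
    using p[of k] by (auto simp: legal_step1_def)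
  from good_block_exists[OF \<delta> L good sg this]
  obtain E where E: "good_block \<delta> ?M (?B(k := E)) \<epsilon> k"
    "\<forall>s. (\<forall>J\<in>E. \<bar>s J\<bar> = 1) \<longrightarrow>
      infdist (\<Sum>J\<in>E. (s J / measure U (block_set (?B(k := E)) k)) *\<^sub>R abs_L1 (haar J)) (primal_space (p k)) < tolerance (p k) \<and>
      infdist (\<Sum>J\<in>E. s J *\<^sub>R haar_dual J) (dual_space (p k)) < tolerance (p k)"
    by blast
  define r where "r = \<lparr>part = favoured_part ?N, supp = E,
    lam = (\<lambda>J\<in>E. measure U (dyadic_enum J) / measure U (block_set (?B(k := E)) k)), mu = (\<lambda>J\<in>E. 1)\<rparr>"
  have supp_r: "(\<lambda>j. supp ((q(k := r)) j)) = ?B(k := E)" by (rule ext) (simp add: r_def)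
  have "good_move \<delta> ?N (q(k := r)) \<epsilon> k (p k)"
    unfolding good_move_def supp_r using E by (simp add: r_def)
  moreover have "good_move \<delta> ?N (q(k := r)) \<epsilon> k (p k) =
      good_move \<delta> ?N ((\<lambda>j. fst (snd (?hist ! j)))(length ?hist := r)) (\<lambda>j. snd (snd (?hist ! j))) (length ?hist) (p k)" for r
    unfolding length_map length_upt diff_zero by (rule good_move_cong) auto
  ultimately have "good_move \<delta> ?N (q(k := haar_strategy \<delta> ?N ?hist (p k))) \<epsilon> k (p k)"
    unfolding haar_strategy_def by (metis (mono_tags, lifting) someI)
  then show ?case using q[of k] by (metis fun_upd_triv)
qed

lemma good_move_block:
  assumes "good_move \<delta> N q \<epsilon> k p"
  shows "block normalized_haar (q k) s =
      (\<Sum>J\<in>supp (q k). (s J / measure U (block_set (\<lambda>j. supp (q j)) k)) *\<^sub>R abs_L1 (haar J))"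
    and "dual_block normalized_haar (q k) s = (\<Sum>J\<in>supp (q k). s J *\<^sub>R haar_dual J)"
proof -
  let ?w = "measure U (block_set (\<lambda>j. supp (q j)) k)"
  have J: "1 \<le> J" if "J \<in> supp (q k)" for J using assms that by (auto simp: good_move_def good_block_def)
  have "(s J * lam (q k) J) *\<^sub>R normalized_haar J = (s J / ?w) *\<^sub>R abs_L1 (haar J)" if "J \<in> supp (q k)" for J
    using assms that haar_weight_eq[OF J[OF that]] H.A_pos[OF J[OF that]]
    by (simp add: good_move_def normalized_haar_eq)
  then show "block normalized_haar (q k) s = (\<Sum>J\<in>supp (q k). (s J / ?w) *\<^sub>R abs_L1 (haar J))"
    unfolding block_def by (intro sum.cong refl)
  show "dual_block normalized_haar (q k) s = (\<Sum>J\<in>supp (q k). s J *\<^sub>R haar_dual J)"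
    unfolding dual_block_def using assms by (intro sum.cong refl) (simp add: good_move_def biorthogonal_haar)
qed

lemma good_move_legal:
  assumes g: "good_move \<delta> (N1, N2) q \<epsilon> k p" and \<eta>: "0 < \<eta>"
  shows "legal_step2 \<eta> N1 N2 (q k)"
proof -
  let ?w = "measure U (block_set (\<lambda>j. supp (q j)) k)"
  have gb: "good_block \<delta> (favoured_set (N1, N2)) (\<lambda>j. supp (q j)) \<epsilon> k" using g by (simp add: good_move_def)
  then have f: "finite (supp (q k))" "supp (q k) \<subseteq> {1..}" "disjoint_family_on dyadic_enum (supp (q k))"
    and sub: "supp (q k) \<subseteq> favoured_set (N1, N2)" and w: "0 < ?w" by (auto simp: good_block_def)
  have "(\<Sum>J\<in>supp (q k). lam (q k) J * mu (q k) J) = (\<Sum>J\<in>supp (q k). measure U (dyadic_enum J)) / ?w"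
    unfolding sum_divide_distrib using g by (intro sum.cong refl) (simp add: good_move_def)
  also have "\<dots> = 1" using w unfolding measure_disjoint_union[OF f, symmetric] by (simp add: block_set_def)
  finally have "(\<Sum>J\<in>supp (q k). lam (q k) J * mu (q k) J) = 1" .
  moreover have "lam (q k) \<in> supp (q k) \<rightarrow>\<^sub>E {0..}" "mu (q k) \<in> supp (q k) \<rightarrow>\<^sub>E {0..}"
    using g by (auto simp: good_move_def)
  moreover have "part (q k) = 1 \<and> supp (q k) \<subseteq> N1 \<or> part (q k) = 2 \<and> supp (q k) \<subseteq> N2"
    using g sub by (auto simp: good_move_def favoured_part_def favoured_set_def)
  ultimately show ?thesis using \<eta> f(1) by (simp add: legal_step2_def)
qed

text \<open>Comparison of the block tree, of loss \<open>\<delta>\<close>, with the dyadic tree, of loss \<open>0\<close>. The estimate in \<open>L\<^sup>1\<close> has constant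
\<open>1 + 4\<delta>\<close> in one direction and \<open>1\<close> in the other one; the dual norms agree.\<close>

lemma haar_blocks_equivalent:
  assumes \<delta>: "0 < \<delta>" "\<delta> < 1" and C: "1 + 4 * \<delta> \<le> sqrt C"
    and good: "\<And>k. good_block \<delta> M B e k" and sg: "\<And>k. unimodular B e k"
  shows "impartially_equivalent C
      (\<lambda>k. \<Sum>J\<in>B k. (e k J / measure U (block_set B k)) *\<^sub>R abs_L1 (haar J)) normalized_haar"
    and "impartially_equivalent C (\<lambda>k. \<Sum>J\<in>B k. e k J *\<^sub>R haar_dual J) haar_dual"
proof -
  define \<sigma> :: "real \<Rightarrow> real" where "\<sigma> = (\<lambda>x. if haar_block B e 0 x < 0 then - 1 else 1)"
  note bt = good_blocks_tree[OF \<delta> good sg, folded \<sigma>_def]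
  have T: "haar_tree (target B e) \<sigma> \<delta>" and r: "tree_fun (target B e) \<sigma> k = haar_block B e k"
    and w: "tree_weight (target B e) k = measure U (block_set B k)" for k by (rule bt)+
  have C1: "1 \<le> sqrt C" using C \<delta> by linarith
  then have C1': "1 \<le> C" by simp
  have fin: "finite (B k)" for k using good[of k] by (simp add: good_block_def)
  have x: "(\<Sum>J\<in>B k. (e k J / measure U (block_set B k)) *\<^sub>R abs_L1 (haar J)) = (1 / measure U (block_set B k)) *\<^sub>R abs_L1 (haar_block B e k)" for k
  proof -
    have "abs_L1 (haar_block B e k) = (\<Sum>J\<in>B k. e k J *\<^sub>R abs_L1 (haar J))"
      unfolding haar_block_def[abs_def] by (rule abs_L1_sum[symmetric, OF fin H.integrable_tree_fun])
    then show ?thesis by (simp add: scaleR_sum_right)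
  qed
  have norm_x: "norm (\<Sum>k<n. a k *\<^sub>R (\<Sum>J\<in>B k. (e k J / measure U (block_set B k)) *\<^sub>R abs_L1 (haar J)))
    = (LINT x|U. \<bar>\<Sum>k<n. a k / tree_weight (target B e) k * tree_fun (target B e) \<sigma> k x\<bar>)" for a n
  proof -
    have "(\<Sum>k<n. a k *\<^sub>R (\<Sum>J\<in>B k. (e k J / measure U (block_set B k)) *\<^sub>R abs_L1 (haar J)))
      = (\<Sum>k<n. (a k / measure U (block_set B k)) *\<^sub>R abs_L1 (haar_block B e k))"
      unfolding x by simp
    also have "\<dots> = abs_L1 (\<lambda>x. \<Sum>k<n. a k / measure U (block_set B k) * haar_block B e k x)"
      by (rule abs_L1_sum) (simp_all add: haar_block_integrable)
    finally show ?thesis unfolding r w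
      by (simp add: norm_abs_L1 Bochner_Integration.integrable_sum haar_block_integrable)
  qed
  have norm_h: "norm (\<Sum>k<n. a k *\<^sub>R normalized_haar k) = (LINT x|U. \<bar>\<Sum>k<n. a k / haar_weight k * haar k x\<bar>)" for a n
    unfolding haar_sum_eq[OF finite_lessThan]
    by (intro norm_abs_L1 Bochner_Integration.integrable_sum) (simp add: H.integrable_tree_fun)
  show "impartially_equivalent C
      (\<lambda>k. \<Sum>J\<in>B k. (e k J / measure U (block_set B k)) *\<^sub>R abs_L1 (haar J)) normalized_haar"
  proof (rule impartially_equivalentI[OF C1'])
    fix a n
    show "norm (\<Sum>k<n. a k *\<^sub>R (\<Sum>J\<in>B k. (e k J / measure U (block_set B k)) *\<^sub>R abs_L1 (haar J)))
      \<le> sqrt C * norm (\<Sum>k<n. a k *\<^sub>R normalized_haar k)"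
      using tree_norm_compare[OF T H.haar_tree_axioms, of a n] mult_right_mono[OF C norm_ge_zero[of "\<Sum>k<n. a k *\<^sub>R normalized_haar k"]]
      unfolding norm_x norm_h by linarith
    show "norm (\<Sum>k<n. a k *\<^sub>R normalized_haar k)
      \<le> norm (\<Sum>k<n. a k *\<^sub>R (\<Sum>J\<in>B k. (e k J / measure U (block_set B k)) *\<^sub>R abs_L1 (haar J)))"
      using tree_norm_compare[OF H.haar_tree_axioms T, of a n] unfolding norm_x norm_h by simp
  qed
  have d: "(\<Sum>J\<in>B k. e k J *\<^sub>R haar_dual J) = dual_of (tree_fun (target B e) \<sigma> k)" for k
    unfolding r haar_dual_def haar_block_def[abs_def]
    by (rule dual_of_sum[where M = "\<lambda>_. 1"]) (auto simp: fin H.abs_tree_fun_le H.tree_fun_measurable)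
  have eq: "norm (\<Sum>k<n. a k *\<^sub>R (\<Sum>J\<in>B k. e k J *\<^sub>R haar_dual J)) = norm (\<Sum>k<n. a k *\<^sub>R haar_dual k)" for a n
    unfolding d unfolding haar_dual_def by (rule tree_dual_norm_eq[OF T H.haar_tree_axioms])
  show "impartially_equivalent C (\<lambda>k. \<Sum>J\<in>B k. e k J *\<^sub>R haar_dual J) haar_dual"
  proof (rule impartially_equivalentI[OF C1'])
    fix a n
    show "norm (\<Sum>k<n. a k *\<^sub>R (\<Sum>J\<in>B k. e k J *\<^sub>R haar_dual J)) \<le> sqrt C * norm (\<Sum>k<n. a k *\<^sub>R haar_dual k)"
      unfolding eq using mult_right_mono[OF C1 norm_ge_zero[of "\<Sum>k<n. a k *\<^sub>R haar_dual k"]] by simp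
  qed (simp add: eq)
qed

lemma haar_strategy_winning:
  assumes \<delta>: "0 < \<delta>" "\<delta> < 1" and C: "1 + 4 * \<delta> \<le> sqrt (1 + \<eta>)" and \<eta>: "0 < \<eta>"
  shows "winning_strategy normalized_haar 1 \<eta> (haar_strategy \<delta>)"
  unfolding winning_strategy_def
proof (intro allI impI, elim conjE)
  fix N1 N2 p q \<epsilon>
  assume N: "N1 \<union> N2 = UNIV" and p: "\<forall>k. legal_step1 (p k)"
    and q: "\<forall>k. q k = haar_strategy \<delta> (N1, N2) (map (\<lambda>j. (p j, q j, \<epsilon> j)) [0..<k]) (p k)"
    and \<epsilon>: "\<forall>k. legal_step3 (q k) (\<epsilon> k)"
  have good: "good_move \<delta> (N1, N2) q \<epsilon> k (p k)" for k
    using haar_strategy_good[OF \<delta> N, of p q \<epsilon> k] p q \<epsilon> by blast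
  let ?B = "\<lambda>k. supp (q k)"
  have gb: "good_block \<delta> (favoured_set (N1, N2)) ?B \<epsilon> k" for k using good[of k] by (simp add: good_move_def)
  have abs1: "\<forall>J\<in>?B k. \<bar>\<epsilon> k J\<bar> = 1" for k using legal_signs \<epsilon> by blast
  then have sg: "unimodular ?B \<epsilon> k" for k by (simp add: unimodular_def)
  have bl: "block normalized_haar (q k) (\<epsilon> k) = (\<Sum>J\<in>?B k. (\<epsilon> k J / measure U (block_set ?B k)) *\<^sub>R abs_L1 (haar J))"
    "dual_block normalized_haar (q k) (\<epsilon> k) = (\<Sum>J\<in>?B k. \<epsilon> k J *\<^sub>R haar_dual J)" for k
    by (rule good_move_block[OF good])+
  have near: "infdist (block normalized_haar (q k) (\<epsilon> k)) (primal_space (p k)) < tolerance (p k)"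
    "infdist (dual_block normalized_haar (q k) (\<epsilon> k)) (dual_space (p k)) < tolerance (p k)" for k
    using good[of k] abs1[of k] unfolding bl good_move_def by blast+
  have "wins_II normalized_haar 1 \<eta> p q \<epsilon>"
    unfolding wins_II_def biorthogonal_haar[abs_def]
    using haar_blocks_equivalent[OF \<delta> C gb sg] near by (simp add: bl)
  then show "(\<forall>k. legal_step2 \<eta> N1 N2 (q k)) \<and> wins_II normalized_haar 1 \<eta> p q \<epsilon>"
    using good_move_legal[OF good \<eta>] by blast
qed

theorem theorem6p1:
  shows "strategically_reproducible 1 normalized_haar"
  unfolding strategically_reproducible_def
proof (intro conjI allI impI)
  show "normalized_schauder_basis normalized_haar" by (rule normalized_schauder_basis_haar)
  fix \<eta> :: real assume \<eta>: "0 < \<eta>"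
  define \<delta> where "\<delta> = min (1 / 2) ((sqrt (1 + \<eta>) - 1) / 4)"
  have "1 < sqrt (1 + \<eta>)" using \<eta> by simp
  moreover have "\<delta> \<le> (sqrt (1 + \<eta>) - 1) / 4" "\<delta> \<le> 1 / 2"
    unfolding \<delta>_def by (rule min.cobounded2, rule min.cobounded1)
  moreover from calculation have "0 < \<delta>" unfolding \<delta>_def by simp
  moreover from calculation have "4 * \<delta> \<le> sqrt (1 + \<eta>) - 1" by simp
  ultimately have "0 < \<delta>" "\<delta> < 1" "1 + 4 * \<delta> \<le> sqrt (1 + \<eta>)" by simp_all
  then show "\<exists>\<sigma>. winning_strategy normalized_haar 1 \<eta> \<sigma>" using haar_strategy_winning[OF _ _ _ \<eta>] by blast
qed

end
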